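(* Let $n,k,\delta$ be positive integers such that $\delta$ is a multiple of $k$. Suppose one of the following conditions holds. \begin{enumerate} \item $H_{n,k}$ is non-empty and $\delta\geq (n+3)k$; \item $HE_{n,k}\cap H_{n,k}$ is non-empty and $\delta\geq (n+2)k$. \end{enumerate} Then there exists a Brody hyperbolic smooth hypersurface $W$ of degree $\delta$ in $\mathbb{P}^{n+1}$, such that $W$ is a cyclic cover of $\mathbb{P}^n$ under some linear projection.
   Context: We work over $\mathbb{C}$. A complex analytic space is called Brody hyperbolic if there are no non-constant holomorphic maps from $\mathbb{C}$ to it. A relatively compact open complex subspace $Y\subset X$ is hyperbolically embedded in $X$ if for any two distinct points $p,q\in\overline{Y}$ there are neighborhoods $U_p,U_q$ of $p,q$ in $X$ such that $d_Y(U_p\cap Y,U_q\cap Y)>0$, where $d_Y$ is the Kobayashi pseudodistance. $\mathbb{P}_{n,k}$ is the projective space of dimension $\binom{n+k}{n}-1$ whose points parametrize hypersurfaces of degree $k$ in $\mathbb{P}^n$. $H_{n,k}\subset\mathbb{P}_{n,k}$ is the subset corresponding to Brody hyperbolic hypersurfaces. $HE_{n,k}\subset\mathbb{P}_{n,k}$ is the subset of hypersurfaces of degree $k$ in $\mathbb{P}^n$ whose complement is hyperbolically embedded in $\mathbb{P}^n$. *)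

theory Defs
  imports "HOL-Complex_Analysis.Complex_Analysis" "HOL-Library.Poly_Mapping"
begin

section \<open>Complex projective space\<close>

text \<open>
  Since the dimensions \<open>n\<close> and \<open>n + 1\<close> both occur, vectors of \<open>\<complex>\<^sup>n\<^sup>+\<^sup>1\<close> are functions on \<open>nat\<close>
  vanishing beyond index \<open>n\<close>. A point of projective \<open>n\<close>-space is a punctured line through the
  origin, and the topology is the quotient topology.
\<close>

type_synonym cvec = "nat \<Rightarrow> complex"

definition nonzero_vecs :: "nat \<Rightarrow> cvec set" where
  "nonzero_vecs n = {v. (\<forall>i>n. v i = 0) \<and> (\<exists>i\<le>n. v i \<noteq> 0)}"

definition proj_point :: "cvec \<Rightarrow> cvec set" where
  "proj_point v = {\<lambda>i. c * v i | c. c \<noteq> 0}"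

definition proj_space :: "nat \<Rightarrow> cvec set set" where
  "proj_space n = proj_point ` nonzero_vecs n"

definition proj_topology :: "nat \<Rightarrow> cvec set topology" where
  "proj_topology n = topology (\<lambda>U. U \<subseteq> proj_space n \<and>
     openin (top_of_set (nonzero_vecs n)) {v \<in> nonzero_vecs n. proj_point v \<in> U})"

lemma openin_proj_topology:
  "openin (proj_topology n) U \<longleftrightarrow> U \<subseteq> proj_space n \<and>
     openin (top_of_set (nonzero_vecs n)) {v \<in> nonzero_vecs n. proj_point v \<in> U}"
proof -
  let ?T = "top_of_set (nonzero_vecs n)"
  let ?P = "\<lambda>U. {v \<in> nonzero_vecs n. proj_point v \<in> U}"
  have "istopology (\<lambda>U. U \<subseteq> proj_space n \<and> openin ?T (?P U))"
    unfolding istopology_def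
  proof (intro conjI allI impI)
    fix S T assume "S \<subseteq> proj_space n \<and> openin ?T (?P S)" "T \<subseteq> proj_space n \<and> openin ?T (?P T)"
    moreover have "?P (S \<inter> T) = ?P S \<inter> ?P T" by blast
    ultimately show "S \<inter> T \<subseteq> proj_space n" "openin ?T (?P (S \<inter> T))" by auto
  next
    fix K assume K: "\<forall>S\<in>K. S \<subseteq> proj_space n \<and> openin ?T (?P S)"
    then show "\<Union> K \<subseteq> proj_space n" by blast
    have "?P (\<Union> K) = \<Union> (?P ` K)" by blast
    moreover have "openin ?T (\<Union> (?P ` K))" by (rule openin_Union) (use K in auto)
    ultimately show "openin ?T (?P (\<Union> K))" by simp
  qed
  then show ?thesis by (simp add: proj_topology_def)
qed

lemma topspace_proj_topology: "topspace (proj_topology n) = proj_space n"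
proof -
  have "{v \<in> nonzero_vecs n. proj_point v \<in> proj_space n} = nonzero_vecs n"
    by (auto simp: proj_space_def)
  then have "openin (proj_topology n) (proj_space n)"
    unfolding openin_proj_topology
    by (metis openin_topspace order_refl topspace_euclidean_subtopology)
  then show ?thesis
    by (meson openin_proj_topology openin_subset openin_topspace subset_antisym)
qed

lemma quotient_map_proj_point:
  "quotient_map (top_of_set (nonzero_vecs n)) (proj_topology n) proj_point"
  by (auto simp: quotient_map_def topspace_proj_topology openin_proj_topology proj_space_def)

text \<open>
  A map from an open subset of \<open>\<complex>\<close> to projective space is holomorphic if, locally, it can be written
  in homogeneous coordinates that are holomorphic without common zeros.
\<close>

definition proj_holomorphic_on :: "nat \<Rightarrow> (complex \<Rightarrow> cvec set) \<Rightarrow> complex set \<Rightarrow> bool" where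
  "proj_holomorphic_on n f S \<longleftrightarrow>
     (\<forall>z\<in>S. \<exists>U F. open U \<and> z \<in> U \<and> U \<subseteq> S \<and>
        (\<forall>i. (\<lambda>w. F w i) holomorphic_on U) \<and>
        (\<forall>w\<in>U. F w \<in> nonzero_vecs n \<and> f w = proj_point (F w)))"


section \<open>Hyperbolicity\<close>

text \<open>
  As \<open>\<complex>\<close> is reduced, holomorphic maps from \<open>\<complex>\<close> to a possibly non-reduced closed subspace of
  projective space are the holomorphic maps to projective space with values in its support.
\<close>

definition brody_hyperbolic :: "nat \<Rightarrow> cvec set set \<Rightarrow> bool" where
  "brody_hyperbolic n X \<longleftrightarrow>
     (\<forall>f. proj_holomorphic_on n f UNIV \<and> range f \<subseteq> X \<longrightarrow> f constant_on UNIV)"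

definition poincare_dist :: "complex \<Rightarrow> complex \<Rightarrow> real" where
  "poincare_dist a b = 2 * artanh (cmod ((a - b) / (1 - cnj a * b)))"

text \<open>
  The Kobayashi pseudodistance: the infimum over finite chains of holomorphic discs
  \<open>f i\<close> in \<open>Y\<close> joining \<open>x i = f i (a i)\<close> to \<open>x (i + 1) = f i (b i)\<close>. Extended reals make it \<open>\<infinity>\<close> if
  there is no chain.
\<close>

definition kobayashi_dist :: "nat \<Rightarrow> cvec set set \<Rightarrow> cvec set \<Rightarrow> cvec set \<Rightarrow> ereal" where
  "kobayashi_dist n Y p q =
     Inf {ereal (\<Sum>i<m. poincare_dist (a i) (b i)) | (m::nat) f a b x.
            x 0 = p \<and> x m = q \<and>
            (\<forall>i<m. proj_holomorphic_on n (f i) (ball 0 1) \<and> f i ` ball 0 1 \<subseteq> Y \<and>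
                   a i \<in> ball 0 1 \<and> b i \<in> ball 0 1 \<and>
                   f i (a i) = x i \<and> f i (b i) = x (Suc i))}"

definition kobayashi_setdist :: "nat \<Rightarrow> cvec set set \<Rightarrow> cvec set set \<Rightarrow> cvec set set \<Rightarrow> ereal" where
  "kobayashi_setdist n Y A B = (INF p\<in>A. INF q\<in>B. kobayashi_dist n Y p q)"

definition hyperbolically_embedded :: "nat \<Rightarrow> cvec set set \<Rightarrow> bool" where
  "hyperbolically_embedded n Y \<longleftrightarrow>
     openin (proj_topology n) Y \<and>
     compactin (proj_topology n) (proj_topology n closure_of Y) \<and>
     (\<forall>p \<in> proj_topology n closure_of Y. \<forall>q \<in> proj_topology n closure_of Y. p \<noteq> q \<longrightarrow>
        (\<exists>U V. openin (proj_topology n) U \<and> p \<in> U \<and>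
               openin (proj_topology n) V \<and> q \<in> V \<and>
               kobayashi_setdist n Y (U \<inter> Y) (V \<inter> Y) > 0))"


section \<open>Hypersurfaces\<close>

text \<open>Polynomials in the variables \<open>0, 1, 2, \<dots>\<close>, as finitely supported functions on monomials.\<close>

type_synonym cpoly = "(nat \<Rightarrow>\<^sub>0 nat) \<Rightarrow>\<^sub>0 complex"

definition eval_poly :: "cpoly \<Rightarrow> cvec \<Rightarrow> complex" where
  "eval_poly F v =
     (\<Sum>m\<in>Poly_Mapping.keys F. Poly_Mapping.lookup F m *
        (\<Prod>i\<in>Poly_Mapping.keys m. v i ^ Poly_Mapping.lookup m i))"

text \<open>Forms of degree \<open>k\<close> in the homogeneous coordinates \<open>0, \<dots>, n\<close> (including the zero form).\<close>

definition forms :: "nat \<Rightarrow> nat \<Rightarrow> cpoly set" where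
  "forms n k = {F. \<forall>m\<in>Poly_Mapping.keys F. Poly_Mapping.keys m \<subseteq> {..n} \<and>
                     (\<Sum>i\<in>Poly_Mapping.keys m. Poly_Mapping.lookup m i) = k}"

text \<open>
  The projective space parametrizing hypersurfaces of degree \<open>k\<close> in projective \<open>n\<close>-space: nonzero
  forms up to scaling. Its elements may be reducible or non-reduced.
\<close>

definition proj_form :: "cpoly \<Rightarrow> cpoly set" where
  "proj_form F = {Poly_Mapping.map ((*) c) F | c. c \<noteq> 0}"

definition hypersurfaces :: "nat \<Rightarrow> nat \<Rightarrow> cpoly set set" where
  "hypersurfaces n k = proj_form ` (forms n k - {0})"

definition zero_locus :: "nat \<Rightarrow> cpoly set \<Rightarrow> cvec set set" where
  "zero_locus n X = {proj_point v | v. v \<in> nonzero_vecs n \<and> (\<forall>F\<in>X. eval_poly F v = 0)}"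

definition poly_partial :: "nat \<Rightarrow> cpoly \<Rightarrow> cvec \<Rightarrow> complex" where
  "poly_partial i F v = deriv (\<lambda>z. eval_poly F (v(i := z))) (v i)"

definition smooth_hypersurface :: "nat \<Rightarrow> cpoly set \<Rightarrow> bool" where
  "smooth_hypersurface n X \<longleftrightarrow>
     (\<forall>F\<in>X. \<forall>v\<in>nonzero_vecs n. eval_poly F v = 0 \<longrightarrow> (\<exists>i\<le>n. poly_partial i F v \<noteq> 0))"

definition H :: "nat \<Rightarrow> nat \<Rightarrow> cpoly set set" where
  "H n k = {X \<in> hypersurfaces n k. brody_hyperbolic n (zero_locus n X)}"

definition HE :: "nat \<Rightarrow> nat \<Rightarrow> cpoly set set" where
  "HE n k = {X \<in> hypersurfaces n k. hyperbolically_embedded n (proj_space n - zero_locus n X)}"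


section \<open>Linear projections and cyclic covers\<close>

text \<open>
  The linear map from \<open>\<complex>\<^sup>n\<^sup>+\<^sup>2\<close> to \<open>\<complex>\<^sup>n\<^sup>+\<^sup>1\<close> with matrix \<open>A\<close>. If it is surjective, then its kernel is a line,
  that is, a point \<open>c\<close> of projective \<open>(n + 1)\<close>-space, and it induces the linear projection from \<open>c\<close>
  onto projective \<open>n\<close>-space.
\<close>

definition lin_map :: "nat \<Rightarrow> (nat \<Rightarrow> nat \<Rightarrow> complex) \<Rightarrow> cvec \<Rightarrow> cvec" where
  "lin_map n A v = (\<lambda>i. if i \<le> n then \<Sum>j\<le>n + 1. A i j * v j else 0)"

definition linear_projection :: "nat \<Rightarrow> (nat \<Rightarrow> nat \<Rightarrow> complex) \<Rightarrow> bool" where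
  "linear_projection n A \<longleftrightarrow>
     (\<forall>w\<in>nonzero_vecs n. \<exists>v\<in>nonzero_vecs (n + 1). lin_map n A v = w)"

text \<open>
  The cyclic cover of degree \<open>d\<close> of projective \<open>n\<close>-space defined by a section \<open>s\<close> of \<open>\<O>(d) = \<O>(1)\<^sup>d\<close> is
  the subspace \<open>t\<^sup>d = s\<close> of the total space of \<open>\<O>(1)\<close>, where \<open>t\<close> is the tautological section. By the
  projection from \<open>c\<close>, the complement of \<open>c\<close> in projective \<open>(n + 1)\<close>-space is this total space:
  an isomorphism over projective \<open>n\<close>-space is given by \<open>v \<mapsto> (A v, t v)\<close> for a linear form \<open>t\<close>
  not vanishing at \<open>c\<close>. In particular, \<open>c\<close> does not lie on \<open>W\<close> if \<open>d > 0\<close>.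
\<close>

definition cyclic_cover :: "nat \<Rightarrow> nat \<Rightarrow> (nat \<Rightarrow> nat \<Rightarrow> complex) \<Rightarrow> cvec set set \<Rightarrow> bool" where
  "cyclic_cover n d A W \<longleftrightarrow>
     (\<exists>t :: nat \<Rightarrow> complex. \<exists>s \<in> forms n d - {0}.
        (\<forall>v\<in>nonzero_vecs (n + 1). lin_map n A v = (\<lambda>_. 0) \<longrightarrow> (\<Sum>j\<le>n + 1. t j * v j) \<noteq> 0) \<and>
        W = {proj_point v | v. v \<in> nonzero_vecs (n + 1) \<and>
               (\<Sum>j\<le>n + 1. t j * v j) ^ d = eval_poly s (lin_map n A v)})"

end

theory Submission
  imports Defs "HOL-Real_Asymp.Real_Asymp" "HOL-Library.Diagonal_Subsequence"
    "Jordan_Normal_Form.Spectral_Radius"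
begin

text \<open>
  For \<open>n \<ge> 2\<close> take a form \<open>F\<close> of degree \<open>k\<close> with hyperbolic zero locus, put \<open>m = \<delta> / k \<ge> n + 2\<close>, and
  consider the cyclic covers
  \<open>y ^ \<delta> = u ^ m + (\<Sum>i\<le>n. x\<^sub>i ^ (k * (i + 2)) * u ^ (m - i - 2)) + \<epsilon> * (\<Sum>i\<le>n. x\<^sub>i ^ \<delta>)\<close>
  with \<open>u = F / t\<close>. If none of them were hyperbolic, then Brody's rescaling would give, as \<open>t, \<epsilon> \<rightarrow> 0\<close>,
  a nonconstant entire curve in the cyclic cover (\<open>\<epsilon> = 0\<close>) of the cone over \<open>{F = 0}\<close>, where \<open>u\<close>
  is now an independent variable of weight \<open>k\<close>. Hyperbolicity of \<open>{F = 0}\<close> forces \<open>x = c \<xi>\<close> with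
  \<open>\<xi>\<close> constant, so the curve satisfies \<open>y ^ (k * m) = (\<Prod>l. (u - \<alpha>\<^sub>l * c ^ k) ^ e\<^sub>l)\<close>. There is no
  term in \<open>u ^ (m - 1)\<close> and some coefficient is nonzero, hence at least two of the roots \<open>\<alpha>\<^sub>l\<close> are
  distinct. Hyperplanes and quadrics contain rational curves, so \<open>k \<ge> 3\<close>, and then the zeros of \<open>u - \<alpha> * c ^ k\<close>,
  \<open>u - \<beta> * c ^ k\<close> and \<open>c ^ k\<close> have orders at least 4, 4 and 3. Since \<open>1/4 + 1/4 + 1/3 < 1\<close>, a
  negatively curved metric and Ahlfors' lemma make these functions proportional, and the curve is
  constant. The parameter \<open>\<epsilon>\<close> is there only to make the cover smooth, which holds for all but finitely
  many values. For \<open>n = 1\<close> the Fermat curve of degree \<open>\<delta> \<ge> 4\<close> does; the remaining case \<open>\<delta> = 3\<close>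
  does not occur because the complement of a point in the projective line is not hyperbolically
  embedded.
\<close>

text \<open>The orders decide everything. With two distinct roots each multiplicity e is below m, so
  at a zero of u - \<alpha> c^k, of order o, the equation o e = r k m with r \<ge> 1 forces o > k,
  hence o \<ge> 4, while c^k only has orders at least k \<ge> 3. Orders 3, 3, 3 would not do: the
  reciprocals would add up to 1, and the cubic x^3 + y^3 = z^3 carries nonconstant entire curves.
  Each x_i is the coefficient of its own power of u because \<xi> is arbitrary: whichever entry of
  \<xi> is nonzero keeps the polynomial in u from being a pure power. The powers u^(m - 2), ...,
  u^(m - n - 2) have to exist, which is where m \<ge> n + 2 enters. The obstacle in the limit t -> 0
  is that u = F / t might blow up. It does not, because the equation of the cover is monic in u and
  weighted homogeneous, so u is bounded by k-th powers of the coordinates. Brody's theorem is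
  therefore proved for curves together with a function of weight k. In the metric, 12 is the least
  common multiple of 4 and 3; it makes 12 (1 - 1/4) = 9 and 12 (1 - 1/3) = 8 integers.\<close>

hide_const (open) Ring_Hom_Poly.eval_poly

subsection \<open>Entire functions with prescribed zeros\<close>

lemma holomorphic_local_factorization:
  assumes "f holomorphic_on S" "open S" "connected S" "z \<in> S" "\<exists>w\<in>S. f w \<noteq> 0"
  shows "\<exists>g. g analytic_on {z} \<and> g z \<noteq> 0 \<and> (\<forall>\<^sub>F w in nhds z. f w = (w - z) ^ nat (zorder f z) * g w)"
proof -
  let ?g = "zor_poly f z"
  have "\<exists>r>0. cball z r \<subseteq> S \<and> ?g holomorphic_on cball z r \<and>
      (\<forall>w\<in>cball z r. f w = ?g w * (w - z) ^ nat (zorder f z) \<and> ?g w \<noteq> 0)"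
    using zorder_exist_zero[OF assms] by (rule conjunct2)
  then obtain r where r: "r > 0" "?g holomorphic_on cball z r"
      "\<And>w. w \<in> cball z r \<Longrightarrow> f w = ?g w * (w - z) ^ nat (zorder f z) \<and> ?g w \<noteq> 0"
    by metis
  have "?g holomorphic_on ball z r" by (rule holomorphic_on_subset[OF r(2) ball_subset_cball])
  then have "?g analytic_on {z}" using r(1) analytic_at centre_in_ball open_ball by metis
  moreover have "?g z \<noteq> 0" using r(1,3) by simp
  moreover have "\<forall>\<^sub>F w in nhds z. f w = (w - z) ^ nat (zorder f z) * ?g w"
  proof (rule eventually_mono)
    show "\<forall>\<^sub>F w in nhds z. w \<in> ball z r" using r(1) by (intro eventually_nhds_in_open) auto
  qed (use r(3) in \<open>simp add: mult.commute\<close>)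
  ultimately show ?thesis by (intro exI[of _ ?g] conjI)
qed

text \<open>A Weierstrass product over a sequence that lists each nonzero zero with its
  multiplicity. The origin is set apart because the factors need nonzero zeros, and the finite case
  because such a sequence must tend to infinity. The local form, with exponent \<open>m z\<close> at
  every z, also records that there are no further zeros.\<close>

lemma entire_with_zeros:
  fixes m :: "complex \<Rightarrow> nat"
  assumes sparse: "\<And>z. \<not> z islimpt {w. m w > 0}"
  obtains f where "f holomorphic_on UNIV"
    "\<And>z. \<exists>g. g analytic_on {z} \<and> g z \<noteq> 0 \<and> (\<forall>\<^sub>F w in nhds z. f w = (w - z) ^ m z * g w)"
proof -
  define Z where "Z = {w. m w > 0}"
  have closed: "closed (Z - {0})"
    unfolding closed_limpt Z_def using sparse by (metis Diff_subset islimpt_subset)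
  have fin: "finite ((Z - {0}) \<inter> cball 0 R)" for R
  proof (rule ccontr)
    assume "infinite ((Z - {0}) \<inter> cball 0 R)"
    then obtain z where "z islimpt ((Z - {0}) \<inter> cball 0 R)"
      using compact_cball[of 0 R] unfolding compact_eq_Bolzano_Weierstrass by (meson inf_le2)
    then have "z islimpt Z" by (meson Diff_subset inf_le1 islimpt_subset)
    with sparse show False by (simp add: Z_def)
  qed
  have *: "\<exists>f. f holomorphic_on UNIV \<and> (\<forall>z. z \<noteq> 0 \<longrightarrow> f z = 0 \<longleftrightarrow> z \<in> Z - {0}) \<and> f 0 \<noteq> 0 \<and>
      (\<forall>z\<in>Z-{0}. \<exists>g. g analytic_on {z} \<and> g z \<noteq> 0 \<and> (\<forall>\<^sub>F w in nhds z. f w = (w - z) ^ m z * g w))"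
  proof (cases "finite (Z - {0})")
    case True
    let ?f = "\<lambda>w. \<Prod>z\<in>Z-{0}. (w - z) ^ m z"
    have 1: "\<exists>g. g analytic_on {z} \<and> g z \<noteq> 0 \<and> (\<forall>\<^sub>F w in nhds z. ?f w = (w - z) ^ m z * g w)"
      if "z \<in> Z - {0}" for z
    proof (intro exI[of _ "\<lambda>w. \<Prod>u\<in>Z-{0}-{z}. (w - u) ^ m u"] conjI always_eventually allI)
      show "(\<lambda>w. \<Prod>u\<in>Z-{0}-{z}. (w - u) ^ m u) analytic_on {z}"
        by (intro analytic_intros)
      show "(\<Prod>u\<in>Z-{0}-{z}. (z - u) ^ m u) \<noteq> 0"
        using True by (subst prod_zero_iff) auto
      show "?f w = (w - z) ^ m z * (\<Prod>u\<in>Z-{0}-{z}. (w - u) ^ m u)" for w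
        by (rule prod.remove) (use True that in auto)
    qed
    have 2: "?f holomorphic_on UNIV" by (intro holomorphic_intros)
    have 3: "?f z = 0 \<longleftrightarrow> z \<in> Z - {0}" for z
    proof -
      have "?f z = 0 \<longleftrightarrow> (\<exists>u\<in>Z-{0}. (z - u) ^ m u = 0)" by (rule prod_zero_iff[OF True])
      also have "\<dots> \<longleftrightarrow> z \<in> Z - {0}" by (auto simp: Z_def)
      finally show ?thesis .
    qed
    show ?thesis
    proof (rule exI[of _ "?f"], intro conjI allI impI ballI)
      show "?f 0 \<noteq> 0" unfolding 3 by blast
    qed (rule 2, rule 3, erule 1)
  next
    case False
    have mpos: "\<And>x. x \<in> Z - {0} \<Longrightarrow> m x > 0" by (simp add: Z_def)
    obtain a :: "nat \<Rightarrow> complex" where a: "range a = Z - {0}" "filterlim a at_infinity at_top"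
        "\<And>z. z \<in> Z - {0} \<Longrightarrow> finite (a -` {z}) \<and> card (a -` {z}) = m z"
      by (rule sequence_of_sparse_set_exists'[of "Z - {0}" m, OF False closed fin mpos]) (assumption, rule that)
    interpret W: weierstrass_product' a
    proof
      show "a n \<noteq> 0" for n using a(1) by (metis Diff_iff rangeI singletonI)
      show "finite (a -` {z})" if "z \<in> range a" for z using a(1,3) that by blast
    qed (rule a(2))
    have 1: "\<exists>g. g analytic_on {z} \<and> g z \<noteq> 0 \<and> (\<forall>\<^sub>F w in nhds z. W.f w = (w - z) ^ m z * g w)"
      if "z \<in> Z - {0}" for z
    proof -
      have zo: "zorder W.f z = int (m z)" using W.zorder a(3)[OF that] by simp
      have iz: "isolated_zero W.f z" by (rule W.isolated_zero) (use a(1) that in simp)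
      then have ev: "\<forall>\<^sub>F w in at z. W.f w \<noteq> 0" by (simp add: isolated_zero_def)
      obtain u where "W.f u \<noteq> 0" using eventually_happens[OF ev] by auto
      then have "\<exists>u\<in>UNIV. W.f u \<noteq> 0" by blast
      from holomorphic_local_factorization[OF W.holomorphic open_UNIV connected_UNIV UNIV_I this, of z]
      show ?thesis unfolding zo nat_int .
    qed
    have 3: "W.f z = 0 \<longleftrightarrow> z \<in> Z - {0}" for z using W.zero[of z] a(1) by simp
    show ?thesis
    proof (rule exI[of _ "W.f"], intro conjI allI impI ballI)
      show "W.f 0 \<noteq> 0" unfolding 3 by blast
    qed (rule W.holomorphic, rule 3, erule 1)
  qed
  then obtain f where f: "f holomorphic_on UNIV" "\<And>z. z \<noteq> 0 \<Longrightarrow> f z = 0 \<longleftrightarrow> z \<in> Z - {0}" "f 0 \<noteq> 0"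
    "\<And>z. z \<in> Z - {0} \<Longrightarrow> \<exists>g. g analytic_on {z} \<and> g z \<noteq> 0 \<and> (\<forall>\<^sub>F w in nhds z. f w = (w - z) ^ m z * g w)"
    by blast
  have fa: "f analytic_on {z}" for z using f(1) analytic_at by blast
  show thesis
  proof (rule that[of "\<lambda>w. w ^ m 0 * f w"])
    show "(\<lambda>w. w ^ m 0 * f w) holomorphic_on UNIV" using f(1) by (intro holomorphic_intros)
    fix z
    show "\<exists>g. g analytic_on {z} \<and> g z \<noteq> 0 \<and> (\<forall>\<^sub>F w in nhds z. w ^ m 0 * f w = (w - z) ^ m z * g w)"
    proof (cases "z = 0")
      case True then show ?thesis using f(3) fa by (intro exI[of _ f]) auto
    next
      case nz: False
      show ?thesis
      proof (cases "z \<in> Z")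
        case True
        then obtain g where g: "g analytic_on {z}" "g z \<noteq> 0" "\<forall>\<^sub>F w in nhds z. f w = (w - z) ^ m z * g w"
          using f(4)[of z] nz by auto
        show ?thesis
          by (intro exI[of _ "\<lambda>w. w ^ m 0 * g w"] conjI analytic_intros g)
             (use g nz in \<open>auto elim!: eventually_mono\<close>)
      next
        case False
        then have "m z = 0" "f z \<noteq> 0" using f(2)[OF nz] by (auto simp: Z_def)
        then show ?thesis
          by (intro exI[of _ "\<lambda>w. w ^ m 0 * f w"] conjI analytic_intros fa) (use nz in auto)
      qed
    qed
  qed
qed

lemma analytic_local_order:
  fixes f :: "complex \<Rightarrow> complex"
  assumes "f analytic_on {z}"
  shows "(\<forall>\<^sub>F w in nhds z. f w = 0) \<or>
    (\<exists>m g. g analytic_on {z} \<and> g z \<noteq> 0 \<and> (\<forall>\<^sub>F w in nhds z. f w = (w - z) ^ m * g w))"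
proof (cases "\<exists>\<^sub>F w in at z. f w \<noteq> 0")
  case False
  then have *: "\<forall>\<^sub>F w in at z. f w = 0" by (simp add: frequently_def)
  have "isCont f z" using assms by (rule analytic_at_imp_isCont)
  then have "f \<midarrow>z\<rightarrow> f z" by (rule isContD)
  moreover have "f \<midarrow>z\<rightarrow> 0" by (rule tendsto_eventually[OF *])
  ultimately have "f z = 0"
    by (rule LIM_unique)
  with * show ?thesis
    by (auto simp: eventually_nhds_conv_at)
next
  case True
  obtain r where r: "r > 0" "f holomorphic_on ball z r"
    using assms analytic_at_ball by blast
  have ex: "\<exists>w\<in>ball z r. f w \<noteq> 0"
  proof (rule ccontr)
    assume "\<not> ?thesis"
    then have "\<forall>\<^sub>F w in at z. f w = 0"
      using eventually_at_in_open'[of "ball z r" z] r(1) by (auto elim!: eventually_mono)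
    with True show False by (simp add: frequently_def)
  qed
  show ?thesis
    using holomorphic_local_factorization[OF r(2) open_ball connected_ball _ ex] r(1) by (metis centre_in_ball)
qed

subsection \<open>Lifting maps to projective space\<close>

lemma proj_point_eq_iff: "proj_point u = proj_point v \<longleftrightarrow> (\<exists>c. c \<noteq> 0 \<and> u = (\<lambda>i. c * v i))"
proof
  assume "proj_point u = proj_point v"
  moreover have "u \<in> proj_point u" unfolding proj_point_def by (rule CollectI, rule exI[of _ 1]) simp
  ultimately show "\<exists>c. c \<noteq> 0 \<and> u = (\<lambda>i. c * v i)" by (auto simp: proj_point_def)
next
  assume "\<exists>c. c \<noteq> 0 \<and> u = (\<lambda>i. c * v i)"
  then obtain c where c: "c \<noteq> 0" "u = (\<lambda>i. c * v i)" by blast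
  show "proj_point u = proj_point v"
  proof (intro subset_antisym subsetI)
    fix w assume "w \<in> proj_point u"
    then obtain d where "d \<noteq> 0" "w = (\<lambda>i. d * u i)" by (auto simp: proj_point_def)
    then show "w \<in> proj_point v" unfolding proj_point_def c
      by (intro CollectI exI[of _ "d * c"]) (use c(1) in \<open>auto simp: mult.assoc\<close>)
  next
    fix w assume "w \<in> proj_point v"
    then obtain d where "d \<noteq> 0" "w = (\<lambda>i. d * v i)" by (auto simp: proj_point_def)
    then show "w \<in> proj_point u" unfolding proj_point_def c
      by (intro CollectI exI[of _ "d / c"]) (use c(1) in auto)
  qed
qed

lemma analytic_nonzero_nhds:
  assumes "g analytic_on {z}" "g z \<noteq> 0"
  shows "\<forall>\<^sub>F w in nhds z. g w \<noteq> 0"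
proof -
  have "g \<midarrow>z\<rightarrow> g z" using analytic_at_imp_isCont[OF assms(1)] by (rule isContD)
  from tendsto_imp_eventually_ne[OF this assms(2)] assms(2) show ?thesis
    by (simp add: eventually_nhds_conv_at)
qed

lemma eventually_analytic:
  assumes "g analytic_on {z::complex}"
  shows "\<forall>\<^sub>F w in nhds z. g analytic_on {w}"
proof -
  obtain S where "open S" "z \<in> S" "g holomorphic_on S" using assms analytic_at by blast
  then show ?thesis unfolding eventually_nhds analytic_at by blast
qed

lemma choice_pair:
  assumes "\<And>z j. R z j \<Longrightarrow> \<exists>m g. Q z j m g"
  obtains m g where "\<And>z j. R z j \<Longrightarrow> Q z j (m z j) (g z j)"
  using assms by metis

text \<open>Line bundles on the plane are trivial. Concretely, local lifts differ by nonvanishing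
  factors, so the zeros of a coordinate \<open>i\<close> have well-defined orders; rescaling the
  local lifts so that coordinate \<open>i\<close> becomes an entire function \<open>e\<close> with
  exactly these zeros makes them agree.\<close>

lemma proj_holomorphic_lift:
  assumes "proj_holomorphic_on n f UNIV"
  obtains v where "\<And>i. (\<lambda>z. v z i) holomorphic_on UNIV" "\<And>z. v z \<in> nonzero_vecs n"
    "\<And>z. f z = proj_point (v z)"
proof -
  from assms have "\<forall>z. \<exists>U F. open U \<and> z \<in> U \<and> (\<forall>i. (\<lambda>w. F w i) holomorphic_on U) \<and>
        (\<forall>w\<in>U. F w \<in> nonzero_vecs n \<and> f w = proj_point (F w))"
    unfolding proj_holomorphic_on_def by (metis UNIV_I)
  then obtain U F where UF: "\<And>z. open (U z)" "\<And>z. z \<in> U z" "\<And>z i. (\<lambda>w. F z w i) holomorphic_on U z"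
     "\<And>z w. w \<in> U z \<Longrightarrow> F z w \<in> nonzero_vecs n" "\<And>z w. w \<in> U z \<Longrightarrow> f w = proj_point (F z w)"
    by metis
  have evU: "\<forall>\<^sub>F w in nhds z. w \<in> U z" for z using UF(1,2) by (intro eventually_nhds_in_open)
  have Fan: "(\<lambda>w. F z w i) analytic_on {z}" for z i
    using UF(1-3)[of z] analytic_at by blast
  \<comment> \<open>\<open>F w w\<close> is the lift chosen at \<open>w\<close>, evaluated at
    \<open>w\<close> itself. It differs from any other local lift only by a nonzero scalar, so the
    vanishing of a coordinate does not depend on the lift.\<close>
  have sc: "\<exists>c. c \<noteq> 0 \<and> F w w = (\<lambda>j. c * F z w j)" if "w \<in> U z" for z w
    using UF(5)[OF that] UF(5)[OF UF(2), of w] proj_point_eq_iff[of "F w w" "F z w"] by simp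
  have F0: "F w w i = 0 \<longleftrightarrow> F z w i = 0" if "w \<in> U z" for z w i
    using sc[OF that] by (metis mult_eq_0_iff)
  obtain i where i: "F 0 0 i \<noteq> 0" using UF(4)[OF UF(2), of 0] by (auto simp: nonzero_vecs_def)
  \<comment> \<open>Where coordinate \<open>i\<close> vanishes identically nearby. This set is open
    and closed and misses 0, hence it is empty.\<close>
  define E where "E = {z. \<forall>\<^sub>F w in nhds z. F w w i = 0}"
  have ev0: "(\<forall>\<^sub>F w in nhds z. F w w i = 0) \<longleftrightarrow> (\<forall>\<^sub>F w in nhds z. F z w i = 0)" for z
    by (rule eventually_cong[OF evU]) (rule F0)
  have dich: "z \<notin> E \<Longrightarrow> \<exists>m g. g analytic_on {z} \<and> g z \<noteq> 0 \<and> (\<forall>\<^sub>F w in nhds z. F z w i = (w - z) ^ m * g w)" for z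
    using analytic_local_order[OF Fan[of z i]] by (auto simp: E_def ev0)
  have nz: "\<forall>\<^sub>F w in at z. F w w i \<noteq> 0" if zE: "z \<notin> E" for z
  proof -
    obtain m g where g: "g analytic_on {z}" "g z \<noteq> 0" "\<forall>\<^sub>F w in nhds z. F z w i = (w - z) ^ m * g w"
      using dich[OF zE] by blast
    have "\<forall>\<^sub>F w in nhds z. g w \<noteq> 0"
      using g(1,2) by (rule analytic_nonzero_nhds)
    then have "\<forall>\<^sub>F w in nhds z. w \<noteq> z \<longrightarrow> F w w i \<noteq> 0"
      using g(3) evU[of z] by eventually_elim (auto simp: F0)
    then show ?thesis by (simp add: eventually_at_filter)
  qed
  have "open E" unfolding E_def
    by (subst open_subopen) (auto simp: eventually_nhds)
  moreover have "open (- E)"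
  proof (subst open_subopen, intro ballI)
    fix z assume z: "z \<in> - E"
    then have "\<forall>\<^sub>F w in at z. F w w i \<noteq> 0" using nz by simp
    then have "\<forall>\<^sub>F w in at z. w \<in> - E"
    proof (rule eventually_mono)
      fix w assume "F w w i \<noteq> 0"
      then show "w \<in> - E" by (auto simp: E_def dest: eventually_nhds_x_imp_x)
    qed
    with z have "\<forall>\<^sub>F w in nhds z. w \<in> - E" by (simp add: eventually_nhds_conv_at)
    then show "\<exists>T. open T \<and> z \<in> T \<and> T \<subseteq> - E" by (auto simp: eventually_nhds)
  qed
  moreover have "0 \<notin> E" using i by (auto simp: E_def dest: eventually_nhds_x_imp_x)
  ultimately have E: "z \<notin> E" for z
    using connected_UNIV[where ?'a = complex] unfolding connected_def by blast
  have dich': "\<exists>m g. g analytic_on {z} \<and> g z \<noteq> 0 \<and> (\<forall>\<^sub>F w in nhds z. F z w i = (w - z) ^ m * g w)"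
    if True for z j :: complex using dich[OF E] .
  obtain m' :: "complex \<Rightarrow> complex \<Rightarrow> nat" and g' where mg0: "\<And>z j. True \<Longrightarrow> g' z j analytic_on {z} \<and> g' z j z \<noteq> 0 \<and>
      (\<forall>\<^sub>F w in nhds z. F z w i = (w - z) ^ m' z j * g' z j w)"
    by (rule choice_pair[OF dich']) (assumption, rule that)
  define m where "m z = m' z 0" for z
  define g where "g z = g' z 0" for z
  have mg: "\<And>z. g z analytic_on {z}" "\<And>z. g z z \<noteq> 0" "\<And>z. \<forall>\<^sub>F w in nhds z. F z w i = (w - z) ^ m z * g z w"
    using mg0 by (auto simp: m_def g_def)
  have m0: "m w = 0" if "F w w i \<noteq> 0" for w
    using eventually_nhds_x_imp_x[OF mg(3)[of w]] that by (cases "m w") auto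
  have "\<not> z islimpt {w. m w > 0}" for z
    unfolding islimpt_iff_eventually
    using nz[OF E, of z] by (auto elim!: eventually_mono dest: m0)
  then obtain e where e: "e holomorphic_on UNIV"
    "\<And>z. \<exists>g. g analytic_on {z} \<and> g z \<noteq> 0 \<and> (\<forall>\<^sub>F w in nhds z. e w = (w - z) ^ m z * g w)"
    using entire_with_zeros by metis
  from e(2) obtain h where h: "\<And>z. h z analytic_on {z}" "\<And>z. h z z \<noteq> 0" "\<And>z. \<forall>\<^sub>F w in nhds z. e w = (w - z) ^ m z * h z w"
    by metis
  \<comment> \<open>Formally \<open>e\<close> divided by coordinate \<open>i\<close>, times the
    local lift. At a zero of that coordinate the powers of w - z cancel and the quotient is read off
    from the units \<open>h\<close> and \<open>g\<close>.\<close>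
  define v where "v z = (\<lambda>j. (h z z / g z z) * F z z j)" for z
  have veq: "\<forall>\<^sub>F w in nhds z. v w j = (h z w / g z w) * F z w j" for z j
  proof -
    have "\<forall>\<^sub>F w in nhds z. w \<noteq> z \<longrightarrow> F w w i \<noteq> 0" using nz[OF E, of z] by (simp add: eventually_at_filter)
    then show ?thesis using evU[of z] mg(3)[of z] h(3)[of z]
    proof eventually_elim
      case (elim w)
      show ?case
      proof (cases "w = z")
        case False
        then have Fw: "F w w i \<noteq> 0" using elim(1) by simp
        have hw: "e w = h w w" "F w w i = g w w"
          using eventually_nhds_x_imp_x[OF h(3)[of w]] eventually_nhds_x_imp_x[OF mg(3)[of w]] m0[OF Fw] by auto
        obtain c where c: "c \<noteq> 0" "F w w = (\<lambda>j. c * F z w j)" using sc[OF elim(2)] by blast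
        have "F z w i \<noteq> 0" using Fw F0[OF elim(2)] by simp
        have "v w j = e w / F w w i * F w w j" by (simp add: v_def hw)
        also have "\<dots> = e w / F z w i * F z w j" using c by simp
        also have "\<dots> = (h z w / g z w) * F z w j" using elim(3,4) False \<open>F z w i \<noteq> 0\<close> by simp
        finally show ?thesis .
      qed (simp add: v_def)
    qed
  qed
  show thesis
  proof (rule that[of v])
    fix j
    have "(\<lambda>z. v z j) analytic_on {z}" for z
    proof -
      have "(\<lambda>w. (h z w / g z w) * F z w j) analytic_on {z}"
        by (intro analytic_intros h(1) mg(1) Fan) (use mg(2) in auto)
      then show ?thesis by (subst analytic_at_cong[OF veq refl])
    qed
    then show "(\<lambda>z. v z j) holomorphic_on UNIV"
      by (metis analytic_imp_holomorphic analytic_on_analytic_at)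
  next
    fix z
    have k: "h z z / g z z \<noteq> 0" using h(2) mg(2) by simp
    show "v z \<in> nonzero_vecs n" using UF(4)[OF UF(2), of z] k by (auto simp: v_def nonzero_vecs_def)
    show "f z = proj_point (v z)"
      using UF(5)[OF UF(2), of z] k unfolding v_def by (metis proj_point_eq_iff)
  qed
qed

text \<open>The zeros common to all coordinates of \<open>x\<close> are divided out by a Weierstrass product.\<close>

lemma brody_hyperbolic_cone_map:
  fixes x :: "complex \<Rightarrow> cvec"
  assumes hyp: "brody_hyperbolic n X"
    and hol: "\<And>i. (\<lambda>z. x z i) holomorphic_on UNIV"
    and supp: "\<And>z i. i > n \<Longrightarrow> x z i = 0"
    and nonzero: "x z0 i0 \<noteq> 0"
    and inX: "\<And>z. x z \<in> nonzero_vecs n \<Longrightarrow> proj_point (x z) \<in> X"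
    and closed: "\<And>y z. (\<And>i. (\<lambda>w. y w i) analytic_on {z}) \<Longrightarrow> y z \<in> nonzero_vecs n \<Longrightarrow>
        (\<forall>\<^sub>F w in at z. proj_point (y w) \<in> X) \<Longrightarrow> proj_point (y z) \<in> X"
  obtains c \<xi> where "c holomorphic_on UNIV" "\<xi> \<in> nonzero_vecs n" "\<And>z i. x z i = c z * \<xi> i"
proof -
  define J where "J = {j. \<exists>z. x z j \<noteq> 0}"
  have J: "J \<subseteq> {..n}" "J \<noteq> {}" using supp nonzero unfolding J_def by (force simp: not_le[symmetric])+
  then have finJ: "finite J" by (meson finite_atMost finite_subset)
  have xan: "(\<lambda>w. x w j) analytic_on {z}" for z j using hol analytic_at by blast
  have nzJ: "\<forall>\<^sub>F w in at z. x w j \<noteq> 0" if jJ: "j \<in> J" for j z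
  proof -
    obtain \<beta> where "x \<beta> j \<noteq> 0" using jJ by (auto simp: J_def)
    from non_zero_neighbour_alt[OF hol open_UNIV connected_UNIV UNIV_I UNIV_I this, of z]
    show ?thesis by (rule eventually_mono) auto
  qed
  have fact: "\<exists>m g. g analytic_on {z} \<and> g z \<noteq> 0 \<and> (\<forall>\<^sub>F w in nhds z. x w j = (w - z) ^ m * g w)" if "j \<in> J" for z j
  proof -
    have "\<not> (\<forall>\<^sub>F w in nhds z. x w j = 0)"
    proof
      assume "\<forall>\<^sub>F w in nhds z. x w j = 0"
      then have "\<forall>\<^sub>F w in at z. x w j = 0" by (auto simp: eventually_nhds_conv_at)
      with nzJ[OF that, of z] have "\<forall>\<^sub>F w in at z. False" by eventually_elim auto
      then show False by simp
    qed
    with analytic_local_order[OF xan] show ?thesis by blast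
  qed
  obtain m g where mg0: "\<And>z j. j \<in> J \<Longrightarrow> g z j analytic_on {z} \<and> g z j z \<noteq> 0 \<and>
      (\<forall>\<^sub>F w in nhds z. x w j = (w - z) ^ m z j * g z j w)"
    by (rule choice_pair[OF fact]) (assumption, rule that)
  then have mg: "\<And>z j. j \<in> J \<Longrightarrow> g z j analytic_on {z}" "\<And>z j. j \<in> J \<Longrightarrow> g z j z \<noteq> 0"
     "\<And>z j. j \<in> J \<Longrightarrow> \<forall>\<^sub>F w in nhds z. x w j = (w - z) ^ m z j * g z j w"
    by auto
  \<comment> \<open>The order to which all coordinates vanish at z. The local lift
    \<open>y z\<close> has the factor (w - z)^(r z) removed; for different z these lifts agree up to
    nonzero scalars, so they define one map \<open>f\<close>.\<close>
  define r where "r z = Min (m z ` J)" for z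
  define y where "y z w = (\<lambda>j. if j \<in> J then (w - z) ^ (m z j - r z) * g z j w else 0)" for z w :: complex
  have yan: "(\<lambda>w. y z w j) analytic_on {z}" for z j
    unfolding y_def by (cases "j \<in> J") (auto intro!: analytic_intros mg(1))
  have xy: "\<forall>\<^sub>F w in nhds z. \<forall>j. x w j = (w - z) ^ r z * y z w j" for z
  proof -
    have "\<forall>\<^sub>F w in nhds z. \<forall>j\<in>J. x w j = (w - z) ^ m z j * g z j w"
      using mg(3) finJ by (intro eventually_ball_finite) auto
    then show ?thesis
    proof eventually_elim
      case (elim w)
      show ?case
      proof
        fix j
        show "x w j = (w - z) ^ r z * y z w j"
        proof (cases "j \<in> J")
          case True
          then have "r z \<le> m z j" unfolding r_def using finJ by simp
          then have "(w - z) ^ m z j = (w - z) ^ r z * (w - z) ^ (m z j - r z)"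
            by (simp add: power_add[symmetric])
          then show ?thesis using elim True by (simp add: y_def)
        qed (auto simp: y_def J_def)
      qed
    qed
  qed
  have ynz: "y z z \<in> nonzero_vecs n" for z
  proof -
    have "Min (m z ` J) \<in> m z ` J" using finJ J by (intro Min_in) auto
    then obtain j where j: "j \<in> J" "m z j = r z" unfolding r_def by auto
    then have "y z z j \<noteq> 0" using mg(2) by (simp add: y_def)
    moreover have "j \<le> n" using j J by auto
    moreover have "y z z i = 0" if "i > n" for i using J(1) that by (auto simp: y_def)
    ultimately show ?thesis unfolding nonzero_vecs_def by blast
  qed
  have evnz: "\<forall>\<^sub>F w in at z. x w \<in> nonzero_vecs n" for z
  proof -
    obtain j where "j \<in> J" using J by auto
    then show ?thesis using nzJ[of j z] J(1)
      by (auto elim!: eventually_mono simp: nonzero_vecs_def supp)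
  qed
  have xy1: "x w = y w w" if "x w \<in> nonzero_vecs n" for w
  proof -
    have *: "x w j = 0 ^ r w * y w w j" for j using eventually_nhds_x_imp_x[OF xy[of w]] by simp
    have "r w = 0"
      using that *  by (cases "r w") (auto simp: nonzero_vecs_def)
    with * show ?thesis by auto
  qed
  define f where "f z = proj_point (y z z)" for z
  have loc: "\<forall>\<^sub>F w in nhds z. y z w \<in> nonzero_vecs n \<and> f w = proj_point (y z w) \<and> (w \<noteq> z \<longrightarrow> proj_point (y z w) \<in> X)" for z
  proof -
    have "\<forall>\<^sub>F w in nhds z. w \<noteq> z \<longrightarrow> x w \<in> nonzero_vecs n" using evnz[of z] by (simp add: eventually_at_filter)
    then show ?thesis using xy[of z]
    proof eventually_elim
      case (elim w)
      show ?case
      proof (cases "w = z")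
        case False
        then have xw: "x w \<in> nonzero_vecs n" using elim(1) by simp
        have xe: "x w = (\<lambda>j. (w - z) ^ r z * y z w j)" using elim(2) by auto
        have nz: "(w - z) ^ r z \<noteq> 0" using False by simp
        have "proj_point (x w) = proj_point (y z w)" unfolding proj_point_eq_iff using xe nz by blast
        moreover have "y z w \<in> nonzero_vecs n" using xw nz by (auto simp: nonzero_vecs_def xe)
        ultimately show ?thesis using inX[OF xw] xy1[OF xw] by (simp add: f_def)
      qed (use ynz in \<open>simp add: f_def\<close>)
    qed
  qed
  have "proj_holomorphic_on n f UNIV"
    unfolding proj_holomorphic_on_def
  proof
    fix z :: complex
    have "\<forall>\<^sub>F w in nhds z. (\<forall>j\<in>J. (\<lambda>w. y z w j) analytic_on {w})"
      using finJ yan by (intro eventually_ball_finite ballI eventually_analytic) auto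
    with loc[of z] have "\<forall>\<^sub>F w in nhds z. y z w \<in> nonzero_vecs n \<and> f w = proj_point (y z w) \<and> (\<forall>j\<in>J. (\<lambda>w. y z w j) analytic_on {w})"
      by eventually_elim auto
    then obtain U where U: "open U" "z \<in> U" "\<And>w. w \<in> U \<Longrightarrow> y z w \<in> nonzero_vecs n \<and> f w = proj_point (y z w) \<and> (\<forall>j\<in>J. (\<lambda>w. y z w j) analytic_on {w})"
      by (auto simp: eventually_nhds)
    show "\<exists>U F. open U \<and> z \<in> U \<and> U \<subseteq> UNIV \<and> (\<forall>i. (\<lambda>w. F w i) holomorphic_on U) \<and>
        (\<forall>w\<in>U. F w \<in> nonzero_vecs n \<and> f w = proj_point (F w))"
    proof (intro exI[of _ U] exI[of _ "y z"] conjI allI)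
      fix j
      show "(\<lambda>w. y z w j) holomorphic_on U"
      proof (cases "j \<in> J")
        case True
        then have "(\<lambda>w. y z w j) analytic_on U" using U(3) by (subst analytic_on_analytic_at) auto
        then show ?thesis by (rule analytic_imp_holomorphic)
      qed (simp add: y_def)
    qed (use U in auto)
  qed
  moreover have "range f \<subseteq> X"
  proof
    fix p assume "p \<in> range f"
    then obtain z where z: "p = proj_point (y z z)" by (auto simp: f_def)
    \<comment> \<open>At a common zero of the coordinates \<open>inX\<close> says nothing about the
      value of \<open>f\<close>, which is obtained as a limit along the arc
      \<open>y z\<close>.\<close>
    have "\<forall>\<^sub>F w in at z. proj_point (y z w) \<in> X"
      using loc[of z] by (auto simp: eventually_at_filter elim!: eventually_mono)
    then show "p \<in> X" unfolding z by (intro closed yan ynz)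
  qed
  ultimately have const: "f constant_on UNIV" using hyp by (auto simp: brody_hyperbolic_def)
  define \<xi> where "\<xi> = y 0 0"
  obtain i where i: "\<xi> i \<noteq> 0" using ynz[of 0] by (auto simp: nonzero_vecs_def \<xi>_def)
  have "\<exists>c. \<forall>j. x z j = c * \<xi> j" for z
  proof -
    have "f z = f 0" using const by (auto simp: constant_on_def)
    then obtain k where k: "y z z = (\<lambda>j. k * \<xi> j)" by (auto simp: f_def \<xi>_def proj_point_eq_iff)
    \<comment> \<open>\<open>0 ^ r z\<close> is 1 away from the common zeros and 0 at them, so one
      formula for \<open>c\<close> covers both cases.\<close>
    have "\<forall>j. x z j = 0 ^ r z * y z z j" using eventually_nhds_x_imp_x[OF xy[of z]] by simp
    then show ?thesis using k by (intro exI[of _ "0 ^ r z * k"]) simp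
  qed
  then obtain c where c: "\<And>z j. x z j = c z * \<xi> j" by metis
  have "c = (\<lambda>z. x z i / \<xi> i)" using c i by auto
  then have "c holomorphic_on UNIV" using hol i by (auto intro!: holomorphic_intros)
  with c ynz[of 0] that show thesis by (simp add: \<xi>_def)
qed

subsection \<open>Three functions with zeros of high order\<close>

lemma local_root:
  assumes "f analytic_on {z::complex}" "f z \<noteq> 0" "q > 0"
  shows "\<exists>g. g analytic_on {z} \<and> (\<forall>\<^sub>F w in nhds z. g w ^ q = f w)"
proof (intro exI conjI)
  \<comment> \<open>Dividing by \<open>f z\<close> moves the argument of the first logarithm to 1,
    away from the branch cut; the second logarithm is a constant.\<close>
  let ?g = "\<lambda>w. exp ((Ln (f w / f z) + Ln (f z)) / of_nat q)"
  show "?g analytic_on {z}"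
    using assms by (intro analytic_intros) auto
  show "\<forall>\<^sub>F w in nhds z. ?g w ^ q = f w"
    using analytic_nonzero_nhds[OF assms(1,2)]
  proof eventually_elim
    case (elim w)
    have "?g w ^ q = exp (of_nat q * ((Ln (f w / f z) + Ln (f z)) / of_nat q))"
      by (simp only: exp_of_nat_mult)
    also have "\<dots> = exp (Ln (f w / f z) + Ln (f z))" using assms(3) by simp
    also have "\<dots> = f w" using elim assms(2) by (simp add: exp_add)
    finally show ?case .
  qed
qed

text \<open>A constant unitary change of basis turns the vector (A, B) into (E, G) with G = 0 at z,
  and g = G / E. Hence log(|A|^2 + |B|^2) is harmonic plus log(1 + |g|^2), whose Laplacian at z is a
  multiple of |g'|^2. The last equation identifies |g'| as the Fubini-Study speed of the map
  [A : B].\<close>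

lemma sum_norm_squares_factorization:
  assumes A: "A analytic_on {z::complex}" and B: "B analytic_on {z}" and nz: "A z \<noteq> 0 \<or> B z \<noteq> 0"
  obtains E g where "E analytic_on {z}" "g analytic_on {z}" "E z \<noteq> 0" "g z = 0"
    "\<forall>\<^sub>F w in nhds z. (cmod (A w))\<^sup>2 + (cmod (B w))\<^sup>2 = (cmod (E w))\<^sup>2 * (1 + (cmod (g w))\<^sup>2)"
    "cmod (deriv g z) * ((cmod (A z))\<^sup>2 + (cmod (B z))\<^sup>2) = cmod (deriv A z * B z - A z * deriv B z)"
proof -
  define n where "n = sqrt ((cmod (A z))\<^sup>2 + (cmod (B z))\<^sup>2)"
  have n2: "n\<^sup>2 = (cmod (A z))\<^sup>2 + (cmod (B z))\<^sup>2" by (simp add: n_def)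
  have n0: "n > 0" using nz by (auto simp: n_def intro: add_pos_nonneg add_nonneg_pos)
  define E where "E w = (cnj (A z) * A w + cnj (B z) * B w) / of_real n" for w
  define G where "G w = (B z * A w - A z * B w) / of_real n" for w
  have Ean: "E analytic_on {z}" and Gan: "G analytic_on {z}"
    unfolding E_def G_def using n0 by (auto intro!: analytic_intros A B)
  have "cnj (A z) * A z + cnj (B z) * B z = of_real (n\<^sup>2)"
    unfolding n2 by (simp add: complex_norm_square mult.commute del: of_real_power)
  then have Ez: "E z = of_real n" using n0 by (simp add: E_def power2_eq_square)
  have Gz: "G z = 0" by (simp add: G_def)
  have id: "(cmod (A w))\<^sup>2 + (cmod (B w))\<^sup>2 = (cmod (E w))\<^sup>2 + (cmod (G w))\<^sup>2" for w
  proof -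
    have "of_real ((cmod (E w))\<^sup>2 + (cmod (G w))\<^sup>2) = E w * cnj (E w) + G w * cnj (G w)"
      by (simp add: complex_norm_square del: of_real_power)
    also have "\<dots> = (A w * cnj (A w) + B w * cnj (B w)) * (A z * cnj (A z) + B z * cnj (B z)) / (of_real n * of_real n)"
      by (simp add: E_def G_def add_divide_distrib[symmetric]) (simp add: algebra_simps)
    also have "A z * cnj (A z) + B z * cnj (B z) = of_real n * of_real n"
      using arg_cong[OF n2, of complex_of_real] by (simp add: complex_norm_square del: of_real_power) (simp add: power2_eq_square)
    also have "(A w * cnj (A w) + B w * cnj (B w)) * (of_real n * of_real n) / (of_real n * of_real n) = A w * cnj (A w) + B w * cnj (B w)"
      using n0 by simp
    also have "\<dots> = of_real ((cmod (A w))\<^sup>2 + (cmod (B w))\<^sup>2)" by (simp add: complex_norm_square del: of_real_power)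
    finally show ?thesis by (metis of_real_eq_iff)
  qed
  have Ez0: "E z \<noteq> 0" using Ez n0 by simp
  show thesis
  proof (rule that[of E "\<lambda>w. G w / E w"])
    show "(\<lambda>w. G w / E w) analytic_on {z}" by (intro analytic_intros Ean Gan) (use Ez0 in auto)
    show "\<forall>\<^sub>F w in nhds z. (cmod (A w))\<^sup>2 + (cmod (B w))\<^sup>2 = (cmod (E w))\<^sup>2 * (1 + (cmod (G w / E w))\<^sup>2)"
      using analytic_nonzero_nhds[OF Ean Ez0]
      by eventually_elim (simp add: id norm_divide power_divide field_simps)
    have dA: "(A has_field_derivative deriv A z) (at z)" and dB: "(B has_field_derivative deriv B z) (at z)"
      and dE: "(E has_field_derivative deriv E z) (at z)"
      using A B Ean by (auto intro: analytic_derivI)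
    have "(G has_field_derivative (B z * deriv A z - A z * deriv B z) / of_real n) (at z)"
      unfolding G_def using n0 by (auto intro!: derivative_eq_intros dA dB)
    from DERIV_divide[OF this dE Ez0]
    have "((\<lambda>w. G w / E w) has_field_derivative (B z * deriv A z - A z * deriv B z) / of_real n / of_real n) (at z)"
      using Ez0 by (simp add: Gz Ez)
    then have "deriv (\<lambda>w. G w / E w) z = (B z * deriv A z - A z * deriv B z) / of_real n / of_real n"
      by (rule DERIV_imp_deriv)
    then have "cmod (deriv (\<lambda>w. G w / E w) z) * n\<^sup>2 = cmod (B z * deriv A z - A z * deriv B z)"
      using n0 by (simp add: norm_divide norm_mult power2_eq_square)
    then show "cmod (deriv (\<lambda>w. G w / E w) z) * ((cmod (A z))\<^sup>2 + (cmod (B z))\<^sup>2) = cmod (deriv A z * B z - A z * deriv B z)"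
      by (simp add: n2 mult.commute)
  qed (use Ean Ez0 Gz in auto)
qed

text \<open>The comparison step of Ahlfors' lemma: \<open>log |E|\<close> is harmonic, so at a local maximum the Laplacians
  of the other two logarithms compare.\<close>

lemma ahlfors_pointwise:
  assumes E: "E analytic_on {z0::complex}" and g: "g analytic_on {z0}" and E0: "E z0 \<noteq> 0" and g0: "g z0 = 0"
    and R: "cmod z0 < R"
    and max: "\<forall>\<^sub>F z in nhds z0. cmod (E z) * (1 + (cmod (g z))\<^sup>2) ^ p * (R\<^sup>2 - (cmod z)\<^sup>2) ^ q
        \<le> cmod (E z0) * (R\<^sup>2 - (cmod z0)\<^sup>2) ^ q"
  shows "real p * (cmod (deriv g z0))\<^sup>2 \<le> real q * R\<^sup>2 / (R\<^sup>2 - (cmod z0)\<^sup>2)\<^sup>2"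
proof (rule ccontr)
  assume neg: "\<not> ?thesis"
  define S where "S = R\<^sup>2 - (cmod z0)\<^sup>2"
  have S: "S > 0" using R unfolding S_def by (simp add: power_strict_mono)
  define \<kappa> where "\<kappa> = R\<^sup>2 / S\<^sup>2"
  have \<kappa>0: "\<kappa> \<ge> 0" by (simp add: \<kappa>_def)
  have neg': "real p * (cmod (deriv g z0))\<^sup>2 > real q * \<kappa>" using neg by (simp add: S_def \<kappa>_def)
  \<comment> \<open>\<open>S\<close> times this function is R^2 - conj(z0) z. The identity |R^2 -
    conj(z0) z|^2 - R^2 |z - z0|^2 = (R^2 - |z0|^2) (R^2 - |z|^2) splits the weight into |e|^2,
    which can be absorbed in a holomorphic function, and a term quadratic in z - z0.\<close>
  define e where "e z = 1 - cnj z0 * (z - z0) / of_real S" for z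
  have ean: "e analytic_on {z0}" unfolding e_def using S by (auto intro!: analytic_intros)
  have e0: "e z0 = 1" by (simp add: e_def)
  have id: "R\<^sup>2 - (cmod z)\<^sup>2 = S * ((cmod (e z))\<^sup>2 - \<kappa> * (cmod (z - z0))\<^sup>2)" for z
  proof -
    define h where "h = z - z0"
    have z: "z = z0 + h" by (simp add: h_def)
    have "(cmod z)\<^sup>2 = (cmod z0)\<^sup>2 + (cmod h)\<^sup>2 + 2 * Re (cnj z0 * h)"
      unfolding z cmod_power2 by (simp add: power2_eq_square algebra_simps)
    moreover have "(cmod (e z))\<^sup>2 = 1 - 2 * Re (cnj z0 * h) / S + (cmod z0)\<^sup>2 * (cmod h)\<^sup>2 / S\<^sup>2"
    proof -
      have "(cmod (1 - w))\<^sup>2 = 1 - 2 * Re w + (cmod w)\<^sup>2" for w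
        unfolding cmod_power2 by (simp add: power2_eq_square algebra_simps)
      from this[of "cnj z0 * h / of_real S"] show ?thesis
        by (simp add: e_def h_def norm_mult norm_divide power_mult_distrib power_divide)
    qed
    moreover have "S * (1 - 2 * Re (cnj z0 * h) / S + (cmod z0)\<^sup>2 * (cmod h)\<^sup>2 / S\<^sup>2 - R\<^sup>2 / S\<^sup>2 * (cmod h)\<^sup>2)
        = S - 2 * Re (cnj z0 * h) - (R\<^sup>2 - (cmod z0)\<^sup>2) * (cmod h)\<^sup>2 / S"
      using S by (simp add: field_simps power2_eq_square)
    moreover have "(R\<^sup>2 - (cmod z0)\<^sup>2) * (cmod h)\<^sup>2 / S = (cmod h)\<^sup>2" using S by (simp add: S_def)
    ultimately show ?thesis by (simp add: \<kappa>_def h_def S_def)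
  qed
  \<comment> \<open>The factors without curvature, collected in one holomorphic function. By the
    maximum principle a small circle contains a point with |F z| \<ge> |F z0|, and there the
    remaining factor (1 + |g|^2)^p (1 - y)^q is at most 1.\<close>
  define F where "F z = E z * e z ^ (2 * q)" for z
  have Fan: "F analytic_on {z0}" unfolding F_def by (intro analytic_intros E ean)
  have F0: "cmod (F z0) = cmod (E z0)" by (simp add: F_def e0)
  \<comment> \<open>This is (1 + p |g|^2) (1 - q y) - 1 divided by |z - z0|^2. At \<open>z0\<close>
    it tends to p |g'|^2 - q \<kappa>, which is positive by assumption.\<close>
  define Q where "Q z = real p * (cmod (g z / (z - z0)))\<^sup>2 - real q * \<kappa> / (cmod (e z))\<^sup>2 * (1 + real p * (cmod (g z))\<^sup>2)" for z
  have "(g has_field_derivative deriv g z0) (at z0)" using g by (rule analytic_derivI)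
  then have dq: "((\<lambda>z. g z / (z - z0)) \<longlongrightarrow> deriv g z0) (at z0)"
    by (simp add: has_field_derivative_iff g0)
  have ge: "(g \<longlongrightarrow> 0) (at z0)" "(e \<longlongrightarrow> 1) (at z0)"
    using isContD[OF analytic_at_imp_isCont[OF g]] isContD[OF analytic_at_imp_isCont[OF ean]] g0 e0 by simp_all
  have "(Q \<longlongrightarrow> real p * (cmod (deriv g z0))\<^sup>2 - real q * \<kappa> / (cmod 1)\<^sup>2 * (1 + real p * (cmod 0)\<^sup>2)) (at z0)"
    unfolding Q_def by (intro tendsto_intros dq ge) auto
  from order_tendstoD(1)[OF this, of 0] neg' have "\<forall>\<^sub>F z in at z0. Q z > 0" by simp
  then have Qpos: "\<forall>\<^sub>F z in nhds z0. z \<noteq> z0 \<longrightarrow> Q z > 0" by (simp add: eventually_at_filter)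
  have small: "\<forall>\<^sub>F z in nhds z0. \<kappa> * (cmod (z - z0))\<^sup>2 < (cmod (e z))\<^sup>2"
  proof -
    have "((\<lambda>z. (cmod (e z))\<^sup>2 - \<kappa> * (cmod (z - z0))\<^sup>2) \<longlongrightarrow> (cmod 1)\<^sup>2 - \<kappa> * (cmod (z0 - z0))\<^sup>2) (at z0)"
      by (intro tendsto_intros ge)
    from order_tendstoD(1)[OF this, of 0]
    have "\<forall>\<^sub>F z in at z0. (cmod (e z))\<^sup>2 - \<kappa> * (cmod (z - z0))\<^sup>2 > 0" by simp
    then show ?thesis by (simp add: eventually_nhds_conv_at e0)
  qed
  have "\<forall>\<^sub>F z in nhds z0. F analytic_on {z}" by (rule eventually_analytic[OF Fan])
  with Qpos small max have "\<forall>\<^sub>F z in nhds z0. F analytic_on {z} \<and> (z \<noteq> z0 \<longrightarrow> Q z > 0) \<and> \<kappa> * (cmod (z - z0))\<^sup>2 < (cmod (e z))\<^sup>2 \<and>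
      cmod (E z) * (1 + (cmod (g z))\<^sup>2) ^ p * (R\<^sup>2 - (cmod z)\<^sup>2) ^ q \<le> cmod (E z0) * (R\<^sup>2 - (cmod z0)\<^sup>2) ^ q"
    by eventually_elim auto
  then obtain d where d: "d > 0" and D: "\<And>z. dist z z0 < d \<Longrightarrow> F analytic_on {z} \<and> (z \<noteq> z0 \<longrightarrow> Q z > 0) \<and> \<kappa> * (cmod (z - z0))\<^sup>2 < (cmod (e z))\<^sup>2 \<and>
      cmod (E z) * (1 + (cmod (g z))\<^sup>2) ^ p * (R\<^sup>2 - (cmod z)\<^sup>2) ^ q \<le> cmod (E z0) * (R\<^sup>2 - (cmod z0)\<^sup>2) ^ q"
    unfolding eventually_nhds_metric by blast
  define r where "r = d / 2"
  have r: "r > 0" "r < d" using d by (auto simp: r_def)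
  have Fhol: "F holomorphic_on cball z0 r"
  proof (rule analytic_imp_holomorphic, subst analytic_on_analytic_at, intro ballI)
    fix z assume "z \<in> cball z0 r"
    then show "F analytic_on {z}" using D[of z] r by (auto simp: dist_commute)
  qed
  have "\<exists>z\<in>sphere z0 r. \<forall>w\<in>sphere z0 r. cmod (F w) \<le> cmod (F z)"
  proof (rule continuous_attains_sup)
    show "continuous_on (sphere z0 r) (\<lambda>w. cmod (F w))"
      by (intro continuous_on_norm continuous_on_subset[OF holomorphic_on_imp_continuous_on[OF Fhol]])
         (simp add: sphere_cball)
  qed (use r in auto)
  then obtain z where z: "z \<in> sphere z0 r" "\<And>w. w \<in> sphere z0 r \<Longrightarrow> cmod (F w) \<le> cmod (F z)" by blast
  have Fz: "cmod (F z0) \<le> cmod (F z)"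
  proof (rule maximum_modulus_frontier[of F "cball z0 r"])
    show "F holomorphic_on interior (cball z0 r)" "continuous_on (closure (cball z0 r)) F"
      using Fhol by (auto intro: holomorphic_on_imp_continuous_on holomorphic_on_subset)
    show "cmod (F w) \<le> cmod (F z)" if "w \<in> frontier (cball z0 r)" for w
      using that z(2) r by (simp add: frontier_cball)
  qed (use r in auto)
  have zr: "cmod (z - z0) = r" "dist z z0 < d" "z \<noteq> z0" using z(1) r by (auto simp: dist_norm norm_minus_commute)
  note Dz = D[OF zr(2)]
  define y where "y = \<kappa> * r\<^sup>2 / (cmod (e z))\<^sup>2"
  have ez: "cmod (e z) > 0" using Dz zr(1) \<kappa>0 by (metis less_irrefl mult_nonneg_nonneg not_less norm_ge_zero zero_le_power2 zero_less_norm_iff norm_eq_zero power_zero_numeral)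
  have y1: "0 \<le> y" "y < 1" using Dz ez \<kappa>0 zr(1) by (auto simp: y_def field_simps)
  have Rz: "R\<^sup>2 - (cmod z)\<^sup>2 = S * ((cmod (e z))\<^sup>2 * (1 - y))"
    unfolding id zr(1) y_def using ez by (simp add: field_simps)
  have "cmod (E z) * (1 + (cmod (g z))\<^sup>2) ^ p * (S * ((cmod (e z))\<^sup>2 * (1 - y))) ^ q \<le> cmod (E z0) * S ^ q"
    using Dz by (simp only: Rz S_def)
  then have "(cmod (F z) * ((1 + (cmod (g z))\<^sup>2) ^ p * (1 - y) ^ q)) * S ^ q \<le> cmod (F z0) * S ^ q"
    unfolding F0 by (simp add: F_def norm_mult norm_power power_mult_distrib power_mult[symmetric] mult_ac)
  then have le: "cmod (F z) * ((1 + (cmod (g z))\<^sup>2) ^ p * (1 - y) ^ q) \<le> cmod (F z0)"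
    using S by simp
  have Fpos: "cmod (F z) > 0" using Fz F0 E0 by (metis less_le_trans zero_less_norm_iff)
  have "(1 + (cmod (g z))\<^sup>2) ^ p * (1 - y) ^ q \<le> 1"
  proof (rule ccontr)
    assume "\<not> ?thesis"
    then have "cmod (F z) * 1 < cmod (F z) * ((1 + (cmod (g z))\<^sup>2) ^ p * (1 - y) ^ q)"
      using Fpos by (intro mult_strict_left_mono) auto
    with le Fz show False by simp
  qed
  \<comment> \<open>Bernoulli's inequality replaces both powers by their linear parts, and (1 + p
    |g|^2) (1 - q y) \<le> 1 already contradicts \<open>Q z\<close> > 0. The sign of 1 - q y is
    unknown, hence the case distinction.\<close>
  moreover have "1 + real p * (cmod (g z))\<^sup>2 \<le> (1 + (cmod (g z))\<^sup>2) ^ p"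
    by (rule Bernoulli_inequality) (rule order_trans[of _ 0], simp_all)
  moreover have "1 + real q * (- y) \<le> (1 + (- y)) ^ q"
    by (rule Bernoulli_inequality) (use y1 in simp)
  moreover have "(1 + real p * (cmod (g z))\<^sup>2) * (1 - real q * y) \<le> (1 + (cmod (g z))\<^sup>2) ^ p * (1 - y) ^ q"
  proof (cases "1 - real q * y \<ge> 0")
    case True
    show ?thesis
    proof (rule mult_mono)
      show "1 + real p * (cmod (g z))\<^sup>2 \<le> (1 + (cmod (g z))\<^sup>2) ^ p" by fact
      show "1 - real q * y \<le> (1 - y) ^ q" using calculation(3) by simp
    qed (use True in \<open>auto intro: add_nonneg_nonneg\<close>)
  next
    case False
    have "(1 + real p * (cmod (g z))\<^sup>2) * (1 - real q * y) \<le> 0"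
      by (rule mult_nonneg_nonpos) (use False in \<open>auto intro: add_nonneg_nonneg\<close>)
    also have "0 \<le> (1 + (cmod (g z))\<^sup>2) ^ p * (1 - y) ^ q" using y1 by (auto intro: add_nonneg_nonneg)
    finally show ?thesis .
  qed
  ultimately have "(1 + real p * (cmod (g z))\<^sup>2) * (1 - real q * y) \<le> 1" by linarith
  then have "real p * (cmod (g z))\<^sup>2 - real q * y * (1 + real p * (cmod (g z))\<^sup>2) \<le> 0"
    by (simp add: algebra_simps)
  moreover have "r\<^sup>2 * Q z = real p * (cmod (g z))\<^sup>2 - real q * y * (1 + real p * (cmod (g z))\<^sup>2)"
  proof -
    have "r\<^sup>2 * (cmod (g z / (z - z0)))\<^sup>2 = (cmod (g z))\<^sup>2"
      using r zr(1) by (simp add: norm_divide power_divide)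
    then show ?thesis unfolding Q_def y_def by (simp add: algebra_simps)
  qed
  moreover have "r\<^sup>2 * Q z > 0" using Dz zr(3) r by simp
  ultimately show False by linarith
qed

text \<open>Every zero of finite order has order at least \<open>q\<close>; where \<open>f\<close>
  vanishes identically the condition is vacuous, as no factorization with a unit exists.\<close>

definition zero_orders_ge :: "nat \<Rightarrow> (complex \<Rightarrow> complex) \<Rightarrow> bool" where
  "zero_orders_ge q f \<longleftrightarrow> (\<forall>z e h. h analytic_on {z} \<longrightarrow> h z \<noteq> 0 \<longrightarrow>
     (\<forall>\<^sub>F w in nhds z. f w = (w - z) ^ e * h w) \<longrightarrow> e = 0 \<or> q \<le> e)"

text \<open>By the product rule, only one factor w - z is lost.\<close>

lemma wronskian_order:
  assumes h: "h analytic_on {z::complex}" and g: "g analytic_on {z}"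
    and f: "\<forall>\<^sub>F w in nhds z. f w = (w - z) ^ Suc e * h w"
  shows "\<exists>k. k analytic_on {z} \<and> (\<forall>\<^sub>F w in nhds z. deriv f w * g w - f w * deriv g w = (w - z) ^ e * k w)"
proof (intro exI conjI)
  let ?k = "\<lambda>w. of_nat (Suc e) * h w * g w + (w - z) * (deriv h w * g w - h w * deriv g w)"
  show "?k analytic_on {z}" by (intro analytic_intros h g analytic_deriv)
  show "\<forall>\<^sub>F w in nhds z. deriv f w * g w - f w * deriv g w = (w - z) ^ e * ?k w"
    using eventually_eventually[THEN iffD2, OF f] eventually_analytic[OF h]
  proof eventually_elim
    case (elim w)
    have "((\<lambda>w. (w - z) ^ Suc e) has_field_derivative of_nat (Suc e) * (w - z) ^ e) (at w)"
      by (rule derivative_eq_intros refl)+ simp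
    from DERIV_mult[OF this analytic_derivI[OF elim(2)]]
    have "((\<lambda>w. (w - z) ^ Suc e * h w) has_field_derivative
        of_nat (Suc e) * (w - z) ^ e * h w + deriv h w * (w - z) ^ Suc e) (at w)" .
    then have df: "deriv f w = of_nat (Suc e) * (w - z) ^ e * h w + deriv h w * (w - z) ^ Suc e"
      using deriv_cong_ev[OF elim(1) refl] by (simp add: DERIV_imp_deriv)
    show ?case unfolding df eventually_nhds_x_imp_x[OF elim(1)] by (simp add: algebra_simps)
  qed
qed

text \<open>At a zero of \<open>f\<close> of order e the Wronskian has order at least e - 1, so the
  order of W^12 / f^p is at least d = 12 (e - 1) - p e. This is 0 for e = q and nonnegative beyond,
  since p \<le> 12. It is applied with (p, q) = (9, 4) and (8, 3); \<open>r\<close> collects the two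
  functions of the triple that do not vanish at z, and \<open>s\<close> is the sign relating the
  Wronskians of the various pairs.\<close>

lemma wronskian_power_quotient:
  assumes W: "W analytic_on {z::complex}" and f: "f analytic_on {z}" and g: "g analytic_on {z}" and r: "r analytic_on {z}" "r z \<noteq> 0"
    and fnz: "\<not> (\<forall>\<^sub>F w in nhds z. f w = 0)" and f0: "f z = 0"
    and ord: "zero_orders_ge q f"
    and Weq: "\<forall>\<^sub>F w in nhds z. W w = s * (deriv f w * g w - f w * deriv g w)"
    and p: "12 * (q - 1) = p * q" "p \<le> 12" "q > 0"
  shows "\<exists>\<psi> e h. h analytic_on {z} \<and> h z \<noteq> 0 \<and> (\<forall>\<^sub>F w in nhds z. f w = (w - z) ^ e * h w) \<and> e \<ge> q \<and>
    \<psi> analytic_on {z} \<and> (\<forall>\<^sub>F w in nhds z. W w ^ 12 = \<psi> w * (f w ^ p * r w)) \<and> (\<psi> z \<noteq> 0 \<longrightarrow> p = 12 \<or> e = q)"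
proof -
  obtain e h where h: "h analytic_on {z}" "h z \<noteq> 0" "\<forall>\<^sub>F w in nhds z. f w = (w - z) ^ e * h w"
    using analytic_local_order[OF f] fnz by blast
  have e0: "e \<noteq> 0" using eventually_nhds_x_imp_x[OF h(3)] f0 h(2) by (cases e) auto
  then have eq: "e \<ge> q" using ord h unfolding zero_orders_ge_def by blast
  obtain e' where e': "e = Suc e'" using e0 by (cases e) auto
  obtain k where k: "k analytic_on {z}" "\<forall>\<^sub>F w in nhds z. deriv f w * g w - f w * deriv g w = (w - z) ^ e' * k w"
    using wronskian_order[OF h(1) g, of f e'] h(3) e' by blast
  have "int (12 * (e - 1)) \<ge> int (p * e)"
  proof -
    have "int p * (int e - int q) \<le> 12 * (int e - int q)" using p eq by (intro mult_right_mono) auto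
    moreover have "12 * (int q - 1) = int p * int q" using arg_cong[OF p(1), of int] p(3) by (simp add: of_nat_diff)
    ultimately show ?thesis using e0 by (simp add: of_nat_diff algebra_simps)
  qed
  then obtain d where d: "12 * e' = p * e + d" using e' by (metis diff_Suc_1 le_Suc_ex of_nat_le_iff)
  have d0: "p = 12 \<or> e = q" if "d = 0"
  proof (rule ccontr)
    assume "\<not> ?thesis"
    then have "p < 12" "e > q" using p eq by auto
    then have "int p * (int e - int q) < 12 * (int e - int q)" by (intro mult_strict_right_mono) auto
    moreover have "12 * (int q - 1) = int p * int q" using arg_cong[OF p(1), of int] p(3) by (simp add: of_nat_diff)
    moreover have "12 * (int e - 1) = int p * int e" using arg_cong[OF d, of int] that e' by (simp add: algebra_simps)
    ultimately show False by (simp add: algebra_simps)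
  qed
  define \<psi> where "\<psi> w = s ^ 12 * (w - z) ^ d * k w ^ 12 / (h w ^ p * r w)" for w
  have "\<psi> analytic_on {z}" unfolding \<psi>_def using h(2) r(2) by (intro analytic_intros h k r) auto
  moreover have "\<forall>\<^sub>F w in nhds z. W w ^ 12 = \<psi> w * (f w ^ p * r w)"
    using Weq k(2) h(3) analytic_nonzero_nhds[OF h(1,2)] analytic_nonzero_nhds[OF r]
  proof eventually_elim
    case (elim w)
    have "W w ^ 12 = s ^ 12 * ((w - z) ^ (12 * e') * k w ^ 12)" unfolding elim(1,2)
      by (simp add: power_mult_distrib power_mult[symmetric] mult.commute)
    also have "(w - z) ^ (12 * e') = ((w - z) ^ e) ^ p * (w - z) ^ d"
      unfolding d by (simp add: power_add power_mult[symmetric] mult.commute)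
    finally show ?case using elim(4,5) by (simp add: \<psi>_def elim(3) power_mult_distrib)
  qed
  moreover have "\<psi> z \<noteq> 0 \<longrightarrow> p = 12 \<or> e = q" using d0 by (cases d) (auto simp: \<psi>_def)
  ultimately show ?thesis using h eq by blast
qed

section \<open>Entire functions with a + b = c and multiple zeros\<close>

lemma eventually_at_not_identically_zero:
  assumes "f holomorphic_on UNIV" "f z0 \<noteq> (0::complex)"
  shows "\<forall>\<^sub>F w in at z. f w \<noteq> 0"
  using non_zero_neighbour_alt[OF assms(1) open_UNIV connected_UNIV UNIV_I UNIV_I assms(2), of z]
  by (rule eventually_mono) auto

lemma not_eventually_zero:
  assumes "\<forall>\<^sub>F w in at z. f w \<noteq> (0::complex)"
  shows "\<not> (\<forall>\<^sub>F w in nhds (z::complex). f w = 0)"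
proof
  assume "\<forall>\<^sub>F w in nhds z. f w = 0"
  then have "\<forall>\<^sub>F w in at z. f w = 0" by (auto simp: eventually_nhds_conv_at)
  with assms have "\<forall>\<^sub>F w in at z. False" by eventually_elim auto
  then show False by simp
qed

lemma analytic_eq_of_eventually_eq:
  assumes "f analytic_on {z::complex}" "g analytic_on {z}" "\<forall>\<^sub>F w in at z. f w = g w"
  shows "f z = g z"
proof -
  have f: "f \<midarrow>z\<rightarrow> f z" and g: "g \<midarrow>z\<rightarrow> g z"
    using assms(1,2) by (auto intro: isContD analytic_at_imp_isCont)
  have "f \<midarrow>z\<rightarrow> g z" using Lim_transform_eventually[OF g] assms(3) by (simp add: eq_commute)
  with f show ?thesis by (rule LIM_unique)
qed

text \<open>A hypothetical nonconstant map [a : b] to the projective line that takes the values 0,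
  infinity and -1 of a / b only with multiplicities at least 4, 4 and 3. As an orbifold the line
  then has negative Euler characteristic, and these assumptions are going to be refuted.\<close>

locale wronskian_triple =
  fixes a b c W :: "complex \<Rightarrow> complex"
  assumes hol: "a holomorphic_on UNIV" "b holomorphic_on UNIV"
    and c_def: "c = (\<lambda>z. a z + b z)"
    and no_common: "\<And>z. a z \<noteq> 0 \<or> b z \<noteq> 0"
    and ords: "zero_orders_ge 4 a" "zero_orders_ge 4 b" "zero_orders_ge 3 c"
    and W_def: "W = (\<lambda>z. deriv a z * b z - a z * deriv b z)"
    and W_nz: "\<exists>z. W z \<noteq> 0"
begin

lemma hol_c: "c holomorphic_on UNIV" unfolding c_def by (intro holomorphic_intros hol)
lemma hol_W: "W holomorphic_on UNIV" unfolding W_def by (intro holomorphic_intros hol holomorphic_deriv) auto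
lemma an: "a analytic_on {z}" "b analytic_on {z}" "c analytic_on {z}" "W analytic_on {z}"
  using hol hol_c hol_W analytic_at by blast+

lemma dc: "deriv c z = deriv a z + deriv b z"
  unfolding c_def by (intro deriv_add analytic_on_imp_differentiable_at[OF an(1)] analytic_on_imp_differentiable_at[OF an(2)]) auto

lemma W_eq: "W z = 1 * (deriv a z * b z - a z * deriv b z)" "W z = -1 * (deriv b z * a z - b z * deriv a z)"
   "W z = -1 * (deriv c z * a z - c z * deriv a z)" "W z = deriv a z * c z - a z * deriv c z"
  unfolding dc by (simp_all add: W_def c_def algebra_simps)

text \<open>Up to sign, \<open>W\<close> is the Wronskian of any two of the three functions, so none
  of them vanishes identically.\<close>

lemma nz_at: "\<forall>\<^sub>F w in at z. a w \<noteq> 0" "\<forall>\<^sub>F w in at z. b w \<noteq> 0" "\<forall>\<^sub>F w in at z. c w \<noteq> 0"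
proof -
  obtain z0 where z0: "W z0 \<noteq> 0" using W_nz by blast
  have *: "\<exists>u. f u \<noteq> 0" if f: "f holomorphic_on UNIV" and fe: "\<And>z. W z = s * (deriv f z * g z - f z * deriv g z)" for f g s
  proof (rule ccontr)
    assume "\<nexists>u. f u \<noteq> 0"
    then have "f = (\<lambda>_. 0)" by auto
    with fe[of z0] z0 show False by simp
  qed
  show "\<forall>\<^sub>F w in at z. a w \<noteq> 0" "\<forall>\<^sub>F w in at z. b w \<noteq> 0" "\<forall>\<^sub>F w in at z. c w \<noteq> 0"
    using *[OF hol(1) W_eq(1)] *[OF hol(2) W_eq(2)] *[OF hol_c W_eq(3)] hol hol_c
      eventually_at_not_identically_zero by blast+
qed

text \<open>At a zero of order \<open>e\<close> the Wronskian vanishes to order at least \<open>e - 1\<close>, and \<open>12 (e - 1) \<ge> 9 e\<close>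
  for \<open>e \<ge> 4\<close>, \<open>12 (e - 1) \<ge> 8 e\<close> for \<open>e \<ge> 3\<close>. The quotient is nonzero only where these are
  equalities or \<open>e = 0\<close>, that is, where the roots exist.\<close>

lemma exists_Psi_local:
  "\<exists>\<psi>. \<psi> analytic_on {z} \<and> (\<forall>\<^sub>F w in nhds z. W w ^ 12 = \<psi> w * (a w ^ 9 * (b w ^ 9 * c w ^ 8))) \<and>
    (\<psi> z \<noteq> 0 \<longrightarrow>
      (\<exists>A. A analytic_on {z} \<and> (\<forall>\<^sub>F w in nhds z. A w ^ 4 = a w)) \<and>
      (\<exists>B. B analytic_on {z} \<and> (\<forall>\<^sub>F w in nhds z. B w ^ 4 = b w)) \<and>
      (\<exists>C. C analytic_on {z} \<and> (\<forall>\<^sub>F w in nhds z. C w ^ 3 = c w)))"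
proof -
  note nev = not_eventually_zero[OF nz_at(1)] not_eventually_zero[OF nz_at(2)] not_eventually_zero[OF nz_at(3)]
  have root: "\<exists>A. A analytic_on {z} \<and> (\<forall>\<^sub>F w in nhds z. A w ^ q = f w)"
    if h: "h analytic_on {z}" "h z \<noteq> 0" and fq: "\<forall>\<^sub>F w in nhds z. f w = (w - z) ^ q * h w" and q: "q > 0" for f h q
  proof -
    obtain g where g: "g analytic_on {z}" "\<forall>\<^sub>F w in nhds z. g w ^ q = h w"
      using local_root[OF h q] by blast
    show ?thesis
    proof (intro exI[of _ "\<lambda>w. (w - z) * g w"] conjI)
      show "\<forall>\<^sub>F w in nhds z. ((w - z) * g w) ^ q = f w"
        using g(2) fq by eventually_elim (simp add: power_mult_distrib)
    qed (intro analytic_intros g)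
  qed
  have r4: "\<exists>A. A analytic_on {z} \<and> (\<forall>\<^sub>F w in nhds z. A w ^ q = f w)" if "f analytic_on {z}" "f z \<noteq> 0" "q > 0" for f q
    using local_root[OF that] .
  \<comment> \<open>Two of the three functions cannot vanish at the same point, since that would be
    a common zero of \<open>a\<close> and \<open>b\<close>.\<close>
  consider "a z = 0" | "b z = 0" | "c z = 0" | "a z \<noteq> 0" "b z \<noteq> 0" "c z \<noteq> 0" by blast
  then show ?thesis
  proof cases
    case 1
    then have bc: "b z \<noteq> 0" "c z \<noteq> 0" using no_common[of z] by (auto simp: c_def)
    have "\<exists>\<psi> e h. h analytic_on {z} \<and> h z \<noteq> 0 \<and> (\<forall>\<^sub>F w in nhds z. a w = (w - z) ^ e * h w) \<and> e \<ge> 4 \<and>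
      \<psi> analytic_on {z} \<and> (\<forall>\<^sub>F w in nhds z. W w ^ 12 = \<psi> w * (a w ^ 9 * (b w ^ 9 * c w ^ 8))) \<and> (\<psi> z \<noteq> 0 \<longrightarrow> (9::nat) = 12 \<or> e = 4)"
      by (rule wronskian_power_quotient[OF an(4) an(1) an(2) _ _ nev(1) 1 ords(1), of _ 1])
         (use bc W_eq(1) in \<open>auto intro!: analytic_intros an\<close>)
    then obtain \<psi> e h where "h analytic_on {z}" "h z \<noteq> 0" "\<forall>\<^sub>F w in nhds z. a w = (w - z) ^ e * h w"
      "\<psi> analytic_on {z}" "\<forall>\<^sub>F w in nhds z. W w ^ 12 = \<psi> w * (a w ^ 9 * (b w ^ 9 * c w ^ 8))" "\<psi> z \<noteq> 0 \<longrightarrow> e = 4"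
      by auto
    then show ?thesis using root[of h a 4] r4[OF an(2) bc(1), of 4] r4[OF an(3) bc(2), of 3]
      by (intro exI[of _ \<psi>]) auto
  next
    case 2
    then have bc: "a z \<noteq> 0" "c z \<noteq> 0" using no_common[of z] by (auto simp: c_def)
    have "\<exists>\<psi> e h. h analytic_on {z} \<and> h z \<noteq> 0 \<and> (\<forall>\<^sub>F w in nhds z. b w = (w - z) ^ e * h w) \<and> e \<ge> 4 \<and>
      \<psi> analytic_on {z} \<and> (\<forall>\<^sub>F w in nhds z. W w ^ 12 = \<psi> w * (b w ^ 9 * (a w ^ 9 * c w ^ 8))) \<and> (\<psi> z \<noteq> 0 \<longrightarrow> (9::nat) = 12 \<or> e = 4)"
      by (rule wronskian_power_quotient[OF an(4) an(2) an(1) _ _ nev(2) 2 ords(2), of _ "-1"])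
         (use bc W_eq(2) in \<open>auto intro!: analytic_intros an\<close>)
    then obtain \<psi> e h where "h analytic_on {z}" "h z \<noteq> 0" "\<forall>\<^sub>F w in nhds z. b w = (w - z) ^ e * h w"
      "\<psi> analytic_on {z}" "\<forall>\<^sub>F w in nhds z. W w ^ 12 = \<psi> w * (b w ^ 9 * (a w ^ 9 * c w ^ 8))" "\<psi> z \<noteq> 0 \<longrightarrow> e = 4"
      by auto
    then show ?thesis using root[of h b 4] r4[OF an(1) bc(1), of 4] r4[OF an(3) bc(2), of 3]
      by (intro exI[of _ \<psi>]) (auto simp: mult.left_commute)
  next
    case 3
    then have bc: "a z \<noteq> 0" "b z \<noteq> 0" using no_common[of z] by (auto simp: c_def)
    have "\<exists>\<psi> e h. h analytic_on {z} \<and> h z \<noteq> 0 \<and> (\<forall>\<^sub>F w in nhds z. c w = (w - z) ^ e * h w) \<and> e \<ge> 3 \<and>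
      \<psi> analytic_on {z} \<and> (\<forall>\<^sub>F w in nhds z. W w ^ 12 = \<psi> w * (c w ^ 8 * (a w ^ 9 * b w ^ 9))) \<and> (\<psi> z \<noteq> 0 \<longrightarrow> (8::nat) = 12 \<or> e = 3)"
      by (rule wronskian_power_quotient[OF an(4) an(3) an(1) _ _ nev(3) 3 ords(3), of _ "-1"])
         (use bc W_eq(3) in \<open>auto intro!: analytic_intros an\<close>)
    then obtain \<psi> e h where "h analytic_on {z}" "h z \<noteq> 0" "\<forall>\<^sub>F w in nhds z. c w = (w - z) ^ e * h w"
      "\<psi> analytic_on {z}" "\<forall>\<^sub>F w in nhds z. W w ^ 12 = \<psi> w * (c w ^ 8 * (a w ^ 9 * b w ^ 9))" "\<psi> z \<noteq> 0 \<longrightarrow> e = 3"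
      by auto
    then show ?thesis using root[of h c 3] r4[OF an(1) bc(1), of 4] r4[OF an(2) bc(2), of 4]
      by (intro exI[of _ \<psi>]) (auto simp: mult_ac)
  next
    case 4
    let ?\<psi> = "\<lambda>w. W w ^ 12 / (a w ^ 9 * (b w ^ 9 * c w ^ 8))"
    have "?\<psi> analytic_on {z}" using 4 by (intro analytic_intros an) auto
    moreover have "\<forall>\<^sub>F w in nhds z. W w ^ 12 = ?\<psi> w * (a w ^ 9 * (b w ^ 9 * c w ^ 8))"
      using analytic_nonzero_nhds[OF an(1) 4(1)] analytic_nonzero_nhds[OF an(2) 4(2)] analytic_nonzero_nhds[OF an(3) 4(3)]
      by eventually_elim simp
    ultimately show ?thesis
      using r4[OF an(1) 4(1), of 4] r4[OF an(2) 4(2), of 4] r4[OF an(3) 4(3), of 3]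
      by (intro exI[of _ ?\<psi>]) auto
  qed
qed

text \<open>Off the zeros of \<open>a\<close>, \<open>b\<close> and \<open>c\<close>, which are
  isolated, the quotient is unique. Hence the local quotients agree near each point and glue to an
  entire function.\<close>

lemma exists_Psi:
  "\<exists>\<Psi>. \<Psi> holomorphic_on UNIV \<and> (\<forall>w. W w ^ 12 = \<Psi> w * (a w ^ 9 * (b w ^ 9 * c w ^ 8))) \<and>
    (\<forall>z. \<Psi> z \<noteq> 0 \<longrightarrow>
      (\<exists>A. A analytic_on {z} \<and> (\<forall>\<^sub>F w in nhds z. A w ^ 4 = a w)) \<and>
      (\<exists>B. B analytic_on {z} \<and> (\<forall>\<^sub>F w in nhds z. B w ^ 4 = b w)) \<and>
      (\<exists>C. C analytic_on {z} \<and> (\<forall>\<^sub>F w in nhds z. C w ^ 3 = c w)))"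
proof -
  have "\<forall>z. \<exists>\<psi>. \<psi> analytic_on {z} \<and> (\<forall>\<^sub>F w in nhds z. W w ^ 12 = \<psi> w * (a w ^ 9 * (b w ^ 9 * c w ^ 8))) \<and>
    (\<psi> z \<noteq> 0 \<longrightarrow>
      (\<exists>A. A analytic_on {z} \<and> (\<forall>\<^sub>F w in nhds z. A w ^ 4 = a w)) \<and>
      (\<exists>B. B analytic_on {z} \<and> (\<forall>\<^sub>F w in nhds z. B w ^ 4 = b w)) \<and>
      (\<exists>C. C analytic_on {z} \<and> (\<forall>\<^sub>F w in nhds z. C w ^ 3 = c w)))"
    using exists_Psi_local by (rule allI)
  from choice[OF this] obtain \<psi> where \<psi>: "\<forall>z. \<psi> z analytic_on {z} \<and> (\<forall>\<^sub>F w in nhds z. W w ^ 12 = \<psi> z w * (a w ^ 9 * (b w ^ 9 * c w ^ 8))) \<and>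
    (\<psi> z z \<noteq> 0 \<longrightarrow>
      (\<exists>A. A analytic_on {z} \<and> (\<forall>\<^sub>F w in nhds z. A w ^ 4 = a w)) \<and>
      (\<exists>B. B analytic_on {z} \<and> (\<forall>\<^sub>F w in nhds z. B w ^ 4 = b w)) \<and>
      (\<exists>C. C analytic_on {z} \<and> (\<forall>\<^sub>F w in nhds z. C w ^ 3 = c w)))"
    by (rule exE)
  have an\<psi>: "\<And>z. \<psi> z analytic_on {z}"
    and eq: "\<And>z. \<forall>\<^sub>F w in nhds z. W w ^ 12 = \<psi> z w * (a w ^ 9 * (b w ^ 9 * c w ^ 8))"
    and rt: "\<And>z. \<psi> z z \<noteq> 0 \<Longrightarrow>
      (\<exists>A. A analytic_on {z} \<and> (\<forall>\<^sub>F w in nhds z. A w ^ 4 = a w)) \<and>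
      (\<exists>B. B analytic_on {z} \<and> (\<forall>\<^sub>F w in nhds z. B w ^ 4 = b w)) \<and>
      (\<exists>C. C analytic_on {z} \<and> (\<forall>\<^sub>F w in nhds z. C w ^ 3 = c w))"
    using \<psi> by simp_all
  have ev: "\<forall>\<^sub>F w in nhds z. \<psi> w w = \<psi> z w" for z
  proof -
    have "\<forall>\<^sub>F w in at z. a w ^ 9 * (b w ^ 9 * c w ^ 8) \<noteq> 0"
      using nz_at[of z] by eventually_elim auto
    then have "\<forall>\<^sub>F w in nhds z. w \<noteq> z \<longrightarrow> a w ^ 9 * (b w ^ 9 * c w ^ 8) \<noteq> 0" by (simp add: eventually_at_filter)
    then show ?thesis using eq[of z]
    proof eventually_elim
      case (elim w)
      show ?case
      proof (cases "w = z")
        case False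
        then show ?thesis using elim eventually_nhds_x_imp_x[OF eq[of w]] by simp
      qed simp
    qed
  qed
  show ?thesis
  proof (rule exI[of _ "\<lambda>z. \<psi> z z"], intro conjI allI impI)
    have "(\<lambda>w. \<psi> w w) analytic_on {z}" for z by (subst analytic_at_cong[OF ev refl]) (rule an\<psi>)
    then show "(\<lambda>w. \<psi> w w) holomorphic_on UNIV" by (metis analytic_imp_holomorphic analytic_on_analytic_at)
    show "W w ^ 12 = \<psi> w w * (a w ^ 9 * (b w ^ 9 * c w ^ 8))" for w
      by (rule eventually_nhds_x_imp_x[OF eq[of w]])
  qed (use rt in auto)
qed

end

text \<open>Translates between the Wronskian of the triple and the Wronskian of local roots, which
  is the one that measures curvature in \<open>sum_norm_squares_factorization\<close>.\<close>

lemma deriv_power_wronskian: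
  assumes A: "A analytic_on {z::complex}" and B: "B analytic_on {z}" and q: "q > 0"
    and a: "\<forall>\<^sub>F w in nhds z. A w ^ q = a w" and b: "\<forall>\<^sub>F w in nhds z. B w ^ q = b w"
  shows "\<forall>\<^sub>F w in nhds z. deriv a w * b w - a w * deriv b w
           = of_nat q * (deriv A w * B w - A w * deriv B w) * (A w * B w) ^ (q - 1)"
proof -
  obtain r where r: "q = Suc r" using q by (cases q) auto
  have d: "\<forall>\<^sub>F w in nhds z. deriv f w = of_nat q * F w ^ r * deriv F w"
    if F: "F analytic_on {z}" and f: "\<forall>\<^sub>F w in nhds z. F w ^ q = f w" for F f :: "complex \<Rightarrow> complex"
    using eventually_eventually[THEN iffD2, OF f] eventually_analytic[OF F]
  proof eventually_elim
    case (elim w)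
    have "((\<lambda>w. F w ^ q) has_field_derivative of_nat q * (deriv F w * F w ^ r)) (at w)"
      using DERIV_power[OF analytic_derivI[OF elim(2)], of q] r by simp
    then show ?case using deriv_cong_ev[OF elim(1) refl] by (simp add: DERIV_imp_deriv mult_ac)
  qed
  show ?thesis using d[OF A a] d[OF B b] a b
  proof eventually_elim
    case (elim w)
    show ?case unfolding elim(1,2) elim(3,4)[symmetric] r by (simp add: algebra_simps power_mult_distrib)
  qed
qed

section \<open>The curvature estimate\<close>

context wronskian_triple
begin

text \<open>Ahlfors' method on the disc of radius R. \<Psi> has degree -2 in (a, b),
  \<open>N1\<close> degree 1/2 and \<open>N2\<close> degree 2/3, so \<open>L\<close> has degree 0
  and depends only on the map [a : b]. At a maximum of \<open>L\<close> times (R^2 - |z|^2)^24, the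
  24th power of the inverse hyperbolic density up to a constant, negative curvature bounds the
  product by a constant times R^24; letting R grow gives L = 0.\<close>

lemma wronskian_triple_False: False
proof -
  obtain \<Psi> where "\<Psi> holomorphic_on UNIV \<and> (\<forall>w. W w ^ 12 = \<Psi> w * (a w ^ 9 * (b w ^ 9 * c w ^ 8))) \<and>
    (\<forall>z. \<Psi> z \<noteq> 0 \<longrightarrow>
      (\<exists>A. A analytic_on {z} \<and> (\<forall>\<^sub>F w in nhds z. A w ^ 4 = a w)) \<and>
      (\<exists>B. B analytic_on {z} \<and> (\<forall>\<^sub>F w in nhds z. B w ^ 4 = b w)) \<and>
      (\<exists>C. C analytic_on {z} \<and> (\<forall>\<^sub>F w in nhds z. C w ^ 3 = c w)))"
    using exists_Psi by (rule exE)
  then have \<Psi>: "\<Psi> holomorphic_on UNIV" and W12: "\<And>w. W w ^ 12 = \<Psi> w * (a w ^ 9 * (b w ^ 9 * c w ^ 8))"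
    and rA: "\<And>z. \<Psi> z \<noteq> 0 \<Longrightarrow> \<exists>A. A analytic_on {z} \<and> (\<forall>\<^sub>F w in nhds z. A w ^ 4 = a w)"
    and rB: "\<And>z. \<Psi> z \<noteq> 0 \<Longrightarrow> \<exists>B. B analytic_on {z} \<and> (\<forall>\<^sub>F w in nhds z. B w ^ 4 = b w)"
    and rC: "\<And>z. \<Psi> z \<noteq> 0 \<Longrightarrow> \<exists>C. C analytic_on {z} \<and> (\<forall>\<^sub>F w in nhds z. C w ^ 3 = c w)"
    by simp_all
  have \<Psi>an: "\<Psi> analytic_on {z}" for z using \<Psi> analytic_at by blast
  \<comment> \<open>\<open>L\<close> is the 24th power of a conformal density. The curvature is controlled by \<open>N1\<close> where
    \<open>c\<close> dominates \<open>a\<close>, and by \<open>N2\<close> elsewhere, where \<open>b\<close> is comparable to \<open>a\<close>.\<close>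
  define N1 where "N1 z = sqrt (cmod (a z)) + sqrt (cmod (b z))" for z
  define N2 where "N2 z = (root 3 (cmod (a z)))\<^sup>2 + (root 3 (cmod (c z)))\<^sup>2" for z
  define L where "L z = (cmod (\<Psi> z))\<^sup>2 * N1 z ^ 4 * N2 z ^ 3" for z
  have Npos: "N1 z > 0" "N2 z > 0" for z
  proof -
    show "N1 z > 0" using no_common[of z] by (auto simp: N1_def intro: add_pos_nonneg add_nonneg_pos)
    have "cmod (a z) > 0 \<or> cmod (c z) > 0" using no_common[of z] by (auto simp: c_def)
    then have "(root 3 (cmod (a z)))\<^sup>2 > 0 \<or> (root 3 (cmod (c z)))\<^sup>2 > 0" by auto
    then show "N2 z > 0" unfolding N2_def by (meson add_pos_nonneg add_nonneg_pos zero_le_power2)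
  qed
  have cont: "continuous_on UNIV a" "continuous_on UNIV b" "continuous_on UNIV c" "continuous_on UNIV \<Psi>"
    using hol hol_c \<Psi> by (auto intro: holomorphic_on_imp_continuous_on)
  have Lcont: "continuous_on S L" for S
    unfolding L_def N1_def N2_def by (intro continuous_intros continuous_on_subset[OF cont(1)] continuous_on_subset[OF cont(2)] continuous_on_subset[OF cont(3)] continuous_on_subset[OF cont(4)]) auto
  \<comment> \<open>With fourth roots \<open>A\<close>, \<open>B\<close> of \<open>a\<close>,
    \<open>b\<close> and cube roots \<open>D\<close>, \<open>C\<close> of \<open>a\<close>,
    \<open>c\<close>, the functions \<open>N1\<close> and \<open>N2\<close> become |A|^2 + |B|^2 and
    |D|^2 + |C|^2.\<close>
  have sq4: "sqrt (cmod x) = (cmod y)\<^sup>2" if "y ^ 4 = x" for x y :: complex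
  proof -
    have "cmod x = ((cmod y)\<^sup>2)\<^sup>2" using that by (auto simp: norm_power power_mult[symmetric])
    then show ?thesis by (metis real_sqrt_unique zero_le_power2)
  qed
  have rt3: "root 3 (cmod x) = cmod y" if "y ^ 3 = x" for x y :: complex
    using that by (auto simp: norm_power real_root_power_cancel)
  \<comment> \<open>A generous bound for the numerical factors of both cases below; it only has to
    be independent of R.\<close>
  define K :: real where "K = 2 ^ 400"
  have key: "L z0 * (R\<^sup>2 - (cmod z0)\<^sup>2) ^ 24 \<le> K * R ^ 24"
    if R: "R > 0" "cmod z0 < R" and Lz: "\<Psi> z0 \<noteq> 0"
      and max: "\<And>z. cmod z \<le> R \<Longrightarrow> L z * (R\<^sup>2 - (cmod z)\<^sup>2) ^ 24 \<le> L z0 * (R\<^sup>2 - (cmod z0)\<^sup>2) ^ 24" for R z0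
  proof -
    define S where "S = R\<^sup>2 - (cmod z0)\<^sup>2"
    have S: "S > 0" using R unfolding S_def by (simp add: power_strict_mono)
    obtain A where A: "A analytic_on {z0}" "\<forall>\<^sub>F w in nhds z0. A w ^ 4 = a w" using rA[OF Lz] by blast
    obtain B where B: "B analytic_on {z0}" "\<forall>\<^sub>F w in nhds z0. B w ^ 4 = b w" using rB[OF Lz] by blast
    obtain C where C: "C analytic_on {z0}" "\<forall>\<^sub>F w in nhds z0. C w ^ 3 = c w" using rC[OF Lz] by blast
    note A0 = eventually_nhds_x_imp_x[OF A(2)] and B0 = eventually_nhds_x_imp_x[OF B(2)] and C0 = eventually_nhds_x_imp_x[OF C(2)]
    have AB: "A z0 \<noteq> 0 \<or> B z0 \<noteq> 0" using no_common[of z0] A0 B0 by auto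
    obtain E1 g1 where E1: "E1 analytic_on {z0}" "g1 analytic_on {z0}" "E1 z0 \<noteq> 0" "g1 z0 = 0"
      "\<forall>\<^sub>F w in nhds z0. (cmod (A w))\<^sup>2 + (cmod (B w))\<^sup>2 = (cmod (E1 w))\<^sup>2 * (1 + (cmod (g1 w))\<^sup>2)"
      "cmod (deriv g1 z0) * ((cmod (A z0))\<^sup>2 + (cmod (B z0))\<^sup>2) = cmod (deriv A z0 * B z0 - A z0 * deriv B z0)"
      by (rule sum_norm_squares_factorization[OF A(1) B(1) AB])
    have N1eq: "\<forall>\<^sub>F w in nhds z0. N1 w = (cmod (E1 w))\<^sup>2 * (1 + (cmod (g1 w))\<^sup>2)"
      using E1(5) A(2) B(2) by eventually_elim (simp add: N1_def sq4)
    have N1z: "N1 z0 = (cmod (A z0))\<^sup>2 + (cmod (B z0))\<^sup>2" using A0 B0 by (simp add: N1_def sq4)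
    have inR: "\<forall>\<^sub>F z in nhds z0. cmod z < R"
      using eventually_nhds_in_open[of "ball 0 R" z0] R by simp
    note N1z' = eventually_nhds_x_imp_x[OF N1eq]
    show ?thesis
    proof (cases "2 * cmod (c z0) \<ge> cmod (a z0)")
      case True
      \<comment> \<open>The curvature comes from \<open>N1\<close> in this case, so for
        \<open>N2\<close> a lower bound |E2|^2 with equality at \<open>z0\<close> suffices. At a
        zero of \<open>a\<close> a holomorphic cube root of \<open>a\<close> may fail to exist, and
        |C|^2 serves as the bound.\<close>
      have "\<exists>E2. E2 analytic_on {z0} \<and> E2 z0 \<noteq> 0 \<and> (\<forall>\<^sub>F w in nhds z0. (cmod (E2 w))\<^sup>2 \<le> N2 w) \<and> (cmod (E2 z0))\<^sup>2 = N2 z0"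
      proof (cases "a z0 = 0")
        case True
        then have "C z0 \<noteq> 0" using C0 no_common[of z0] by (auto simp: c_def)
        moreover have "\<forall>\<^sub>F w in nhds z0. (cmod (C w))\<^sup>2 \<le> N2 w"
          using C(2) by eventually_elim (simp add: N2_def rt3)
        moreover have "(cmod (C z0))\<^sup>2 = N2 z0" using C0 True by (simp add: N2_def rt3)
        ultimately show ?thesis using C(1) by blast
      next
        case False
        obtain D where D: "D analytic_on {z0}" "\<forall>\<^sub>F w in nhds z0. D w ^ 3 = a w"
          using local_root[OF an(1) False, of 3] by auto
        note D0 = eventually_nhds_x_imp_x[OF D(2)]
        have "D z0 \<noteq> 0 \<or> C z0 \<noteq> 0" using D0 False by auto
        then obtain E2 g2 where E2: "E2 analytic_on {z0}" "g2 analytic_on {z0}" "E2 z0 \<noteq> 0" "g2 z0 = 0"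
          "\<forall>\<^sub>F w in nhds z0. (cmod (D w))\<^sup>2 + (cmod (C w))\<^sup>2 = (cmod (E2 w))\<^sup>2 * (1 + (cmod (g2 w))\<^sup>2)"
          by (rule sum_norm_squares_factorization[OF D(1) C(1)])
        have N2eq: "\<forall>\<^sub>F w in nhds z0. N2 w = (cmod (E2 w))\<^sup>2 * (1 + (cmod (g2 w))\<^sup>2)"
          using E2(5) D(2) C(2) by eventually_elim (simp add: N2_def rt3)
        then have "\<forall>\<^sub>F w in nhds z0. (cmod (E2 w))\<^sup>2 \<le> N2 w" by eventually_elim (simp add: distrib_left)
        moreover have "(cmod (E2 z0))\<^sup>2 = N2 z0" using eventually_nhds_x_imp_x[OF N2eq] E2(4) by simp
        ultimately show ?thesis using E2(1,3) by blast
      qed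
      then obtain E2 where E2: "E2 analytic_on {z0}" "E2 z0 \<noteq> 0" "\<forall>\<^sub>F w in nhds z0. (cmod (E2 w))\<^sup>2 \<le> N2 w" "(cmod (E2 z0))\<^sup>2 = N2 z0"
        by blast
      define E where "E w = \<Psi> w ^ 2 * E1 w ^ 8 * E2 w ^ 6" for w
      have Ean: "E analytic_on {z0}" unfolding E_def by (intro analytic_intros \<Psi>an E1 E2)
      have Ez: "cmod (E z0) = L z0"
      proof -
        have "cmod (E z0) = (cmod (\<Psi> z0))\<^sup>2 * ((cmod (E1 z0))\<^sup>2) ^ 4 * ((cmod (E2 z0))\<^sup>2) ^ 3"
          by (simp add: E_def norm_mult norm_power power_mult[symmetric])
        then show ?thesis using N1z' E1(4) E2(4) by (simp add: L_def)
      qed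
      have "\<forall>\<^sub>F z in nhds z0. cmod (E z) * (1 + (cmod (g1 z))\<^sup>2) ^ 4 * (R\<^sup>2 - (cmod z)\<^sup>2) ^ 24
        \<le> cmod (E z0) * (R\<^sup>2 - (cmod z0)\<^sup>2) ^ 24"
        using N1eq E2(3) inR
      proof eventually_elim
        case (elim w)
        have "cmod (E w) * (1 + (cmod (g1 w))\<^sup>2) ^ 4 = (cmod (\<Psi> w))\<^sup>2 * N1 w ^ 4 * ((cmod (E2 w))\<^sup>2) ^ 3"
          unfolding elim(1) by (simp add: E_def norm_mult norm_power power_mult[symmetric] power_mult_distrib)
        also have "\<dots> \<le> L w" unfolding L_def
          using elim(2) Npos[of w] by (intro mult_left_mono power_mono) auto
        finally have "cmod (E w) * (1 + (cmod (g1 w))\<^sup>2) ^ 4 * (R\<^sup>2 - (cmod w)\<^sup>2) ^ 24 \<le> L w * (R\<^sup>2 - (cmod w)\<^sup>2) ^ 24"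
          using elim(3) by (intro mult_right_mono zero_le_power) (auto simp: power_mono)
        also have "\<dots> \<le> L z0 * (R\<^sup>2 - (cmod z0)\<^sup>2) ^ 24" using max elim(3) by simp
        finally show ?case by (simp add: Ez)
      qed
      from ahlfors_pointwise[OF Ean E1(2) _ E1(4) R(2) this]
      \<comment> \<open>6 = 24 / 4, the exponent of the weight over that of \<open>N1\<close> in
        \<open>L\<close>.\<close>
      have bound: "(cmod (deriv g1 z0))\<^sup>2 \<le> 6 * R\<^sup>2 / S\<^sup>2" using Lz E1(3) E2(2) by (simp add: E_def S_def)
      \<comment> \<open>W is 4 (A B)^3 times the Wronskian of \<open>A\<close> and \<open>B\<close>,
        and (A B)^36 = a^9 b^9. This factor cancels off isolated points, hence at \<open>z0\<close>
        by continuity, and leaves \<Psi> c^8.\<close>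
      have "\<forall>\<^sub>F w in nhds z0. (4 * (deriv A w * B w - A w * deriv B w)) ^ 12 * (a w ^ 9 * b w ^ 9) = \<Psi> w * c w ^ 8 * (a w ^ 9 * b w ^ 9)"
        using deriv_power_wronskian[OF A(1) B(1) zero_less_numeral A(2) B(2)] A(2) B(2)
      proof eventually_elim
        case (elim w)
        have "\<Psi> w * c w ^ 8 * (a w ^ 9 * b w ^ 9) = W w ^ 12" by (simp add: W12)
        also have "W w = 4 * (deriv A w * B w - A w * deriv B w) * (A w * B w) ^ 3" using elim by (simp add: W_def)
        also have "\<dots> ^ 12 = (4 * (deriv A w * B w - A w * deriv B w)) ^ 12 * ((A w ^ 4) ^ 9 * (B w ^ 4) ^ 9)"
          by (simp add: power_mult_distrib power_mult[symmetric])
        finally show ?case unfolding elim(2,3) by (rule sym)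
      qed
      then have "\<forall>\<^sub>F w in at z0. (4 * (deriv A w * B w - A w * deriv B w)) ^ 12 * (a w ^ 9 * b w ^ 9) = \<Psi> w * c w ^ 8 * (a w ^ 9 * b w ^ 9)"
        by (simp add: eventually_nhds_conv_at)
      then have "\<forall>\<^sub>F w in at z0. (4 * (deriv A w * B w - A w * deriv B w)) ^ 12 = \<Psi> w * c w ^ 8"
        using nz_at[of z0] by eventually_elim simp
      then have "(4 * (deriv A z0 * B z0 - A z0 * deriv B z0)) ^ 12 = \<Psi> z0 * c z0 ^ 8"
        by (intro analytic_eq_of_eventually_eq[of "\<lambda>w. (4 * (deriv A w * B w - A w * deriv B w)) ^ 12" z0 "\<lambda>w. \<Psi> w * c w ^ 8"])
           (auto intro!: analytic_intros analytic_deriv A B \<Psi>an an)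
      then have "cmod ((4 * (deriv A z0 * B z0 - A z0 * deriv B z0)) ^ 12) = cmod (\<Psi> z0 * c z0 ^ 8)" by (rule arg_cong)
      then have "(4 * cmod (deriv A z0 * B z0 - A z0 * deriv B z0)) ^ 12 = cmod (\<Psi> z0) * cmod (c z0) ^ 8"
        by (simp only: norm_power norm_mult norm_numeral)
      then have eq: "(4 * (cmod (deriv g1 z0) * N1 z0)) ^ 12 = cmod (\<Psi> z0) * cmod (c z0) ^ 8"
        using E1(6) N1z by simp
      \<comment> \<open>As |a| \<le> 2 |c| and b = c - a, all three moduli are bounded by multiples
        of \<open>x\<close>.\<close>
      define x where "x = cmod (c z0)"
      have x0: "x > 0" using True no_common[of z0] by (auto simp: x_def c_def)
      have bb: "cmod (b z0) \<le> 3 * x"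
      proof -
        have "b z0 = c z0 - a z0" by (simp add: c_def)
        then have "cmod (b z0) \<le> cmod (c z0) + cmod (a z0)" by (metis norm_triangle_ineq4)
        with True show ?thesis by (simp add: x_def)
      qed
      have N1x: "N1 z0 ^ 4 \<le> 256 * x\<^sup>2"
      proof -
        have "sqrt (cmod (a z0)) \<le> sqrt (4 * x)" "sqrt (cmod (b z0)) \<le> sqrt (4 * x)"
          unfolding real_sqrt_le_iff using True bb x0 unfolding x_def by linarith+
        then have "N1 z0 \<le> 4 * sqrt x" unfolding N1_def by (simp add: real_sqrt_mult)
        then have "N1 z0 ^ 4 \<le> (4 * sqrt x) ^ 4" using Npos[of z0] by (intro power_mono) auto
        also have "(4 * sqrt x) ^ 4 = 256 * ((sqrt x)\<^sup>2)\<^sup>2" by (simp add: power_mult_distrib power_mult[symmetric])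
        finally show ?thesis using x0 by simp
      qed
      have N2x: "N2 z0 ^ 3 \<le> 125 * x\<^sup>2"
      proof -
        have "root 3 (cmod (a z0)) \<le> root 3 (8 * x)"
          using True x0 unfolding x_def by (intro real_root_le_mono) linarith+
        also have "\<dots> = root 3 (2 ^ 3) * root 3 x" by (simp add: real_root_mult)
        also have "root 3 (2 ^ 3) = (2::real)" by (rule real_root_power_cancel) auto
        finally have "(root 3 (cmod (a z0)))\<^sup>2 \<le> (2 * root 3 x)\<^sup>2" by (intro power_mono) auto
        then have "N2 z0 \<le> 5 * (root 3 x)\<^sup>2" unfolding N2_def x_def by (simp add: power_mult_distrib)
        then have "N2 z0 ^ 3 \<le> (5 * (root 3 x)\<^sup>2) ^ 3" using Npos[of z0] by (intro power_mono) auto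
        also have "\<dots> = 125 * (root 3 x ^ 3)\<^sup>2" by (simp add: power_mult_distrib power_mult[symmetric])
        also have "root 3 x ^ 3 = x" using x0 by simp
        finally show ?thesis .
      qed
      \<comment> \<open>|g1'| \<open>N1\<close> is the modulus of the Wronskian of \<open>A\<close>
        and \<open>B\<close>, so the curvature bound becomes a bound for |\<Psi>|^2 x^4, and
        \<open>L\<close> is at most a constant times that quantity.\<close>
      have "(cmod (\<Psi> z0))\<^sup>2 * x ^ 16 = ((4 * (cmod (deriv g1 z0) * N1 z0)) ^ 12)\<^sup>2"
        unfolding eq x_def by (simp add: power_mult_distrib power_mult[symmetric])
      also have "\<dots> = 4 ^ 24 * ((cmod (deriv g1 z0))\<^sup>2) ^ 12 * (N1 z0 ^ 4) ^ 6"
        by (simp add: power_mult_distrib power_mult[symmetric])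
      also have "\<dots> \<le> 4 ^ 24 * (6 * R\<^sup>2 / S\<^sup>2) ^ 12 * (256 * x\<^sup>2) ^ 6"
        using bound N1x Npos[of z0] by (intro mult_mono power_mono) auto
      also have "\<dots> = (4 ^ 24 * 6 ^ 12 * 256 ^ 6) * (R ^ 24 / S ^ 24) * x ^ 12"
        by (simp add: power_mult_distrib power_divide power_mult[symmetric])
      finally have "(cmod (\<Psi> z0))\<^sup>2 * x ^ 4 * x ^ 12 \<le> (4 ^ 24 * 6 ^ 12 * 256 ^ 6) * (R ^ 24 / S ^ 24) * x ^ 12"
        by (simp add: power_add[symmetric] mult.assoc)
      then have P: "(cmod (\<Psi> z0))\<^sup>2 * x ^ 4 \<le> (4 ^ 24 * 6 ^ 12 * 256 ^ 6) * (R ^ 24 / S ^ 24)"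
        using x0 by (simp only: mult_le_cancel_right_pos[OF zero_less_power[OF x0]])
      have "L z0 \<le> (cmod (\<Psi> z0))\<^sup>2 * (256 * x\<^sup>2) * (125 * x\<^sup>2)"
        unfolding L_def using N1x N2x Npos[of z0] x0 by (intro mult_mono) auto
      also have "\<dots> = (256 * 125) * ((cmod (\<Psi> z0))\<^sup>2 * x ^ 4)" by (simp add: power2_eq_square power4_eq_xxxx)
      also have "\<dots> \<le> (256 * 125) * ((4 ^ 24 * 6 ^ 12 * 256 ^ 6) * (R ^ 24 / S ^ 24))" using P by (intro mult_left_mono) auto
      also have "\<dots> \<le> K * (R ^ 24 / S ^ 24)" unfolding K_def mult.assoc[symmetric]
        using R S by (intro mult_right_mono) auto
      finally show ?thesis using S by (simp add: S_def field_simps)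
    next
      case False
      then have ca: "2 * cmod (c z0) < cmod (a z0)" by simp
      then have a0: "a z0 \<noteq> 0" by auto
      obtain D where D: "D analytic_on {z0}" "\<forall>\<^sub>F w in nhds z0. D w ^ 3 = a w"
        using local_root[OF an(1) a0, of 3] by auto
      note D0 = eventually_nhds_x_imp_x[OF D(2)]
      have DC: "D z0 \<noteq> 0 \<or> C z0 \<noteq> 0" using D0 a0 by auto
      obtain E2 g2 where E2: "E2 analytic_on {z0}" "g2 analytic_on {z0}" "E2 z0 \<noteq> 0" "g2 z0 = 0"
        "\<forall>\<^sub>F w in nhds z0. (cmod (D w))\<^sup>2 + (cmod (C w))\<^sup>2 = (cmod (E2 w))\<^sup>2 * (1 + (cmod (g2 w))\<^sup>2)"
        "cmod (deriv g2 z0) * ((cmod (D z0))\<^sup>2 + (cmod (C z0))\<^sup>2) = cmod (deriv D z0 * C z0 - D z0 * deriv C z0)"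
        by (rule sum_norm_squares_factorization[OF D(1) C(1) DC])
      have N2eq: "\<forall>\<^sub>F w in nhds z0. N2 w = (cmod (E2 w))\<^sup>2 * (1 + (cmod (g2 w))\<^sup>2)"
        using E2(5) D(2) C(2) by eventually_elim (simp add: N2_def rt3)
      have N2z: "N2 z0 = (cmod (D z0))\<^sup>2 + (cmod (C z0))\<^sup>2" using D0 C0 by (simp add: N2_def rt3)
      note N2z' = eventually_nhds_x_imp_x[OF N2eq]
      define E where "E w = \<Psi> w ^ 2 * E1 w ^ 8 * E2 w ^ 6" for w
      have Ean: "E analytic_on {z0}" unfolding E_def by (intro analytic_intros \<Psi>an E1 E2)
      have Ez: "cmod (E z0) = L z0"
      proof -
        have "cmod (E z0) = (cmod (\<Psi> z0))\<^sup>2 * ((cmod (E1 z0))\<^sup>2) ^ 4 * ((cmod (E2 z0))\<^sup>2) ^ 3"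
          by (simp add: E_def norm_mult norm_power power_mult[symmetric])
        then show ?thesis using N1z' N2z' E1(4) E2(4) by (simp add: L_def)
      qed
      have "\<forall>\<^sub>F z in nhds z0. cmod (E z) * (1 + (cmod (g2 z))\<^sup>2) ^ 3 * (R\<^sup>2 - (cmod z)\<^sup>2) ^ 24
        \<le> cmod (E z0) * (R\<^sup>2 - (cmod z0)\<^sup>2) ^ 24"
        using N1eq N2eq inR
      proof eventually_elim
        case (elim w)
        have "cmod (E w) * (1 + (cmod (g2 w))\<^sup>2) ^ 3 = (cmod (\<Psi> w))\<^sup>2 * ((cmod (E1 w))\<^sup>2) ^ 4 * N2 w ^ 3"
          unfolding elim(2) by (simp add: E_def norm_mult norm_power power_mult[symmetric] power_mult_distrib)
        also have "\<dots> \<le> L w" unfolding L_def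
          using elim(1) Npos[of w] by (intro mult_right_mono mult_left_mono power_mono) (auto simp: distrib_left)
        finally have "cmod (E w) * (1 + (cmod (g2 w))\<^sup>2) ^ 3 * (R\<^sup>2 - (cmod w)\<^sup>2) ^ 24 \<le> L w * (R\<^sup>2 - (cmod w)\<^sup>2) ^ 24"
          using elim(3) by (intro mult_right_mono zero_le_power) (auto simp: power_mono)
        also have "\<dots> \<le> L z0 * (R\<^sup>2 - (cmod z0)\<^sup>2) ^ 24" using max elim(3) by simp
        finally show ?case by (simp add: Ez)
      qed
      from ahlfors_pointwise[OF Ean E2(2) _ E2(4) R(2) this]
      \<comment> \<open>8 = 24 / 3, the exponent of the weight over that of \<open>N2\<close> in
        \<open>L\<close>.\<close>
      have bound: "(cmod (deriv g2 z0))\<^sup>2 \<le> 8 * R\<^sup>2 / S\<^sup>2" using Lz E1(3) E2(3) by (simp add: E_def S_def)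
      \<comment> \<open>W is also the Wronskian of \<open>a\<close> and \<open>c\<close>, namely 3
        (D C)^2 times that of \<open>D\<close> and \<open>C\<close>, and (D C)^24 = a^8 c^8.
        Cancelling leaves \<Psi> a b^9.\<close>
      have "\<forall>\<^sub>F w in nhds z0. (3 * (deriv D w * C w - D w * deriv C w)) ^ 12 * (a w ^ 8 * c w ^ 8) = \<Psi> w * a w * b w ^ 9 * (a w ^ 8 * c w ^ 8)"
        using deriv_power_wronskian[OF D(1) C(1) zero_less_numeral D(2) C(2)] D(2) C(2)
      proof eventually_elim
        case (elim w)
        have "\<Psi> w * a w * b w ^ 9 * (a w ^ 8 * c w ^ 8) = W w ^ 12" unfolding W12 by (simp add: eval_nat_numeral)
        also have "W w = 3 * (deriv D w * C w - D w * deriv C w) * (D w * C w) ^ 2" using elim by (simp add: W_eq(4))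
        also have "\<dots> ^ 12 = (3 * (deriv D w * C w - D w * deriv C w)) ^ 12 * ((D w ^ 3) ^ 8 * (C w ^ 3) ^ 8)"
          by (simp add: power_mult_distrib power_mult[symmetric])
        finally show ?case unfolding elim(2,3) by (rule sym)
      qed
      then have "\<forall>\<^sub>F w in at z0. (3 * (deriv D w * C w - D w * deriv C w)) ^ 12 * (a w ^ 8 * c w ^ 8) = \<Psi> w * a w * b w ^ 9 * (a w ^ 8 * c w ^ 8)"
        by (simp add: eventually_nhds_conv_at)
      then have "\<forall>\<^sub>F w in at z0. (3 * (deriv D w * C w - D w * deriv C w)) ^ 12 = \<Psi> w * a w * b w ^ 9"
        using nz_at[of z0] by eventually_elim simp
      then have "(3 * (deriv D z0 * C z0 - D z0 * deriv C z0)) ^ 12 = \<Psi> z0 * a z0 * b z0 ^ 9"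
        by (intro analytic_eq_of_eventually_eq[of "\<lambda>w. (3 * (deriv D w * C w - D w * deriv C w)) ^ 12" z0 "\<lambda>w. \<Psi> w * a w * b w ^ 9"])
           (auto intro!: analytic_intros analytic_deriv D C \<Psi>an an)
      then have "cmod ((3 * (deriv D z0 * C z0 - D z0 * deriv C z0)) ^ 12) = cmod (\<Psi> z0 * a z0 * b z0 ^ 9)" by (rule arg_cong)
      then have "(3 * cmod (deriv D z0 * C z0 - D z0 * deriv C z0)) ^ 12 = cmod (\<Psi> z0) * cmod (a z0) * cmod (b z0) ^ 9"
        by (simp only: norm_power norm_mult norm_numeral)
      then have eq: "(3 * (cmod (deriv g2 z0) * N2 z0)) ^ 12 = cmod (\<Psi> z0) * cmod (a z0) * cmod (b z0) ^ 9"
        using E2(6) N2z by simp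
      define x where "x = cmod (a z0)"
      have x0: "x > 0" using a0 by (auto simp: x_def)
      \<comment> \<open>The lower bound for |b|, valid because \<open>c\<close> is small against
        \<open>a\<close>, is what allows the factor |b|^9 in \<open>eq\<close> to be traded for a
        power of \<open>x\<close>.\<close>
      have bb: "cmod (b z0) \<le> 2 * x" "cmod (b z0) \<ge> x / 2"
      proof -
        have "b z0 = c z0 - a z0" "a z0 = c z0 - b z0" by (simp_all add: c_def)
        then have "cmod (b z0) \<le> cmod (c z0) + cmod (a z0)" "cmod (a z0) \<le> cmod (c z0) + cmod (b z0)" by (metis norm_triangle_ineq4)+
        with ca show "cmod (b z0) \<le> 2 * x" "cmod (b z0) \<ge> x / 2" by (simp_all add: x_def)
      qed
      have N1x: "N1 z0 ^ 4 \<le> 256 * x\<^sup>2"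
      proof -
        have "sqrt (cmod (a z0)) \<le> sqrt (4 * x)" "sqrt (cmod (b z0)) \<le> sqrt (4 * x)"
          unfolding real_sqrt_le_iff using bb x0 by (simp_all add: x_def)
        then have "N1 z0 \<le> 4 * sqrt x" unfolding N1_def by (simp add: real_sqrt_mult)
        then have "N1 z0 ^ 4 \<le> (4 * sqrt x) ^ 4" using Npos[of z0] by (intro power_mono) auto
        also have "(4 * sqrt x) ^ 4 = 256 * ((sqrt x)\<^sup>2)\<^sup>2" by (simp add: power_mult_distrib power_mult[symmetric])
        finally show ?thesis using x0 by simp
      qed
      have N2x: "N2 z0 ^ 3 \<le> 8 * x\<^sup>2"
      proof -
        have "root 3 (cmod (c z0)) \<le> root 3 x"
          using ca norm_ge_zero[of "c z0"] unfolding x_def by (intro real_root_le_mono) linarith+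
        then have "(root 3 (cmod (c z0)))\<^sup>2 \<le> (root 3 x)\<^sup>2" by (intro power_mono) auto
        then have "N2 z0 \<le> 2 * (root 3 x)\<^sup>2" unfolding N2_def x_def by simp
        then have "N2 z0 ^ 3 \<le> (2 * (root 3 x)\<^sup>2) ^ 3" using Npos[of z0] by (intro power_mono) auto
        also have "\<dots> = 8 * (root 3 x ^ 3)\<^sup>2" by (simp add: power_mult_distrib power_mult[symmetric])
        also have "root 3 x ^ 3 = x" using x0 by simp
        finally show ?thesis .
      qed
      have "(cmod (\<Psi> z0))\<^sup>2 * x\<^sup>2 * (x / 2) ^ 18 \<le> (cmod (\<Psi> z0))\<^sup>2 * x\<^sup>2 * cmod (b z0) ^ 18"
        using bb x0 by (intro mult_left_mono power_mono) auto
      also have "\<dots> = ((3 * (cmod (deriv g2 z0) * N2 z0)) ^ 12)\<^sup>2"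
        unfolding eq x_def by (simp add: power_mult_distrib power_mult[symmetric])
      also have "\<dots> = 3 ^ 24 * ((cmod (deriv g2 z0))\<^sup>2) ^ 12 * (N2 z0 ^ 3) ^ 8"
        by (simp add: power_mult_distrib power_mult[symmetric])
      also have "\<dots> \<le> 3 ^ 24 * (8 * R\<^sup>2 / S\<^sup>2) ^ 12 * (8 * x\<^sup>2) ^ 8"
        using bound N2x Npos[of z0] by (intro mult_mono power_mono) auto
      also have "\<dots> = (3 ^ 24 * 8 ^ 12 * 8 ^ 8) * (R ^ 24 / S ^ 24) * x ^ 16"
        by (simp add: power_mult_distrib power_divide power_mult[symmetric])
      also have "(cmod (\<Psi> z0))\<^sup>2 * x\<^sup>2 * (x / 2) ^ 18 = (cmod (\<Psi> z0))\<^sup>2 * x ^ 4 / 2 ^ 18 * x ^ 16"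
        by (simp add: power_divide power_add[symmetric])
      finally have "(cmod (\<Psi> z0))\<^sup>2 * x ^ 4 / 2 ^ 18 \<le> (3 ^ 24 * 8 ^ 12 * 8 ^ 8) * (R ^ 24 / S ^ 24)"
        using x0 by (simp only: mult_le_cancel_right_pos[OF zero_less_power[OF x0]])
      then have P: "(cmod (\<Psi> z0))\<^sup>2 * x ^ 4 \<le> (3 ^ 24 * 8 ^ 12 * 8 ^ 8 * 2 ^ 18) * (R ^ 24 / S ^ 24)"
        by (simp add: field_simps)
      have "L z0 \<le> (cmod (\<Psi> z0))\<^sup>2 * (256 * x\<^sup>2) * (8 * x\<^sup>2)"
        unfolding L_def using N1x N2x Npos[of z0] x0 by (intro mult_mono) auto
      also have "\<dots> = (256 * 8) * ((cmod (\<Psi> z0))\<^sup>2 * x ^ 4)" by (simp add: power2_eq_square power4_eq_xxxx)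
      also have "\<dots> \<le> (256 * 8) * ((3 ^ 24 * 8 ^ 12 * 8 ^ 8 * 2 ^ 18) * (R ^ 24 / S ^ 24))" using P by (intro mult_left_mono) auto
      also have "\<dots> \<le> K * (R ^ 24 / S ^ 24)" unfolding K_def mult.assoc[symmetric]
        using R S by (intro mult_right_mono) auto
      finally show ?thesis using S by (simp add: S_def field_simps)
    qed
  qed
  have bound: "L z * (R\<^sup>2 - (cmod z)\<^sup>2) ^ 24 \<le> K * R ^ 24" if R: "R > 0" and z: "cmod z \<le> R" for R z
  proof -
    have "\<exists>z0\<in>cball 0 R. \<forall>z\<in>cball 0 R. L z * (R\<^sup>2 - (cmod z)\<^sup>2) ^ 24 \<le> L z0 * (R\<^sup>2 - (cmod z0)\<^sup>2) ^ 24"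
      using R by (intro continuous_attains_sup compact_cball continuous_intros Lcont) auto
    then obtain z0 where z0: "cmod z0 \<le> R" "\<And>z. cmod z \<le> R \<Longrightarrow> L z * (R\<^sup>2 - (cmod z)\<^sup>2) ^ 24 \<le> L z0 * (R\<^sup>2 - (cmod z0)\<^sup>2) ^ 24"
      by auto
    have "L z0 * (R\<^sup>2 - (cmod z0)\<^sup>2) ^ 24 \<le> K * R ^ 24"
    proof (cases "cmod z0 < R \<and> \<Psi> z0 \<noteq> 0")
      case True
      then show ?thesis using key[OF R, of z0] z0(2) by blast
    next
      case False
      \<comment> \<open>On the boundary circle the weight is 0, and at a zero of \<Psi> the function
        \<open>L\<close> is.\<close>
      then have "R\<^sup>2 - (cmod z0)\<^sup>2 = 0 \<or> L z0 = 0" using z0(1) by (auto simp: L_def)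
      then have *: "L z0 * (R\<^sup>2 - (cmod z0)\<^sup>2) ^ 24 = 0" by auto
      show ?thesis unfolding * using R by (simp add: K_def)
    qed
    with z0(2)[OF z] show ?thesis by linarith
  qed
  \<comment> \<open>With z fixed and R tending to infinity, the bound decays like R^(-24).\<close>
  have "L z \<le> 0" for z
  proof (rule tendsto_lowerbound)
    show "((\<lambda>R. K * (R / (R\<^sup>2 - (cmod z)\<^sup>2)) ^ 24) \<longlongrightarrow> 0) at_top"
    proof -
      have "((\<lambda>R::real. R / (R\<^sup>2 - (cmod z)\<^sup>2)) \<longlongrightarrow> 0) at_top" by real_asymp
      then have "((\<lambda>R. K * (R / (R\<^sup>2 - (cmod z)\<^sup>2)) ^ 24) \<longlongrightarrow> K * 0 ^ 24) at_top" by (intro tendsto_intros)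
      then show ?thesis by simp
    qed
    show "\<forall>\<^sub>F R in at_top. L z \<le> K * (R / (R\<^sup>2 - (cmod z)\<^sup>2)) ^ 24"
      using eventually_gt_at_top[of "cmod z"]
    proof eventually_elim
      case (elim R)
      then have R: "R > 0" by (meson le_less_trans norm_ge_zero)
      have "R\<^sup>2 - (cmod z)\<^sup>2 > 0" using elim by (simp add: power_strict_mono)
      then show ?case using bound[OF R, of z] elim by (simp add: power_divide pos_le_divide_eq)
    qed
  qed simp
  then have "\<Psi> z = 0" for z using Npos[of z] unfolding L_def
    by (metis mult_pos_pos not_less zero_less_power zero_less_norm_iff)
  then have "W z = 0" for z using W12[of z] by simp
  with W_nz show False by blast
qed

end

lemma sum_of_high_order_functions:
  fixes a b :: "complex \<Rightarrow> complex"
  assumes "a holomorphic_on UNIV" "b holomorphic_on UNIV" "\<And>z. a z \<noteq> 0 \<or> b z \<noteq> 0"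
    and "zero_orders_ge 4 a" "zero_orders_ge 4 b" "zero_orders_ge 3 (\<lambda>z. a z + b z)"
  shows "deriv a z * b z = a z * deriv b z"
proof (rule ccontr)
  assume "\<not> ?thesis"
  then interpret wronskian_triple a b "\<lambda>z. a z + b z" "\<lambda>z. deriv a z * b z - a z * deriv b z"
    using assms by unfold_locales auto
  show False by (rule wronskian_triple_False)
qed

subsection \<open>Entire curves and Brody's limit theorem\<close>

text \<open>The quotient has derivative 0 near \<open>z0\<close>; the identity without denominators
  then extends past the zeros of \<open>g\<close> by analytic continuation.\<close>

lemma wronskian_zero_imp_proportional:
  assumes f: "f holomorphic_on UNIV" and g: "g holomorphic_on UNIV"
    and w: "\<And>z. deriv f z * g z = f z * deriv g (z::complex)" and g0: "g z0 \<noteq> 0"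
  shows "f z * g z0 = f z0 * g z"
proof -
  have an: "f analytic_on {z}" "g analytic_on {z}" for z using f g analytic_at by blast+
  have "\<forall>\<^sub>F w in nhds z0. g w \<noteq> 0" using an(2) g0 by (rule analytic_nonzero_nhds)
  then obtain r where r: "r > 0" "\<And>w. dist w z0 < r \<Longrightarrow> g w \<noteq> 0" unfolding eventually_nhds_metric by blast
  have "\<exists>k. \<forall>x\<in>ball z0 r. f x / g x = k"
  proof (rule has_field_derivative_zero_constant)
    fix x assume x: "x \<in> ball z0 r"
    then have gx: "g x \<noteq> 0" using r(2) by (simp add: dist_commute)
    have "((\<lambda>w. f w / g w) has_field_derivative (deriv f x * g x - f x * deriv g x) / (g x * g x)) (at x)"
      by (rule DERIV_divide[OF analytic_derivI[OF an(1)] analytic_derivI[OF an(2)] gx])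
    then show "((\<lambda>w. f w / g w) has_field_derivative 0) (at x within ball z0 r)"
      by (simp add: w has_field_derivative_at_within)
  qed simp
  then obtain k where "\<And>x. x \<in> ball z0 r \<Longrightarrow> f x / g x = k" by blast
  then have quot: "f w / g w = f z0 / g z0" if "w \<in> ball z0 r" for w
    using r(1) that by simp
  have eq: "f w * g z0 - f z0 * g w = 0" if w: "w \<in> ball z0 r" for w
    using quot[OF w] r(2)[of w] w g0 by (simp add: frac_eq_eq dist_commute mult.commute)
  have "(\<lambda>w. f w * g z0 - f z0 * g w) holomorphic_on UNIV" by (intro holomorphic_intros f g)
  from analytic_continuation_open[of "ball z0 r" UNIV _ "\<lambda>_. 0" z, OF _ _ _ _ _ this]
  show ?thesis using r(1) eq by (auto simp: connected_UNIV)
qed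

section \<open>The projective speed of an entire curve\<close>

definition norm_sq :: "nat \<Rightarrow> cvec \<Rightarrow> real" where
  "norm_sq N x = (\<Sum>i\<le>N. (cmod (x i))\<^sup>2)"

text \<open>Comparable to the Fubini-Study speed |v \<and> v'| / |v|^2 (wedge product), with the l^1
  norm of the minors in place of the Euclidean one. Multiplying the lift by a nonvanishing function
  does not change it.\<close>

definition curve_speed :: "nat \<Rightarrow> (complex \<Rightarrow> cvec) \<Rightarrow> complex \<Rightarrow> real" where
  "curve_speed N v z = (\<Sum>i\<le>N. \<Sum>j\<le>N. cmod (v z i * deriv (\<lambda>w. v w j) z - v z j * deriv (\<lambda>w. v w i) z)) / norm_sq N (v z)"

lemma norm_sq_pos: "v \<in> nonzero_vecs N \<Longrightarrow> norm_sq N v > 0"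
  unfolding norm_sq_def nonzero_vecs_def
  by (auto intro!: sum_pos2)

lemma norm_sq_ge: "i \<le> N \<Longrightarrow> (cmod (v i))\<^sup>2 \<le> norm_sq N v"
  unfolding norm_sq_def by (intro member_le_sum) auto

locale entire_curve =
  fixes N :: nat and v :: "complex \<Rightarrow> cvec"
  assumes hol: "\<And>i. (\<lambda>z. v z i) holomorphic_on UNIV"
    and nz: "\<And>z. v z \<in> nonzero_vecs N"
begin

lemma an: "(\<lambda>z. v z i) analytic_on {z}" using hol analytic_at by blast

lemma pos: "norm_sq N (v z) > 0" using nz by (rule norm_sq_pos)

lemma supp: "i > N \<Longrightarrow> v z i = 0" using nz[of z] by (simp add: nonzero_vecs_def)

lemma speed_nonneg: "curve_speed N v z \<ge> 0"
  unfolding curve_speed_def using pos[of z] by (intro divide_nonneg_pos sum_nonneg) auto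

lemma continuous_speed: "continuous_on S (curve_speed N v)"
proof -
  have 1: "continuous_on S (\<lambda>z. v z i)" "continuous_on S (\<lambda>z. deriv (\<lambda>w. v w i) z)" for i
    by (intro holomorphic_on_imp_continuous_on holomorphic_on_subset[OF hol] holomorphic_on_subset[OF holomorphic_deriv[OF hol open_UNIV]]; simp)+
  have "norm_sq N (v z) \<noteq> 0" for z using pos[of z] by simp
  then show ?thesis unfolding curve_speed_def norm_sq_def
    by (intro continuous_intros 1) auto
qed

lemma speed_zero_imp_constant:
  assumes "\<And>z. curve_speed N v z = 0"
  shows "proj_point (v z) = proj_point (v 0)"
proof -
  obtain i where i: "v 0 i \<noteq> 0" "i \<le> N" using nz[of 0] by (auto simp: nonzero_vecs_def)
  have "v z j * v 0 i = v 0 j * v z i" for z j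
  proof (cases "j \<le> N")
    case True
    show ?thesis
    proof (rule wronskian_zero_imp_proportional[OF hol hol _ i(1)])
      fix z
      have "(\<Sum>i\<le>N. \<Sum>j\<le>N. cmod (v z i * deriv (\<lambda>w. v w j) z - v z j * deriv (\<lambda>w. v w i) z)) = 0"
        using assms[of z] pos[of z] by (simp add: curve_speed_def)
      then have "\<forall>i\<le>N. (\<Sum>j\<le>N. cmod (v z i * deriv (\<lambda>w. v w j) z - v z j * deriv (\<lambda>w. v w i) z)) = 0"
        by (subst (asm) sum_nonneg_eq_0_iff) (auto intro: sum_nonneg)
      then have "cmod (v z i * deriv (\<lambda>w. v w j) z - v z j * deriv (\<lambda>w. v w i) z) = 0"
        using i(2) True by (subst (asm) sum_nonneg_eq_0_iff) auto
      then show "deriv (\<lambda>z. v z j) z * v z i = v z j * deriv (\<lambda>z. v z i) z" by (simp add: mult.commute)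
    qed
  qed (simp add: supp)
  then have "v z j = v z i / v 0 i * v 0 j" for j using i by (metis nonzero_mult_div_cancel_right mult.commute times_divide_eq_left)
  then have eq: "v z = (\<lambda>j. v z i / v 0 i * v 0 j)" by (rule ext)
  have "v z i \<noteq> 0"
  proof
    assume "v z i = 0"
    then have "v z j = 0" for j using fun_cong[OF eq, of j] by simp
    then show False using nz[of z] by (auto simp: nonzero_vecs_def)
  qed
  then show ?thesis unfolding proj_point_eq_iff using eq i(1) by (intro exI[of _ "v z i / v 0 i"]) simp
qed

lemma reparam: "entire_curve N (\<lambda>\<zeta>. v (\<alpha> + \<beta> * \<zeta>))"
proof
  show "(\<lambda>z. v (\<alpha> + \<beta> * z) i) holomorphic_on UNIV" for i
  proof -
    have "(\<lambda>z. \<alpha> + \<beta> * z) holomorphic_on UNIV" by (intro holomorphic_intros)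
    from holomorphic_on_compose_gen[OF this hol[of i]] show ?thesis by (simp add: o_def)
  qed
qed (rule nz)

lemma speed_reparam: "curve_speed N (\<lambda>\<zeta>. v (\<alpha> + \<beta> * \<zeta>)) \<zeta> = cmod \<beta> * curve_speed N v (\<alpha> + \<beta> * \<zeta>)"
proof -
  have d: "deriv (\<lambda>\<zeta>. v (\<alpha> + \<beta> * \<zeta>) i) \<zeta> = \<beta> * deriv (\<lambda>w. v w i) (\<alpha> + \<beta> * \<zeta>)" for i
  proof -
    have "((\<lambda>\<zeta>. \<alpha> + \<beta> * \<zeta>) has_field_derivative \<beta>) (at \<zeta>)" by (auto intro!: derivative_eq_intros)
    from DERIV_chain2[OF analytic_derivI[OF an] this, of i]
    show ?thesis by (simp add: DERIV_imp_deriv mult.commute)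
  qed
  have "cmod (v (\<alpha> + \<beta> * \<zeta>) i * (\<beta> * y) - v (\<alpha> + \<beta> * \<zeta>) j * (\<beta> * x)) = cmod \<beta> * cmod (v (\<alpha> + \<beta> * \<zeta>) i * y - v (\<alpha> + \<beta> * \<zeta>) j * x)" for i j x y
    by (simp add: norm_mult[symmetric] algebra_simps)
  then show ?thesis by (simp add: curve_speed_def d sum_distrib_left)
qed

text \<open>Brody's reparametrization: rescale at a maximum of the speed weighted by the distance to the
  boundary of a large disc.\<close>

lemma brody_reparametrization:
  assumes nc: "curve_speed N v z1 \<noteq> 0" and L: "L > 0"
  obtains \<alpha> \<beta> where "entire_curve N (\<lambda>\<zeta>. v (\<alpha> + \<beta> * \<zeta>))" "curve_speed N (\<lambda>\<zeta>. v (\<alpha> + \<beta> * \<zeta>)) 0 = 1"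
    "\<And>\<zeta>. cmod \<zeta> \<le> L \<Longrightarrow> curve_speed N (\<lambda>\<zeta>. v (\<alpha> + \<beta> * \<zeta>)) \<zeta> \<le> 2"
proof -
  let ?D = "curve_speed N v"
  have D1: "?D z1 > 0" using nc speed_nonneg[of z1] by simp
  \<comment> \<open>This radius makes the weighted speed at \<open>z1\<close>, hence its maximum, at
    least 2 L. Rescaling by the speed at the maximum \<alpha> moves points of |\<zeta>| \<le> L by
    at most half the weight m of \<alpha>, so the weight stays at least m / 2 and the speed at most
    doubles.\<close>
  define R where "R = 2 * L / ?D z1"
  have R: "R > 0" using D1 L by (simp add: R_def)
  have "\<exists>\<alpha>\<in>cball z1 R. \<forall>z\<in>cball z1 R. ?D z * (R - dist z1 z) \<le> ?D \<alpha> * (R - dist z1 \<alpha>)"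
    using R by (intro continuous_attains_sup compact_cball continuous_intros continuous_speed) auto
  then obtain \<alpha> where \<alpha>: "dist z1 \<alpha> \<le> R" "\<And>z. dist z1 z \<le> R \<Longrightarrow> ?D z * (R - dist z1 z) \<le> ?D \<alpha> * (R - dist z1 \<alpha>)"
    by auto
  have "2 * L = ?D z1 * (R - dist z1 z1)" using D1 by (simp add: R_def)
  also have "\<dots> \<le> ?D \<alpha> * (R - dist z1 \<alpha>)" by (rule \<alpha>(2)) (use R in simp)
  finally have M: "2 * L \<le> ?D \<alpha> * (R - dist z1 \<alpha>)" .
  have D\<alpha>: "?D \<alpha> > 0"
  proof (rule ccontr)
    assume "\<not> ?D \<alpha> > 0"
    then have "?D \<alpha> = 0" using speed_nonneg[of \<alpha>] by simp
    with M L show False by simp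
  qed
  define \<beta> where "\<beta> = complex_of_real (1 / ?D \<alpha>)"
  have \<beta>: "cmod \<beta> = 1 / ?D \<alpha>" using D\<alpha> by (simp add: \<beta>_def norm_divide)
  show thesis
  proof (rule that[OF reparam, of \<alpha> \<beta>])
    show "curve_speed N (\<lambda>\<zeta>. v (\<alpha> + \<beta> * \<zeta>)) 0 = 1" using D\<alpha> by (simp add: speed_reparam \<beta>)
    fix \<zeta> assume \<zeta>: "cmod \<zeta> \<le> L"
    define z where "z = \<alpha> + \<beta> * \<zeta>"
    define m where "m = R - dist z1 \<alpha>"
    have "cmod (\<beta> * \<zeta>) \<le> L / ?D \<alpha>" using \<zeta> D\<alpha> by (simp add: norm_mult \<beta> divide_right_mono)
    also have "\<dots> \<le> m / 2" using M D\<alpha> by (simp add: m_def field_simps)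
    finally have dz: "dist \<alpha> z \<le> m / 2" by (simp add: z_def dist_norm)
    have m0: "m > 0"
    proof (rule ccontr)
      assume "\<not> m > 0"
      then have "?D \<alpha> * m \<le> 0" using D\<alpha> by (simp add: mult_nonneg_nonpos)
      with M L show False by (simp add: m_def)
    qed
    have "dist z1 z \<le> dist z1 \<alpha> + dist \<alpha> z" by (rule dist_triangle)
    with dz have Rz: "R - dist z1 z \<ge> m / 2" by (simp add: m_def)
    have "?D z * (m / 2) \<le> ?D z * (R - dist z1 z)" using Rz speed_nonneg by (intro mult_left_mono) auto
    also have "\<dots> \<le> ?D \<alpha> * m" unfolding m_def by (rule \<alpha>(2)) (use Rz m0 in linarith)
    finally have "?D z \<le> 2 * ?D \<alpha>" using m0 by simp
    then show "curve_speed N (\<lambda>\<zeta>. v (\<alpha> + \<beta> * \<zeta>)) \<zeta> \<le> 2"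
      using D\<alpha> unfolding speed_reparam \<beta> z_def[symmetric] by (simp add: pos_divide_le_eq)
  qed
qed

text \<open>A coordinate that is maximal at the centre stays comparable to the norm on a ball whose
  radius does not depend on the curve; this gives uniform bounds in an affine chart. The share
  |v_i|^2 / |v|^2 is at least 1 / (N + 1) at the centre and, at speed at most 2, changes by at most
  4 \<epsilon> \<le> 1 / (2 (N + 1)) along a segment.\<close>

lemma chart_bound:
  assumes sp: "\<And>z. z \<in> ball z0 \<epsilon> \<Longrightarrow> curve_speed N v z \<le> 2" and \<epsilon>: "\<epsilon> \<le> 1 / (8 * real (N + 1))"
    and i: "i \<le> N" "\<And>a. a \<le> N \<Longrightarrow> cmod (v z0 a) \<le> cmod (v z0 i)"
    and z: "z \<in> ball z0 \<epsilon>" and a: "a \<le> N"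
  shows "(cmod (v z a))\<^sup>2 \<le> 2 * real (N + 1) * (cmod (v z i))\<^sup>2"
proof -
  define h where "h = z - z0"
  define \<gamma> where "\<gamma> t = z0 + of_real t * h" for t :: real
  have \<gamma>b: "\<gamma> t \<in> ball z0 \<epsilon>" if "0 \<le> t" "t \<le> 1" for t
  proof -
    have "cmod (of_real t * h) \<le> 1 * cmod h" unfolding norm_mult by (intro mult_right_mono) (use that in auto)
    then show ?thesis using z by (simp add: \<gamma>_def h_def dist_norm norm_minus_commute)
  qed
  define d where "d t b = deriv (\<lambda>w. v w b) (\<gamma> t) * h" for t b
  have dv: "((\<lambda>t. v (\<gamma> t) b) has_vector_derivative d t b) (at t)" for t b
  proof -
    have "(\<gamma> has_vector_derivative h) (at t)"
      unfolding \<gamma>_def by (auto intro!: derivative_eq_intros simp: has_vector_derivative_def scaleR_conv_of_real)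
    from field_vector_diff_chain_at[OF this analytic_derivI[OF an]]
    show ?thesis by (simp add: o_def d_def mult.commute)
  qed
  have dsq: "((\<lambda>t. (cmod (v (\<gamma> t) b))\<^sup>2) has_real_derivative 2 * Re (cnj (v (\<gamma> t) b) * d t b)) (at t)" for t b
  proof -
    have "((\<lambda>t. Re (v (\<gamma> t) b)) has_real_derivative Re (d t b)) (at t)"
         "((\<lambda>t. Im (v (\<gamma> t) b)) has_real_derivative Im (d t b)) (at t)"
      using dv[of b t] unfolding has_vector_derivative_complex_iff by blast+
    from DERIV_cong[OF DERIV_add[OF DERIV_power[OF this(1), of 2] DERIV_power[OF this(2), of 2]] refl]
    show ?thesis by (simp add: cmod_power2 algebra_simps)
  qed
  define S where "S t = norm_sq N (v (\<gamma> t))" for t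
  have S0: "S t > 0" for t unfolding S_def by (rule pos)
  have dS: "(S has_real_derivative (\<Sum>b\<le>N. 2 * Re (cnj (v (\<gamma> t) b) * d t b))) (at t)" for t
    unfolding S_def norm_sq_def by (intro DERIV_sum dsq)
  define \<phi> where "\<phi> t = (cmod (v (\<gamma> t) i))\<^sup>2 / S t" for t
  define n where "n t = 2 * Re (cnj (v (\<gamma> t) i) * d t i) * S t - (cmod (v (\<gamma> t) i))\<^sup>2 * (\<Sum>b\<le>N. 2 * Re (cnj (v (\<gamma> t) b) * d t b))" for t
  have d\<phi>: "(\<phi> has_real_derivative n t / (S t * S t)) (at t)" for t
    unfolding \<phi>_def n_def using S0[of t] by (intro DERIV_divide dsq dS) simp
  have nle: "\<bar>n t\<bar> \<le> 4 * cmod h * (S t * S t)" if t: "0 \<le> t" "t \<le> 1" for t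
  proof -
    define p where "p = v (\<gamma> t)"
    define q where "q b = deriv (\<lambda>w. v w b) (\<gamma> t)" for b
    \<comment> \<open>In the quotient rule the parts that are not minors cancel, and only the minors
      p_b q_i - p_i q_b, which \<open>curve_speed\<close> controls, remain.\<close>
    have "n t = (\<Sum>b\<le>N. 2 * Re (h * (cnj (p i) * cnj (p b)) * (p b * q i - p i * q b)))"
    proof -
      have "n t = (\<Sum>b\<le>N. 2 * Re (cnj (p i) * (q i * h)) * (cmod (p b))\<^sup>2 - (cmod (p i))\<^sup>2 * (2 * Re (cnj (p b) * (q b * h))))"
        by (simp only: n_def S_def norm_sq_def d_def p_def q_def sum_distrib_left sum_subtractf)
      also have "\<dots> = (\<Sum>b\<le>N. 2 * Re (h * (cnj (p i) * cnj (p b)) * (p b * q i - p i * q b)))"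
      proof (rule sum.cong[OF refl])
        fix b
        have re: "Re (X * of_real \<beta> - of_real \<alpha> * Y) = Re X * \<beta> - \<alpha> * Re Y" for X Y \<alpha> \<beta> by simp
        have z: "h * (cnj (p i) * cnj (p b)) * (p b * q i - p i * q b) =
            cnj (p i) * (q i * h) * of_real ((cmod (p b))\<^sup>2) - of_real ((cmod (p i))\<^sup>2) * (cnj (p b) * (q b * h))"
          by (simp add: complex_norm_square algebra_simps del: of_real_power)
        show "2 * Re (cnj (p i) * (q i * h)) * (cmod (p b))\<^sup>2 - (cmod (p i))\<^sup>2 * (2 * Re (cnj (p b) * (q b * h)))
          = 2 * Re (h * (cnj (p i) * cnj (p b)) * (p b * q i - p i * q b))" unfolding z re by (simp only: right_diff_distrib mult_ac)
      qed
      finally show ?thesis .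
    qed
    also have "\<bar>\<dots>\<bar> \<le> (\<Sum>b\<le>N. \<bar>2 * Re (h * (cnj (p i) * cnj (p b)) * (p b * q i - p i * q b))\<bar>)" by (rule sum_abs)
    also have "\<dots> \<le> (\<Sum>b\<le>N. 2 * (cmod h * S t) * cmod (p i * q b - p b * q i))"
    proof (rule sum_mono)
      fix b assume b: "b \<in> {..N}"
      have "cmod (p i) * cmod (p b) \<le> S t"
      proof -
        have "2 * (cmod (p i) * cmod (p b)) \<le> (cmod (p i))\<^sup>2 + (cmod (p b))\<^sup>2"
          using sum_squares_bound[of "cmod (p i)" "cmod (p b)"] by simp
        also have "\<dots> \<le> 2 * S t" using norm_sq_ge[OF i(1), of p] norm_sq_ge[of b N p] b by (simp add: S_def p_def)
        finally show ?thesis by simp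
      qed
      then have "cmod h * (cmod (p i) * cmod (p b)) * cmod (p b * q i - p i * q b) \<le> cmod h * S t * cmod (p b * q i - p i * q b)"
        by (intro mult_right_mono mult_left_mono) auto
      moreover have "\<bar>Re (h * (cnj (p i) * cnj (p b)) * (p b * q i - p i * q b))\<bar> \<le> cmod h * (cmod (p i) * cmod (p b)) * cmod (p b * q i - p i * q b)"
        using abs_Re_le_cmod[of "h * (cnj (p i) * cnj (p b)) * (p b * q i - p i * q b)"] by (simp add: norm_mult)
      ultimately show "\<bar>2 * Re (h * (cnj (p i) * cnj (p b)) * (p b * q i - p i * q b))\<bar> \<le> 2 * (cmod h * S t) * cmod (p i * q b - p b * q i)"
        by (simp add: norm_minus_commute[of "p i * q b"])
    qed
    also have "\<dots> = 2 * (cmod h * S t) * (\<Sum>b\<le>N. cmod (p i * q b - p b * q i))" by (simp add: sum_distrib_left)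
    also have "\<dots> \<le> 2 * (cmod h * S t) * (2 * S t)"
    proof (rule mult_left_mono)
      have "(\<Sum>b\<le>N. cmod (p i * q b - p b * q i)) \<le> (\<Sum>i\<le>N. \<Sum>b\<le>N. cmod (p i * q b - p b * q i))"
        using i(1) by (intro member_le_sum[of i _ "\<lambda>i. \<Sum>b\<le>N. cmod (p i * q b - p b * q i)"]) (auto intro: sum_nonneg)
      also have "\<dots> = curve_speed N v (\<gamma> t) * S t" using S0[of t] by (simp add: curve_speed_def S_def p_def q_def)
      also have "\<dots> \<le> 2 * S t" using sp[OF \<gamma>b[OF t]] S0[of t] by (intro mult_right_mono) auto
      finally show "(\<Sum>b\<le>N. cmod (p i * q b - p b * q i)) \<le> 2 * S t" .
    qed (use S0[of t] in auto)
    finally show ?thesis by (simp add: mult_ac)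
  qed
  obtain t where t: "0 < t" "t < 1" "\<phi> 1 - \<phi> 0 = (1 - 0) * (n t / (S t * S t))"
    using MVT2[of 0 1 \<phi> "\<lambda>t. n t / (S t * S t)"] d\<phi> by auto
  have "\<bar>n t / (S t * S t)\<bar> \<le> 4 * cmod h"
    using nle[of t] t S0[of t] by (simp add: abs_mult pos_divide_le_eq)
  also have "4 * cmod h \<le> 4 * \<epsilon>" using z by (simp add: h_def dist_norm norm_minus_commute)
  also have "4 * \<epsilon> \<le> 1 / (2 * real (N + 1))" using \<epsilon> by (simp add: field_simps)
  finally have "\<phi> 1 \<ge> \<phi> 0 - 1 / (2 * real (N + 1))" unfolding abs_le_iff using t(3) by simp
  moreover have "\<phi> 0 \<ge> 1 / real (N + 1)"
  proof -
    have "S 0 \<le> (\<Sum>b\<le>N. (cmod (v z0 i))\<^sup>2)"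
      unfolding S_def norm_sq_def \<gamma>_def by (intro sum_mono power_mono) (use i in auto)
    also have "\<dots> = real (N + 1) * (cmod (v z0 i))\<^sup>2" by simp
    finally show ?thesis using S0[of 0] unfolding \<phi>_def by (simp add: \<gamma>_def field_simps)
  qed
  ultimately have "\<phi> 1 \<ge> 1 / real (N + 1) - 1 / (2 * real (N + 1))" by linarith
  moreover have "1 / real (N + 1) - 1 / (2 * real (N + 1)) = 1 / (2 * real (N + 1))" by (simp add: field_simps)
  ultimately have "1 / (2 * real (N + 1)) \<le> (cmod (v (\<gamma> 1) i))\<^sup>2 / S 1" unfolding \<phi>_def by simp
  then have "S 1 \<le> 2 * real (N + 1) * (cmod (v (\<gamma> 1) i))\<^sup>2" using S0[of 1] by (simp add: field_simps)
  moreover have "\<gamma> 1 = z" by (simp add: \<gamma>_def h_def)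
  ultimately show ?thesis using norm_sq_ge[OF a, of "v z"] by (simp add: S_def)
qed

end

section \<open>Normal families of curves\<close>

lemma Montel_finite:
  fixes F :: "'a \<Rightarrow> nat \<Rightarrow> complex \<Rightarrow> complex"
  assumes "finite A" and S: "open S" and hol: "\<And>a j. a \<in> A \<Longrightarrow> F a j holomorphic_on S"
    and bd: "\<And>a j z. a \<in> A \<Longrightarrow> z \<in> S \<Longrightarrow> cmod (F a j z) \<le> B"
  shows "\<exists>r l. strict_mono (r :: nat \<Rightarrow> nat) \<and> (\<forall>a\<in>A. l a holomorphic_on S \<and>
    (\<forall>z\<in>S. (\<lambda>j. F a (r j) z) \<longlonglongrightarrow> l a z) \<and> (\<forall>z\<in>S. (\<lambda>j. deriv (F a (r j)) z) \<longlonglongrightarrow> deriv (l a) z))"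
  using assms(1) hol bd
proof (induction A rule: finite_induct)
  case empty
  show ?case by (intro exI[of _ id]) (simp add: strict_mono_def)
next
  case (insert a A)
  have "\<exists>r l. strict_mono (r :: nat \<Rightarrow> nat) \<and> (\<forall>a\<in>A. l a holomorphic_on S \<and>
    (\<forall>z\<in>S. (\<lambda>j. F a (r j) z) \<longlonglongrightarrow> l a z) \<and> (\<forall>z\<in>S. (\<lambda>j. deriv (F a (r j)) z) \<longlonglongrightarrow> deriv (l a) z))"
    by (rule insert.IH) (use insert.prems in auto)
  then obtain r l where "strict_mono (r :: nat \<Rightarrow> nat) \<and> (\<forall>a\<in>A. l a holomorphic_on S \<and>
    (\<forall>z\<in>S. (\<lambda>j. F a (r j) z) \<longlonglongrightarrow> l a z) \<and> (\<forall>z\<in>S. (\<lambda>j. deriv (F a (r j)) z) \<longlonglongrightarrow> deriv (l a) z))"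
    by (elim exE)
  then have r: "strict_mono (r :: nat \<Rightarrow> nat)"
    and l: "\<And>a. a \<in> A \<Longrightarrow> l a holomorphic_on S"
    "\<And>a z. a \<in> A \<Longrightarrow> z \<in> S \<Longrightarrow> (\<lambda>j. F a (r j) z) \<longlonglongrightarrow> l a z"
    "\<And>a z. a \<in> A \<Longrightarrow> z \<in> S \<Longrightarrow> (\<lambda>j. deriv (F a (r j)) z) \<longlonglongrightarrow> deriv (l a) z"
    by auto
  obtain g s where g: "g holomorphic_on S" and s: "strict_mono (s :: nat \<Rightarrow> nat)"
    and gl: "\<And>x. x \<in> S \<Longrightarrow> (\<lambda>n. F a (r (s n)) x) \<longlonglongrightarrow> g x"
    and gu: "\<And>K. compact K \<Longrightarrow> K \<subseteq> S \<Longrightarrow> uniform_limit K ((\<lambda>n. F a (r n)) \<circ> s) g sequentially"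
  proof (rule Montel[OF S, of "range (\<lambda>n. F a (r n))" "\<lambda>n. F a (r n)"])
    show "\<exists>B. \<forall>h\<in>range (\<lambda>n. F a (r n)). \<forall>z\<in>K. cmod (h z) \<le> B" if "compact K" "K \<subseteq> S" for K
      using insert.prems(2) that by (intro exI[of _ B]) auto
  qed (use insert.prems(1) in auto)
  \<comment> \<open>Convergence is uniform on small closed discs, so the derivatives converge too;
    they are needed for the speed of a limit curve.\<close>
  have gd: "(\<lambda>j. deriv (F a (r (s j))) z) \<longlonglongrightarrow> deriv g z" if z: "z \<in> S" for z
  proof -
    obtain e where e: "e > 0" "cball z e \<subseteq> S" using S z open_contains_cball by blast
    have "uniform_limit (ball z e) (\<lambda>n. F a (r (s n))) g sequentially"
      using gu[of "cball z e"] e by (auto simp: o_def intro: uniform_limit_on_subset[OF _ ball_subset_cball])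
    then show ?thesis
      by (rule deriv_complex_uniform_limit)
         (use e in \<open>auto intro!: always_eventually holomorphic_on_subset[OF insert.prems(1)[OF insertI1] subset_trans[OF ball_subset_cball]]\<close>)
  qed
  show ?case
  proof (intro exI[of _ "r \<circ> s"] exI[of _ "l(a := g)"] conjI ballI)
    show "strict_mono (r \<circ> s)" using r s by (rule strict_mono_o)
    fix b assume b: "b \<in> insert a A"
    show "(l(a := g)) b holomorphic_on S" using b g l(1) by auto
    fix z assume z: "z \<in> S"
    show "(\<lambda>j. F b ((r \<circ> s) j) z) \<longlonglongrightarrow> (l(a := g)) b z"
      using b gl[OF z] LIMSEQ_subseq_LIMSEQ[OF l(2)[OF _ z] s] by (auto simp: o_def)
    show "(\<lambda>j. deriv (F b ((r \<circ> s) j)) z) \<longlonglongrightarrow> deriv ((l(a := g)) b) z"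
      using b gd[OF z] LIMSEQ_subseq_LIMSEQ[OF l(3)[OF _ z] s] by (auto simp: o_def)
  qed
qed

text \<open>The speed is unchanged when the lift is divided by \<open>v z i\<close>, and the affine
  coordinates obtained in this way are what converges in the limit theorem.\<close>

lemma (in entire_curve) speed_in_chart:
  assumes i: "i \<le> N" "v z i \<noteq> 0"
  shows "curve_speed N v z = (\<Sum>a\<le>N. \<Sum>b\<le>N. cmod (v z a / v z i * deriv (\<lambda>w. v w b / v w i) z - v z b / v z i * deriv (\<lambda>w. v w a / v w i) z))
     / (\<Sum>a\<le>N. (cmod (v z a / v z i))\<^sup>2)"
proof -
  have d: "deriv (\<lambda>w. v w b / v w i) z = (deriv (\<lambda>w. v w b) z * v z i - v z b * deriv (\<lambda>w. v w i) z) / (v z i * v z i)" for b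
    by (intro DERIV_imp_deriv DERIV_divide analytic_derivI an i)
  have "v z a / v z i * deriv (\<lambda>w. v w b / v w i) z - v z b / v z i * deriv (\<lambda>w. v w a / v w i) z
     = (v z a * deriv (\<lambda>w. v w b) z - v z b * deriv (\<lambda>w. v w a) z) / (v z i)\<^sup>2" for a b
    unfolding d using i by (simp add: field_simps power2_eq_square)
  then have "(\<Sum>a\<le>N. \<Sum>b\<le>N. cmod (v z a / v z i * deriv (\<lambda>w. v w b / v w i) z - v z b / v z i * deriv (\<lambda>w. v w a / v w i) z))
     = (\<Sum>a\<le>N. \<Sum>b\<le>N. cmod (v z a * deriv (\<lambda>w. v w b) z - v z b * deriv (\<lambda>w. v w a) z)) / (cmod (v z i))\<^sup>2"
    by (simp add: norm_divide norm_power sum_divide_distrib)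
  moreover have "(\<Sum>a\<le>N. (cmod (v z a / v z i))\<^sup>2) = norm_sq N (v z) / (cmod (v z i))\<^sup>2"
    by (simp add: norm_divide power_divide norm_sq_def sum_divide_distrib)
  ultimately show ?thesis using i by (simp add: curve_speed_def)
qed

text \<open>Carries along functions \<open>u j\<close> of weight \<open>k\<close>, that is, sections
  of the k-th power of the hyperplane bundle along the curves. The last assertion exhibits each
  point of the limit as a limit of normalised points of the original curves; this suffices for
  passing weighted homogeneous equations to the limit, and it hides the reparametrizations.\<close>

lemma brody_limit:
  fixes v :: "nat \<Rightarrow> complex \<Rightarrow> cvec" and u :: "nat \<Rightarrow> complex \<Rightarrow> complex"
  assumes curve: "\<And>j. entire_curve N (v j)"
    and nc: "\<And>j. \<exists>z. curve_speed N (v j) z \<noteq> 0"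
    and u: "\<And>j. u j holomorphic_on UNIV"
    and ub: "\<And>M. \<exists>B. \<forall>j z i. i \<le> N \<longrightarrow> v j z i \<noteq> 0 \<longrightarrow> (\<forall>a\<le>N. cmod (v j z a) \<le> M * cmod (v j z i)) \<longrightarrow>
        cmod (u j z) \<le> B * cmod (v j z i) ^ k"
  obtains w U where "entire_curve N w" "U holomorphic_on UNIV" "\<exists>z. proj_point (w z) \<noteq> proj_point (w 0)"
    "\<And>z. \<exists>i\<le>N. \<exists>r x. strict_mono (r :: nat \<Rightarrow> nat) \<and> w z i \<noteq> 0 \<and> (\<forall>\<^sub>F j in sequentially. v (r j) (x j) i \<noteq> 0) \<and>
       (\<forall>a\<le>N. (\<lambda>j. v (r j) (x j) a / v (r j) (x j) i) \<longlonglongrightarrow> w z a / w z i) \<and>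
       (\<lambda>j. u (r j) (x j) / v (r j) (x j) i ^ k) \<longlonglongrightarrow> U z / w z i ^ k"
proof -
  have "\<forall>j. \<exists>\<alpha> \<beta>. entire_curve N (\<lambda>\<zeta>. v j (\<alpha> + \<beta> * \<zeta>)) \<and> curve_speed N (\<lambda>\<zeta>. v j (\<alpha> + \<beta> * \<zeta>)) 0 = 1 \<and>
    (\<forall>\<zeta>. cmod \<zeta> \<le> real (j + 1) \<longrightarrow> curve_speed N (\<lambda>\<zeta>. v j (\<alpha> + \<beta> * \<zeta>)) \<zeta> \<le> 2)"
  proof
    fix j
    obtain z1 where z1: "curve_speed N (v j) z1 \<noteq> 0" using nc by blast
    show "\<exists>\<alpha> \<beta>. entire_curve N (\<lambda>\<zeta>. v j (\<alpha> + \<beta> * \<zeta>)) \<and> curve_speed N (\<lambda>\<zeta>. v j (\<alpha> + \<beta> * \<zeta>)) 0 = 1 \<and>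
      (\<forall>\<zeta>. cmod \<zeta> \<le> real (j + 1) \<longrightarrow> curve_speed N (\<lambda>\<zeta>. v j (\<alpha> + \<beta> * \<zeta>)) \<zeta> \<le> 2)"
      by (rule entire_curve.brody_reparametrization[OF curve z1, of "real (j + 1)"]) (simp, blast)
  qed
  from choice[OF this] obtain \<alpha> where "\<forall>j. \<exists>\<beta>. entire_curve N (\<lambda>\<zeta>. v j (\<alpha> j + \<beta> * \<zeta>)) \<and> curve_speed N (\<lambda>\<zeta>. v j (\<alpha> j + \<beta> * \<zeta>)) 0 = 1 \<and>
    (\<forall>\<zeta>. cmod \<zeta> \<le> real (j + 1) \<longrightarrow> curve_speed N (\<lambda>\<zeta>. v j (\<alpha> j + \<beta> * \<zeta>)) \<zeta> \<le> 2)" by (rule exE)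
  from choice[OF this] obtain \<beta> where ab: "\<forall>j. entire_curve N (\<lambda>\<zeta>. v j (\<alpha> j + \<beta> j * \<zeta>)) \<and> curve_speed N (\<lambda>\<zeta>. v j (\<alpha> j + \<beta> j * \<zeta>)) 0 = 1 \<and>
    (\<forall>\<zeta>. cmod \<zeta> \<le> real (j + 1) \<longrightarrow> curve_speed N (\<lambda>\<zeta>. v j (\<alpha> j + \<beta> j * \<zeta>)) \<zeta> \<le> 2)" by (rule exE)
  define x where "x j \<zeta> = \<alpha> j + \<beta> j * \<zeta>" for j \<zeta>
  define y where "y j \<zeta> = v j (x j \<zeta>)" for j \<zeta>
  have y: "entire_curve N (y j)" and y1: "curve_speed N (y j) 0 = 1"
    and y2: "cmod \<zeta> \<le> real (j + 1) \<Longrightarrow> curve_speed N (y j) \<zeta> \<le> 2" for j \<zeta>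
    using ab unfolding y_def x_def by auto
  define yu where "yu j \<zeta> = u j (x j \<zeta>)" for j \<zeta>
  have yu: "yu j holomorphic_on UNIV" for j
  proof -
    have "x j holomorphic_on UNIV" unfolding x_def by (intro holomorphic_intros)
    from holomorphic_on_compose_gen[OF this u[of j]] have "u j \<circ> x j holomorphic_on UNIV" by simp
    moreover have "yu j = u j \<circ> x j" by (rule ext) (simp add: yu_def)
    ultimately show ?thesis by simp
  qed
  define \<epsilon> where "\<epsilon> = 1 / (8 * real (N + 1))"
  have \<epsilon>: "\<epsilon> > 0" by (simp add: \<epsilon>_def)
  \<comment> \<open>The comparison constant of \<open>chart_bound\<close>, after taking square
    roots.\<close>
  define M where "M = sqrt (2 * real (N + 1))"
  from ub obtain B where B: "\<And>j z i. i \<le> N \<Longrightarrow> v j z i \<noteq> 0 \<Longrightarrow> (\<And>a. a \<le> N \<Longrightarrow> cmod (v j z a) \<le> M * cmod (v j z i)) \<Longrightarrow>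
        cmod (u j z) \<le> B * cmod (v j z i) ^ k"
    by meson
  obtain D :: "complex set" where D: "countable D" "\<And>X. open X \<Longrightarrow> X \<noteq> {} \<Longrightarrow> \<exists>d \<in> D. d \<in> X"
    using countable_dense_setE by blast
  define c where "c = from_nat_into D"
  have cov: "\<exists>n. z \<in> ball (c n) \<epsilon>" for z
  proof -
    obtain d where d: "d \<in> D" "d \<in> ball z \<epsilon>" using D(2)[of "ball z \<epsilon>"] \<epsilon> by auto
    obtain n where "c n = d" using from_nat_into_surj[OF D(1) d(1)] by (auto simp: c_def)
    then show ?thesis using d(2) by (auto simp: dist_commute intro!: exI[of _ n])
  qed
  \<comment> \<open>Affine coordinates in chart \<open>i\<close>; the index N + 1 stands for the
    function of weight \<open>k\<close> in the same chart.\<close>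
  define q where "q i a j z = (if a \<le> N then y j z a / y j z i else yu j z / y j z i ^ k)" for i a j z
  \<comment> \<open>What a subsequence should achieve on the n-th ball: one chart serves almost all
    curves, and all affine functions converge with their derivatives. This persists in further
    subsequences, so a diagonal sequence achieves it on every ball.\<close>
  define P where "P n s \<longleftrightarrow> (\<exists>i l. i \<le> N \<and> (\<forall>a\<le>N+1. l a holomorphic_on ball (c n) \<epsilon>) \<and>
      (\<forall>\<^sub>F j in sequentially. \<forall>z\<in>ball (c n) \<epsilon>. y (s j) z i \<noteq> 0) \<and>
      (\<forall>a\<le>N+1. \<forall>z\<in>ball (c n) \<epsilon>. (\<lambda>j. q i a (s j) z) \<longlonglongrightarrow> l a z \<and> (\<lambda>j. deriv (q i a (s j)) z) \<longlonglongrightarrow> deriv (l a) z))" for n s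
  interpret subseqs P
  proof
    fix n and s :: "nat \<Rightarrow> nat" assume s: "strict_mono s"
    have "\<exists>i\<le>N. \<forall>a\<le>N. cmod (y (s j) (c n) a) \<le> cmod (y (s j) (c n) i)" for j
    proof -
      have fin: "finite ((\<lambda>a. cmod (y (s j) (c n) a)) ` {..N})" by simp
      have "Max ((\<lambda>a. cmod (y (s j) (c n) a)) ` {..N}) \<in> (\<lambda>a. cmod (y (s j) (c n) a)) ` {..N}" by (intro Max_in) auto
      then obtain i where i: "Max ((\<lambda>a. cmod (y (s j) (c n) a)) ` {..N}) = cmod (y (s j) (c n) i)" "i \<in> {..N}" by (rule imageE)
      show ?thesis
      proof (intro exI[of _ i] conjI allI impI)
        show "cmod (y (s j) (c n) a) \<le> cmod (y (s j) (c n) i)" if "a \<le> N" for a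
          unfolding i(1)[symmetric] by (rule Max_ge[OF fin]) (use that in auto)
      qed (use i in simp)
    qed
    then obtain ii where ii: "\<And>j. ii j \<le> N" "\<And>j a. a \<le> N \<Longrightarrow> cmod (y (s j) (c n) a) \<le> cmod (y (s j) (c n) (ii j))"
      by metis
    \<comment> \<open>From index \<open>J\<close> on, the disc on which the speed is known to be at
      most 2 contains the ball.\<close>
    obtain J :: nat where J: "real J \<ge> cmod (c n) + \<epsilon>" using real_arch_simple by blast
    have inf: "infinite {J..}" by (rule infinite_Ici)
    have "finite (ii ` {J..})" by (rule finite_subset[of _ "{..N}"]) (use ii(1) in auto)
    \<comment> \<open>The largest coordinate at the centre may vary with the curve, but one of the
      finitely many indices recurs infinitely often.\<close>
    from pigeonhole_infinite[OF inf this] obtain j0 where j0: "infinite {j \<in> {J..}. ii j = ii j0}" by blast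
    from infinite_enumerate[OF this] obtain r0 where r0: "strict_mono (r0 :: nat \<Rightarrow> nat)" "\<And>j. r0 j \<ge> J" "\<And>j. ii (r0 j) = ii j0"
      by auto
    define i where "i = ii j0"
    have i: "i \<le> N" using ii by (simp add: i_def)
    have bd: "(cmod (y (s (r0 j)) z a))\<^sup>2 \<le> 2 * real (N + 1) * (cmod (y (s (r0 j)) z i))\<^sup>2"
      if z: "z \<in> ball (c n) \<epsilon>" and a: "a \<le> N" for z a j
    proof (rule entire_curve.chart_bound[OF y _ _ i _ z a])
      show "curve_speed N (y (s (r0 j))) z \<le> 2" if z: "z \<in> ball (c n) \<epsilon>" for z
      proof (rule y2)
        have "cmod z \<le> cmod (c n) + dist (c n) z" using norm_triangle_sub[of z "c n"] by (simp add: dist_norm norm_minus_commute)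
        also have "\<dots> \<le> real J" using z J by simp
        also have "\<dots> \<le> real (s (r0 j) + 1)" using r0(2)[of j] seq_suble[OF s, of "r0 j"] by simp
        finally show "cmod z \<le> real (s (r0 j) + 1)" .
      qed
      show "cmod (y (s (r0 j)) (c n) a) \<le> cmod (y (s (r0 j)) (c n) i)" if "a \<le> N" for a
        using ii(2)[OF that, of "r0 j"] by (simp add: i_def r0(3))
    qed (simp add: \<epsilon>_def)
    have bdM: "cmod (y (s (r0 j)) z a) \<le> M * cmod (y (s (r0 j)) z i)" if "z \<in> ball (c n) \<epsilon>" "a \<le> N" for z a j
    proof -
      have "sqrt ((cmod (y (s (r0 j)) z a))\<^sup>2) \<le> sqrt (2 * real (N + 1) * (cmod (y (s (r0 j)) z i))\<^sup>2)"
        using bd[OF that] by (rule real_sqrt_le_mono)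
      then show ?thesis unfolding M_def real_sqrt_mult by simp
    qed
    have ynz: "y (s (r0 j)) z i \<noteq> 0" if "z \<in> ball (c n) \<epsilon>" for z j
    proof
      assume 0: "y (s (r0 j)) z i = 0"
      have "y (s (r0 j)) z a = 0" if "a \<le> N" for a using bdM[OF \<open>z \<in> ball (c n) \<epsilon>\<close> that, of j] 0 by simp
      then show False using entire_curve.nz[OF y, of "s (r0 j)" z] by (auto simp: nonzero_vecs_def)
    qed
    have qhol: "q i a (s (r0 j)) holomorphic_on ball (c n) \<epsilon>" for a j
    proof (cases "a \<le> N")
      case True
      then have "q i a (s (r0 j)) = (\<lambda>z. y (s (r0 j)) z a / y (s (r0 j)) z i)" by (auto simp: q_def)
      then show ?thesis using ynz[of _ j]
        by (auto intro!: holomorphic_intros holomorphic_on_subset[OF entire_curve.hol[OF y]])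
    next
      case False
      then have "q i a (s (r0 j)) = (\<lambda>z. yu (s (r0 j)) z / y (s (r0 j)) z i ^ k)" by (auto simp: q_def)
      then show ?thesis using ynz[of _ j]
        by (auto intro!: holomorphic_intros holomorphic_on_subset[OF entire_curve.hol[OF y]] holomorphic_on_subset[OF yu])
    qed
    have qbd: "cmod (q i a (s (r0 j)) z) \<le> max M B" if z: "z \<in> ball (c n) \<epsilon>" for a j z
    proof (cases "a \<le> N")
      case True
      then show ?thesis using bdM[OF z, of a j] ynz[OF z, of j] by (simp add: q_def norm_divide pos_divide_le_eq max.coboundedI1)
    next
      case False
      have "cmod (yu (s (r0 j)) z) \<le> B * cmod (y (s (r0 j)) z i) ^ k"
        using B[OF i, of "s (r0 j)" "x (s (r0 j)) z"] ynz[OF z, of j] bdM[OF z] unfolding y_def yu_def by blast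
      then show ?thesis using ynz[OF z, of j] False by (simp add: q_def norm_divide norm_power pos_divide_le_eq max.coboundedI2)
    qed
    have "\<exists>r l. strict_mono (r :: nat \<Rightarrow> nat) \<and> (\<forall>a\<in>{..N+1}. l a holomorphic_on ball (c n) \<epsilon> \<and>
      (\<forall>z\<in>ball (c n) \<epsilon>. (\<lambda>j. q i a (s (r0 (r j))) z) \<longlonglongrightarrow> l a z) \<and> (\<forall>z\<in>ball (c n) \<epsilon>. (\<lambda>j. deriv (q i a (s (r0 (r j)))) z) \<longlonglongrightarrow> deriv (l a) z))"
      by (rule Montel_finite[of "{..N+1}" "ball (c n) \<epsilon>" "\<lambda>a j. q i a (s (r0 j))" "max M B"]) (use qhol qbd in auto)
    then obtain r l where r: "strict_mono (r :: nat \<Rightarrow> nat)" and l: "\<forall>a\<in>{..N+1}. l a holomorphic_on ball (c n) \<epsilon> \<and>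
      (\<forall>z\<in>ball (c n) \<epsilon>. (\<lambda>j. q i a (s (r0 (r j))) z) \<longlonglongrightarrow> l a z) \<and> (\<forall>z\<in>ball (c n) \<epsilon>. (\<lambda>j. deriv (q i a (s (r0 (r j)))) z) \<longlonglongrightarrow> deriv (l a) z)"
      by (elim exE conjE)
    show "\<exists>r'. strict_mono r' \<and> P n (s \<circ> r')"
    proof (intro exI[of _ "r0 \<circ> r"] conjI)
      show "strict_mono (r0 \<circ> r)" using r0(1) r by (rule strict_mono_o)
      show "P n (s \<circ> (r0 \<circ> r))" unfolding P_def
        by (intro exI[of _ i] exI[of _ l]) (use i l ynz in auto)
    qed
  qed
  have stable: "P n (s \<circ> r)" if r: "strict_mono r" and Ps: "P n s" for r s n
  proof -
    from Ps obtain i l where il: "i \<le> N" "\<forall>a\<le>N+1. l a holomorphic_on ball (c n) \<epsilon>"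
      "\<forall>\<^sub>F j in sequentially. \<forall>z\<in>ball (c n) \<epsilon>. y (s j) z i \<noteq> 0"
      "\<forall>a\<le>N+1. \<forall>z\<in>ball (c n) \<epsilon>. (\<lambda>j. q i a (s j) z) \<longlonglongrightarrow> l a z \<and> (\<lambda>j. deriv (q i a (s j)) z) \<longlonglongrightarrow> deriv (l a) z"
      unfolding P_def by (elim exE conjE)
    show ?thesis unfolding P_def o_def
    proof (intro exI[of _ i] exI[of _ l] conjI allI ballI impI il(1))
      fix a z assume az: "a \<le> N + 1" "z \<in> ball (c n) \<epsilon>"
      show "(\<lambda>j. q i a (s (r j)) z) \<longlonglongrightarrow> l a z" "(\<lambda>j. deriv (q i a (s (r j))) z) \<longlonglongrightarrow> deriv (l a) z"
        using il(4) az LIMSEQ_subseq_LIMSEQ[OF _ r, of "\<lambda>j. q i a (s j) z"] LIMSEQ_subseq_LIMSEQ[OF _ r, of "\<lambda>j. deriv (q i a (s j)) z"]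
        by (auto simp: o_def)
    qed (use il eventually_subseq[OF r il(3)] in auto)
  qed
  define d where "d = diagseq"
  have d: "strict_mono d" unfolding d_def by (rule subseq_diagseq)
  have "\<exists>i l. i \<le> N \<and> (\<forall>a\<le>N+1. l a holomorphic_on ball (c n) \<epsilon>) \<and>
      (\<forall>\<^sub>F j in sequentially. \<forall>z\<in>ball (c n) \<epsilon>. y (d j) z i \<noteq> 0) \<and>
      (\<forall>a\<le>N+1. \<forall>z\<in>ball (c n) \<epsilon>. (\<lambda>j. q i a (d j) z) \<longlonglongrightarrow> l a z \<and> (\<lambda>j. deriv (q i a (d j)) z) \<longlonglongrightarrow> deriv (l a) z)" for n
  proof -
    have "P n (d \<circ> (+) (Suc n))" unfolding d_def by (rule diagseq_holds[OF stable])
    then obtain i l where il: "i \<le> N" "\<forall>a\<le>N+1. l a holomorphic_on ball (c n) \<epsilon>"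
      "\<forall>\<^sub>F j in sequentially. \<forall>z\<in>ball (c n) \<epsilon>. y (d (j + Suc n)) z i \<noteq> 0"
      "\<forall>a\<le>N+1. \<forall>z\<in>ball (c n) \<epsilon>. (\<lambda>j. q i a (d (j + Suc n)) z) \<longlonglongrightarrow> l a z \<and> (\<lambda>j. deriv (q i a (d (j + Suc n))) z) \<longlonglongrightarrow> deriv (l a) z"
      unfolding P_def o_def add.commute[of "Suc n"] by (elim exE conjE)
    show ?thesis
    proof (intro exI[of _ i] exI[of _ l] conjI allI ballI impI il(1))
      show "\<forall>\<^sub>F j in sequentially. \<forall>z\<in>ball (c n) \<epsilon>. y (d j) z i \<noteq> 0"
        using il(3) by (subst (asm) eventually_sequentially_seg)
      fix a z assume az: "a \<le> N + 1" "z \<in> ball (c n) \<epsilon>"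
      show "(\<lambda>j. q i a (d j) z) \<longlonglongrightarrow> l a z" "(\<lambda>j. deriv (q i a (d j)) z) \<longlonglongrightarrow> deriv (l a) z"
        by (rule LIMSEQ_offset[of _ "Suc n"]; use il(4) az in blast)+
    qed (use il in auto)
  qed
  then have "\<forall>n. \<exists>i l. i \<le> N \<and> (\<forall>a\<le>N+1. l a holomorphic_on ball (c n) \<epsilon>) \<and>
      (\<forall>\<^sub>F j in sequentially. \<forall>z\<in>ball (c n) \<epsilon>. y (d j) z i \<noteq> 0) \<and>
      (\<forall>a\<le>N+1. \<forall>z\<in>ball (c n) \<epsilon>. (\<lambda>j. q i a (d j) z) \<longlonglongrightarrow> l a z \<and> (\<lambda>j. deriv (q i a (d j)) z) \<longlonglongrightarrow> deriv (l a) z)"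
    by (rule allI)
  from choice[OF this] obtain I where "\<forall>n. \<exists>l. I n \<le> N \<and> (\<forall>a\<le>N+1. l a holomorphic_on ball (c n) \<epsilon>) \<and>
      (\<forall>\<^sub>F j in sequentially. \<forall>z\<in>ball (c n) \<epsilon>. y (d j) z (I n) \<noteq> 0) \<and>
      (\<forall>a\<le>N+1. \<forall>z\<in>ball (c n) \<epsilon>. (\<lambda>j. q (I n) a (d j) z) \<longlonglongrightarrow> l a z \<and> (\<lambda>j. deriv (q (I n) a (d j)) z) \<longlonglongrightarrow> deriv (l a) z)"
    by (rule exE)
  from choice[OF this] obtain l where Il: "\<forall>n. I n \<le> N \<and> (\<forall>a\<le>N+1. l n a holomorphic_on ball (c n) \<epsilon>) \<and>
      (\<forall>\<^sub>F j in sequentially. \<forall>z\<in>ball (c n) \<epsilon>. y (d j) z (I n) \<noteq> 0) \<and>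
      (\<forall>a\<le>N+1. \<forall>z\<in>ball (c n) \<epsilon>. (\<lambda>j. q (I n) a (d j) z) \<longlonglongrightarrow> l n a z \<and> (\<lambda>j. deriv (q (I n) a (d j)) z) \<longlonglongrightarrow> deriv (l n a) z)"
    by (rule exE)
  have I: "I n \<le> N" for n using Il by blast
  have lhol: "l n a holomorphic_on ball (c n) \<epsilon>" if "a \<le> N + 1" for n a using Il that by blast
  have ev: "\<forall>\<^sub>F j in sequentially. y (d j) z (I n) \<noteq> 0" if z: "z \<in> ball (c n) \<epsilon>" for n z
  proof -
    have "\<forall>\<^sub>F j in sequentially. \<forall>z\<in>ball (c n) \<epsilon>. y (d j) z (I n) \<noteq> 0" using Il by blast
    then show ?thesis by eventually_elim (use z in blast)
  qed
  have lim: "(\<lambda>j. y (d j) z a / y (d j) z (I n)) \<longlonglongrightarrow> l n a z" if z: "z \<in> ball (c n) \<epsilon>" and a: "a \<le> N" for n a z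
  proof -
    have "(\<lambda>j. q (I n) a (d j) z) \<longlonglongrightarrow> l n a z" using Il z a by (meson le_add1 order_trans)
    then show ?thesis using a by (simp add: q_def)
  qed
  have limd: "(\<lambda>j. deriv (\<lambda>z. y (d j) z a / y (d j) z (I n)) z) \<longlonglongrightarrow> deriv (l n a) z" if z: "z \<in> ball (c n) \<epsilon>" and a: "a \<le> N" for n a z
  proof -
    have "(\<lambda>j. deriv (q (I n) a (d j)) z) \<longlonglongrightarrow> deriv (l n a) z" using Il z a by (meson le_add1 order_trans)
    moreover have "q (I n) a j = (\<lambda>z. y j z a / y j z (I n))" for j using a by (auto simp: q_def)
    ultimately show ?thesis by simp
  qed
  have limu: "(\<lambda>j. yu (d j) z / y (d j) z (I n) ^ k) \<longlonglongrightarrow> l n (N+1) z" if z: "z \<in> ball (c n) \<epsilon>" for n z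
  proof -
    have "(\<lambda>j. q (I n) (N+1) (d j) z) \<longlonglongrightarrow> l n (N+1) z" using Il z by blast
    then show ?thesis by (simp add: q_def)
  qed
  have l1: "l n (I n) z = 1" if z: "z \<in> ball (c n) \<epsilon>" for n z
  proof (rule LIMSEQ_unique[OF lim[OF z I]])
    show "(\<lambda>j. y (d j) z (I n) / y (d j) z (I n)) \<longlonglongrightarrow> 1"
      using ev[OF z] by (intro tendsto_eventually) (auto elim!: eventually_mono)
  qed
  \<comment> \<open>The limits inherit the transition relations between affine charts, so they
    define one map to projective space, which can then be lifted.\<close>
  have trans: "l n a z = l m a z * l n (I m) z" if zn: "z \<in> ball (c n) \<epsilon>" and zm: "z \<in> ball (c m) \<epsilon>" and a: "a \<le> N" for n m a z
  proof (rule LIMSEQ_unique[OF lim[OF zn a]])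
    have "(\<lambda>j. (y (d j) z a / y (d j) z (I m)) * (y (d j) z (I m) / y (d j) z (I n))) \<longlonglongrightarrow> l m a z * l n (I m) z"
      by (intro tendsto_mult lim zn zm a I)
    then show "(\<lambda>j. y (d j) z a / y (d j) z (I n)) \<longlonglongrightarrow> l m a z * l n (I m) z"
      by (rule Lim_transform_eventually) (use ev[OF zm] in \<open>auto elim!: eventually_mono\<close>)
  qed
  have transu: "l n (N+1) z = l m (N+1) z * l n (I m) z ^ k" if zn: "z \<in> ball (c n) \<epsilon>" and zm: "z \<in> ball (c m) \<epsilon>" for n m z
  proof (rule LIMSEQ_unique[OF limu[OF zn]])
    have "(\<lambda>j. (yu (d j) z / y (d j) z (I m) ^ k) * (y (d j) z (I m) / y (d j) z (I n)) ^ k) \<longlonglongrightarrow> l m (N+1) z * l n (I m) z ^ k"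
      by (intro tendsto_mult tendsto_power lim limu zn zm I)
    then show "(\<lambda>j. yu (d j) z / y (d j) z (I n) ^ k) \<longlonglongrightarrow> l m (N+1) z * l n (I m) z ^ k"
      by (rule Lim_transform_eventually) (use ev[OF zm] in \<open>auto elim!: eventually_mono simp: power_divide\<close>)
  qed
  obtain \<nu> where \<nu>: "\<And>z. z \<in> ball (c (\<nu> z)) \<epsilon>" using cov by metis
  define L where "L n z = (\<lambda>a. if a \<le> N then l n a z else 0)" for n z
  have Lnz: "L n z \<in> nonzero_vecs N" if "z \<in> ball (c n) \<epsilon>" for n z
    using l1[OF that] I[of n] by (auto simp: L_def nonzero_vecs_def intro!: exI[of _ "I n"])
  have Lprop: "\<exists>\<kappa>. \<kappa> \<noteq> 0 \<and> L n z = (\<lambda>a. \<kappa> * L m z a)" if zn: "z \<in> ball (c n) \<epsilon>" and zm: "z \<in> ball (c m) \<epsilon>" for n m z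
  proof (intro exI conjI)
    show "l n (I m) z \<noteq> 0" using trans[OF zn zm I[of n]] l1[OF zn] by auto
    show "L n z = (\<lambda>a. l n (I m) z * L m z a)" using trans[OF zn zm] by (auto simp: L_def mult.commute)
  qed
  define f where "f z = proj_point (L (\<nu> z) z)" for z
  have "proj_holomorphic_on N f UNIV"
    unfolding proj_holomorphic_on_def
  proof
    fix z :: complex
    show "\<exists>U F. open U \<and> z \<in> U \<and> U \<subseteq> UNIV \<and> (\<forall>i. (\<lambda>w. F w i) holomorphic_on U) \<and>
        (\<forall>w\<in>U. F w \<in> nonzero_vecs N \<and> f w = proj_point (F w))"
    proof (intro exI[of _ "ball (c (\<nu> z)) \<epsilon>"] exI[of _ "L (\<nu> z)"] conjI allI ballI)
      show "(\<lambda>w. L (\<nu> z) w i) holomorphic_on ball (c (\<nu> z)) \<epsilon>" for i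
        by (cases "i \<le> N") (auto simp: L_def intro: lhol)
      fix w assume w: "w \<in> ball (c (\<nu> z)) \<epsilon>"
      show "L (\<nu> z) w \<in> nonzero_vecs N" using w by (rule Lnz)
      show "f w = proj_point (L (\<nu> z) w)"
        unfolding f_def proj_point_eq_iff by (rule Lprop[OF \<nu> w])
    qed (use \<nu> in auto)
  qed
  then obtain w where w: "\<And>i. (\<lambda>z. w z i) holomorphic_on UNIV" "\<And>z. w z \<in> nonzero_vecs N" "\<And>z. f z = proj_point (w z)"
    using proj_holomorphic_lift by metis
  have wcurve: "entire_curve N w" using w by unfold_locales
  have wl: "w z (I n) \<noteq> 0" "w z a = w z (I n) * l n a z" if zn: "z \<in> ball (c n) \<epsilon>" and a: "a \<le> N" for n z a
  proof -
    obtain \<kappa> where k1: "\<kappa> \<noteq> 0" "w z = (\<lambda>a. \<kappa> * L (\<nu> z) z a)" using w(3)[of z] unfolding f_def by (metis proj_point_eq_iff)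
    obtain \<kappa>' where k2: "\<kappa>' \<noteq> 0" "L (\<nu> z) z = (\<lambda>a. \<kappa>' * L n z a)" using Lprop[OF \<nu> zn] by blast
    have e: "w z b = \<kappa> * \<kappa>' * l n b z" if "b \<le> N" for b
      using that fun_cong[OF k2(2), of b] by (simp add: k1 L_def)
    have "w z (I n) = \<kappa> * \<kappa>'" using e[OF I] l1[OF zn] by simp
    then show "w z (I n) \<noteq> 0" "w z a = w z (I n) * l n a z" using k1 k2 e[OF a] by auto
  qed
  \<comment> \<open>The k-th power of the coordinate of the lift cancels the transition factor of
    weight \<open>k\<close>, which makes \<open>U\<close> independent of the chart.\<close>
  define U where "U z = w z (I (\<nu> z)) ^ k * l (\<nu> z) (N+1) z" for z
  have Ueq: "U z = w z (I n) ^ k * l n (N+1) z" if zn: "z \<in> ball (c n) \<epsilon>" for n z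
    unfolding U_def transu[OF \<nu> zn] wl(2)[OF \<nu> I[of n], of z] by (simp add: power_mult_distrib mult_ac)
  have Uhol: "U holomorphic_on UNIV"
  proof -
    have "U analytic_on {z}" for z
    proof -
      let ?n = "\<nu> z"
      have "(\<lambda>z. w z (I ?n) ^ k * l ?n (N+1) z) holomorphic_on ball (c ?n) \<epsilon>"
        by (intro holomorphic_intros holomorphic_on_subset[OF w(1)] lhol) auto
      then have "U holomorphic_on ball (c ?n) \<epsilon>" by (rule holomorphic_transform) (simp add: Ueq)
      then show ?thesis using \<nu>[of z] analytic_at open_ball by blast
    qed
    then show ?thesis by (metis analytic_imp_holomorphic analytic_on_analytic_at)
  qed
  \<comment> \<open>A constant limit would have vanishing derivatives in the chart at 0, so the
    speeds at 0 would tend to 0, although all of them are 1.\<close>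
  have nonconst: "\<exists>z. proj_point (w z) \<noteq> proj_point (w 0)"
  proof (rule ccontr)
    assume "\<not> ?thesis"
    then have pc: "proj_point (w z) = proj_point (w 0)" for z by blast
    let ?n = "\<nu> 0"
    note z0 = \<nu>[of 0]
    have const: "l ?n a z = l ?n a 0" if z: "z \<in> ball (c ?n) \<epsilon>" and a: "a \<le> N" for a z
    proof -
      obtain \<kappa> where k: "\<kappa> \<noteq> 0" "w z = (\<lambda>a. \<kappa> * w 0 a)" using pc[of z] unfolding proj_point_eq_iff by blast
      have "l ?n a z = w z a / w z (I ?n)" using wl[OF z a] by simp
      also have "\<dots> = w 0 a / w 0 (I ?n)" using k by simp
      also have "\<dots> = l ?n a 0" using wl[OF z0 a] by simp
      finally show ?thesis .
    qed
    have d0: "deriv (l ?n a) 0 = 0" if a: "a \<le> N" for a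
    proof -
      have "\<forall>\<^sub>F z in nhds 0. l ?n a z = l ?n a 0"
        using eventually_nhds_in_open[OF open_ball z0] by (rule eventually_mono) (rule const[OF _ a])
      from deriv_cong_ev[OF this refl] show ?thesis by simp
    qed
    have "(\<lambda>j. (\<Sum>a\<le>N. \<Sum>b\<le>N. cmod (y (d j) 0 a / y (d j) 0 (I ?n) * deriv (\<lambda>w. y (d j) w b / y (d j) w (I ?n)) 0
          - y (d j) 0 b / y (d j) 0 (I ?n) * deriv (\<lambda>w. y (d j) w a / y (d j) w (I ?n)) 0))
         / (\<Sum>a\<le>N. (cmod (y (d j) 0 a / y (d j) 0 (I ?n)))\<^sup>2)) \<longlonglongrightarrow>
        (\<Sum>a\<le>N. \<Sum>b\<le>N. cmod (l ?n a 0 * deriv (l ?n b) 0 - l ?n b 0 * deriv (l ?n a) 0)) / (\<Sum>a\<le>N. (cmod (l ?n a 0))\<^sup>2)"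
    proof (intro tendsto_intros lim limd z0)
      have "(cmod (l ?n (I ?n) 0))\<^sup>2 \<le> (\<Sum>a\<le>N. (cmod (l ?n a 0))\<^sup>2)" using I[of ?n] by (intro member_le_sum) auto
      then show "(\<Sum>a\<le>N. (cmod (l ?n a 0))\<^sup>2) \<noteq> 0" using l1[OF z0] by auto
    qed auto
    also have "(\<Sum>a\<le>N. \<Sum>b\<le>N. cmod (l ?n a 0 * deriv (l ?n b) 0 - l ?n b 0 * deriv (l ?n a) 0)) = 0"
      by (intro sum.neutral ballI) (simp add: d0)
    finally have "(\<lambda>j. curve_speed N (y (d j)) 0) \<longlonglongrightarrow> 0 / (\<Sum>a\<le>N. (cmod (l ?n a 0))\<^sup>2)"
      by (rule Lim_transform_eventually)
         (use ev[OF z0] entire_curve.speed_in_chart[OF y I] in \<open>auto elim!: eventually_mono\<close>)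
    then show False by (simp add: y1 LIMSEQ_const_iff)
  qed
  show thesis
  proof (rule that[OF wcurve Uhol nonconst])
    fix z
    let ?n = "\<nu> z"
    note z = \<nu>[of z]
    show "\<exists>i\<le>N. \<exists>r x. strict_mono (r :: nat \<Rightarrow> nat) \<and> w z i \<noteq> 0 \<and> (\<forall>\<^sub>F j in sequentially. v (r j) (x j) i \<noteq> 0) \<and>
       (\<forall>a\<le>N. (\<lambda>j. v (r j) (x j) a / v (r j) (x j) i) \<longlonglongrightarrow> w z a / w z i) \<and>
       (\<lambda>j. u (r j) (x j) / v (r j) (x j) i ^ k) \<longlonglongrightarrow> U z / w z i ^ k"
    proof (intro exI[of _ "I ?n"] exI[of _ d] exI[of _ "\<lambda>j. x (d j) z"] conjI allI impI I d)
      show "w z (I ?n) \<noteq> 0" using wl(1)[OF z I] .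
      show "\<forall>\<^sub>F j in sequentially. v (d j) (x (d j) z) (I ?n) \<noteq> 0" using ev[OF z] by (simp add: y_def)
      fix a assume a: "a \<le> N"
      show "(\<lambda>j. v (d j) (x (d j) z) a / v (d j) (x (d j) z) (I ?n)) \<longlonglongrightarrow> w z a / w z (I ?n)"
        using lim[OF z a] wl[OF z a] by (simp add: y_def)
    next
      show "(\<lambda>j. u (d j) (x (d j) z) / v (d j) (x (d j) z) (I ?n) ^ k) \<longlonglongrightarrow> U z / w z (I ?n) ^ k"
        using limu[OF z] Ueq[OF z] wl(1)[OF z I] by (simp add: y_def yu_def)
    qed
  qed
qed

subsection \<open>Evaluation of forms\<close>

definition mono_val :: "(nat \<Rightarrow>\<^sub>0 nat) \<Rightarrow> cvec \<Rightarrow> complex" where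
  "mono_val m v = (\<Prod>i\<in>Poly_Mapping.keys m. v i ^ Poly_Mapping.lookup m i)"

definition mono_deg :: "(nat \<Rightarrow>\<^sub>0 nat) \<Rightarrow> nat" where
  "mono_deg m = (\<Sum>i\<in>Poly_Mapping.keys m. Poly_Mapping.lookup m i)"

lemma mono_val_superset:
  assumes "finite S" "Poly_Mapping.keys m \<subseteq> S"
  shows "mono_val m v = (\<Prod>i\<in>S. v i ^ Poly_Mapping.lookup m i)"
  unfolding mono_val_def using assms
  by (intro prod.mono_neutral_left) (auto simp: in_keys_iff)

lemma mono_deg_superset:
  assumes "finite S" "Poly_Mapping.keys m \<subseteq> S"
  shows "mono_deg m = (\<Sum>i\<in>S. Poly_Mapping.lookup m i)"
  unfolding mono_deg_def using assms
  by (intro sum.mono_neutral_left) (auto simp: in_keys_iff)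

lemma mono_val_add: "mono_val (a + b) v = mono_val a v * mono_val b v"
proof -
  let ?S = "Poly_Mapping.keys a \<union> Poly_Mapping.keys b"
  have "Poly_Mapping.keys (a + b) \<subseteq> ?S" by (rule Poly_Mapping.keys_add)
  then show ?thesis
    by (simp add: mono_val_superset[of ?S] lookup_add power_add prod.distrib)
qed

lemma mono_deg_add: "mono_deg (a + b) = mono_deg a + mono_deg b"
proof -
  let ?S = "Poly_Mapping.keys a \<union> Poly_Mapping.keys b"
  have "Poly_Mapping.keys (a + b) \<subseteq> ?S" by (rule Poly_Mapping.keys_add)
  then show ?thesis
    by (simp add: mono_deg_superset[of ?S] lookup_add sum.distrib)
qed

lemma eval_poly_altdef: "eval_poly F v = (\<Sum>m\<in>Poly_Mapping.keys F. Poly_Mapping.lookup F m * mono_val m v)"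
  by (simp add: Defs.eval_poly_def mono_val_def)

lemma eval_poly_add [simp]: "eval_poly (F + G) v = eval_poly F v + eval_poly G v"
  unfolding eval_poly_altdef by (rule setsum_keys_plus_distrib) (auto simp: distrib_right)

lemma eval_poly_zero [simp]: "eval_poly 0 v = 0"
  by (simp add: eval_poly_altdef)

lemma eval_poly_single [simp]: "eval_poly (Poly_Mapping.single m c) v = c * mono_val m v"
  by (simp add: eval_poly_altdef)

lemma eval_poly_sum [simp]: "eval_poly (sum f A) v = (\<Sum>a\<in>A. eval_poly (f a) v)"
  by (induction A rule: infinite_finite_induct) auto

lemma poly_eq_sum_single: "F = (\<Sum>m\<in>Poly_Mapping.keys F. Poly_Mapping.single m (Poly_Mapping.lookup F m))"
proof (rule poly_mapping_eqI)
  fix k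
  have "(\<Sum>m\<in>Poly_Mapping.keys F. (Poly_Mapping.lookup F m when m = k)) = Poly_Mapping.lookup F k"
    by (cases "k \<in> Poly_Mapping.keys F") (auto simp: when_def in_keys_iff)
  then show "Poly_Mapping.lookup F k = Poly_Mapping.lookup (\<Sum>m\<in>Poly_Mapping.keys F. Poly_Mapping.single m (Poly_Mapping.lookup F m)) k"
    by (simp add: lookup_sum lookup_single)
qed

lemma eval_poly_mult [simp]: "eval_poly (F * G) v = eval_poly F v * eval_poly G v"
proof -
  have "F * G = (\<Sum>m\<in>Poly_Mapping.keys F. \<Sum>l\<in>Poly_Mapping.keys G.
      Poly_Mapping.single (m + l) (Poly_Mapping.lookup F m * Poly_Mapping.lookup G l))"
    by (subst (1) poly_eq_sum_single, subst (2) poly_eq_sum_single)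
       (simp add: sum_product mult_single)
  then show ?thesis
    by (simp add: eval_poly_altdef[of F] eval_poly_altdef[of G] sum_product mono_val_add mult_ac)
qed

lemma mono_val_zero [simp]: "mono_val 0 v = 1"
  by (simp add: mono_val_def)

lemma eval_poly_one [simp]: "eval_poly 1 v = 1"
  by (simp add: eval_poly_altdef lookup_one)

lemma eval_poly_power [simp]: "eval_poly (F ^ k) v = eval_poly F v ^ k"
  by (induction k) auto

lemma eval_poly_minus [simp]: "eval_poly (F - G) v = eval_poly F v - eval_poly G v"
  using eval_poly_add[of "F - G" G v] by simp

definition const_poly :: "complex \<Rightarrow> cpoly" where "const_poly c = Poly_Mapping.single 0 c"
definition var_poly :: "nat \<Rightarrow> cpoly" where "var_poly i = Poly_Mapping.single (Poly_Mapping.single i 1) 1"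

lemma eval_const_poly [simp]: "eval_poly (const_poly c) v = c"
  by (simp add: const_poly_def)

lemma eval_var_poly [simp]: "eval_poly (var_poly i) v = v i"
  by (simp add: var_poly_def mono_val_def)

lemma eval_poly_map_scale [simp]: "eval_poly (Poly_Mapping.map ((*) c) F) v = c * eval_poly F v"
  by (simp add: mult_map_scale_conv_mult)

lemma forms_iff: "F \<in> forms n k \<longleftrightarrow> (\<forall>m\<in>Poly_Mapping.keys F. Poly_Mapping.keys m \<subseteq> {..n} \<and> mono_deg m = k)"
  by (simp add: forms_def mono_deg_def)

lemma forms_zero: "0 \<in> forms n k" by (simp add: forms_iff)

lemma forms_add: "F \<in> forms n k \<Longrightarrow> G \<in> forms n k \<Longrightarrow> F + G \<in> forms n k"
  unfolding forms_iff using Poly_Mapping.keys_add[of F G] by blast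

lemma forms_sum: "(\<And>a. a \<in> A \<Longrightarrow> f a \<in> forms n k) \<Longrightarrow> sum f A \<in> forms n k"
  by (induction A rule: infinite_finite_induct) (auto intro: forms_add forms_zero)

lemma forms_mult: "F \<in> forms n k \<Longrightarrow> G \<in> forms n l \<Longrightarrow> F * G \<in> forms n (k + l)"
  unfolding forms_iff
proof (intro ballI)
  fix m assume F: "\<forall>m\<in>Poly_Mapping.keys F. Poly_Mapping.keys m \<subseteq> {..n} \<and> mono_deg m = k"
    and G: "\<forall>m\<in>Poly_Mapping.keys G. Poly_Mapping.keys m \<subseteq> {..n} \<and> mono_deg m = l"
    and "m \<in> Poly_Mapping.keys (F * G)"
  then obtain a b where "m = a + b" "a \<in> Poly_Mapping.keys F" "b \<in> Poly_Mapping.keys G"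
    using keys_mult[of F G] by blast
  moreover from this F G have "Poly_Mapping.keys a \<union> Poly_Mapping.keys b \<subseteq> {..n}" by blast
  ultimately show "Poly_Mapping.keys m \<subseteq> {..n} \<and> mono_deg m = k + l"
    using F G subset_trans[OF Poly_Mapping.keys_add[of a b]] by (simp add: mono_deg_add)
qed

lemma forms_const: "const_poly c \<in> forms n 0"
  by (simp add: forms_iff const_poly_def mono_deg_def)

lemma forms_var: "i \<le> n \<Longrightarrow> var_poly i \<in> forms n 1"
  by (simp add: forms_iff var_poly_def mono_deg_def)

lemma forms_power: "F \<in> forms n k \<Longrightarrow> F ^ l \<in> forms n (k * l)"
proof (induction l)
  case 0
  have "const_poly 1 \<in> forms n 0" by (rule forms_const)
  then show ?case by (simp add: const_poly_def)
next
  case (Suc l)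
  from forms_mult[OF Suc.prems Suc.IH[OF Suc.prems]] show ?case by simp
qed

lemma forms_cmult: "F \<in> forms n k \<Longrightarrow> const_poly c * F \<in> forms n k"
  using forms_mult[OF forms_const] by simp

lemma forms_mono: "F \<in> forms n k \<Longrightarrow> n \<le> n' \<Longrightarrow> F \<in> forms n' k"
  unfolding forms_iff by (meson atMost_iff order_trans subset_iff)

lemma forms_diff: "F \<in> forms n k \<Longrightarrow> G \<in> forms n k \<Longrightarrow> F - G \<in> forms n k"
proof -
  assume F: "F \<in> forms n k" and G: "G \<in> forms n k"
  have eq: "F - G = F + const_poly (-1) * G"
    by (simp add: const_poly_def single_uminus)
  show ?thesis unfolding eq by (intro forms_add forms_cmult F G)
qed

lemma mono_val_scale: "mono_val m (\<lambda>i. c * v i) = c ^ mono_deg m * mono_val m v"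
  by (simp add: mono_val_def mono_deg_def power_mult_distrib prod.distrib power_sum)

lemma eval_poly_scale: "F \<in> forms n k \<Longrightarrow> eval_poly F (\<lambda>i. c * v i) = c ^ k * eval_poly F v"
  unfolding eval_poly_altdef sum_distrib_left
  by (intro sum.cong) (auto simp: mono_val_scale forms_iff)

lemma eval_poly_cong:
  assumes "F \<in> forms n k" "\<And>i. i \<le> n \<Longrightarrow> v i = w i"
  shows "eval_poly F v = eval_poly F w"
  unfolding eval_poly_altdef
proof (intro sum.cong refl)
  fix m assume "m \<in> Poly_Mapping.keys F"
  then have "Poly_Mapping.keys m \<subseteq> {..n}" using assms(1) by (simp add: forms_iff)
  then have "mono_val m v = mono_val m w" unfolding mono_val_def using assms(2) by (intro prod.cong) auto
  then show "Poly_Mapping.lookup F m * mono_val m v = Poly_Mapping.lookup F m * mono_val m w" by simp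
qed

lemma eval_poly_holomorphic:
  assumes "\<And>i. (\<lambda>z. v z i) holomorphic_on S"
  shows "(\<lambda>z. eval_poly F (v z)) holomorphic_on S"
  unfolding eval_poly_altdef mono_val_def by (intro holomorphic_intros assms)

lemma eval_poly_tendsto:
  assumes "\<And>i. ((\<lambda>z. v z i) \<longlongrightarrow> w i) G"
  shows "((\<lambda>z. eval_poly F (v z)) \<longlongrightarrow> eval_poly F w) G"
  unfolding eval_poly_altdef mono_val_def by (intro tendsto_intros assms)

subsection \<open>Partial derivatives and smoothness\<close>

lemma eval_poly_has_partial: "((\<lambda>z. eval_poly F (v(i := z))) has_field_derivative poly_partial i F v) (at (v i))"
proof -
  have "(\<lambda>z. (v(i := z)) j) holomorphic_on UNIV" for j
    by (cases "j = i") auto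
  then have "(\<lambda>z. eval_poly F (v(i := z))) holomorphic_on UNIV" by (intro eval_poly_holomorphic)
  then have "(\<lambda>z. eval_poly F (v(i := z))) analytic_on {v i}" using analytic_at by blast
  then show ?thesis unfolding poly_partial_def by (rule analytic_derivI)
qed

lemma poly_partialI:
  assumes "((\<lambda>z. eval_poly F (v(i := z))) has_field_derivative D) (at (v i))"
  shows "poly_partial i F v = D"
  using assms unfolding poly_partial_def by (rule DERIV_imp_deriv)

text \<open>Multiplication by \<open>v i\<close> restores the exponent that differentiation lowers.
  In this form the equations of a singular point are linear in the values of monomials.\<close>

lemma poly_partial_euler:
  "v i * poly_partial i F v = (\<Sum>m\<in>Poly_Mapping.keys F. Poly_Mapping.lookup F m * (of_nat (Poly_Mapping.lookup m i) * mono_val m v))"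
proof -
  have d: "\<exists>D. ((\<lambda>z. mono_val m (v(i := z))) has_field_derivative D) (at (v i)) \<and> v i * D = of_nat (Poly_Mapping.lookup m i) * mono_val m v" for m
  proof -
    define e where "e = Poly_Mapping.lookup m i"
    define R where "R = (\<Prod>j\<in>Poly_Mapping.keys m - {i}. v j ^ Poly_Mapping.lookup m j)"
    have val: "mono_val m (v(i := z)) = z ^ e * R" for z
    proof -
      have "mono_val m (v(i := z)) = (\<Prod>j\<in>insert i (Poly_Mapping.keys m). (v(i := z)) j ^ Poly_Mapping.lookup m j)"
        by (rule mono_val_superset) auto
      also have "\<dots> = z ^ e * (\<Prod>j\<in>Poly_Mapping.keys m - {i}. (v(i := z)) j ^ Poly_Mapping.lookup m j)"
        by (simp add: prod.insert_remove e_def)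
      also have "(\<Prod>j\<in>Poly_Mapping.keys m - {i}. (v(i := z)) j ^ Poly_Mapping.lookup m j) = R"
        unfolding R_def by (intro prod.cong) auto
      finally show ?thesis .
    qed
    have "((\<lambda>z. z ^ e * R) has_field_derivative of_nat e * v i ^ (e - 1) * R) (at (v i))"
      by (auto intro!: derivative_eq_intros)
    moreover have "v i * (of_nat e * v i ^ (e - 1) * R) = of_nat e * mono_val m v"
      using val[of "v i"] by (cases e) (auto simp: mult_ac)
    ultimately show ?thesis unfolding val e_def by blast
  qed
  then obtain D where D: "\<And>m. ((\<lambda>z. mono_val m (v(i := z))) has_field_derivative D m) (at (v i))"
      "\<And>m. v i * D m = of_nat (Poly_Mapping.lookup m i) * mono_val m v"
    by metis
  have "poly_partial i F v = (\<Sum>m\<in>Poly_Mapping.keys F. Poly_Mapping.lookup F m * D m)"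
    unfolding eval_poly_altdef by (rule poly_partialI, unfold eval_poly_altdef) (intro DERIV_sum DERIV_cmult D)
  then show ?thesis by (simp add: sum_distrib_left D(2)[symmetric] mult.left_commute)
qed

lemma finite_monomials: "finite {a :: nat \<Rightarrow>\<^sub>0 nat. Poly_Mapping.keys a \<subseteq> {..n} \<and> mono_deg a = N}"
proof (rule finite_imageD)
  let ?A = "{a :: nat \<Rightarrow>\<^sub>0 nat. Poly_Mapping.keys a \<subseteq> {..n} \<and> mono_deg a = N}"
  have "(\<lambda>a. restrict (Poly_Mapping.lookup a) {..n}) ` ?A \<subseteq> ({..n} \<rightarrow>\<^sub>E {..N})"
  proof (rule image_subsetI, rule restrict_PiE_iff[THEN iffD2], rule ballI)
    fix a i assume a: "a \<in> ?A" and i: "i \<in> {..n}"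
    have "Poly_Mapping.lookup a i \<le> (\<Sum>i\<in>{..n}. Poly_Mapping.lookup a i)" using i by (intro member_le_sum) auto
    also have "\<dots> = N" using a mono_deg_superset[of "{..n}" a] by auto
    finally show "Poly_Mapping.lookup a i \<in> {..N}" by simp
  qed
  then show "finite ((\<lambda>a. restrict (Poly_Mapping.lookup a) {..n}) ` ?A)"
    by (rule finite_subset) (intro finite_PiE; simp)
  show "inj_on (\<lambda>a. restrict (Poly_Mapping.lookup a) {..n}) ?A"
  proof (rule inj_onI)
    fix a b assume a: "a \<in> ?A" and b: "b \<in> ?A"
      and eq: "restrict (Poly_Mapping.lookup a) {..n} = restrict (Poly_Mapping.lookup b) {..n}"
    show "a = b"
    proof (rule poly_mapping_eqI)
      fix k
      show "Poly_Mapping.lookup a k = Poly_Mapping.lookup b k"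
      proof (cases "k \<le> n")
        case True
        then show ?thesis using fun_cong[OF eq, of k] by simp
      next
        case False
        then have "k \<notin> Poly_Mapping.keys a" "k \<notin> Poly_Mapping.keys b" using a b by auto
        then show ?thesis by (simp add: in_keys_iff)
      qed
    qed
  qed
qed

text \<open>Multiplying the equations for a singular point by monomials shows that the vector of all
  monomials of a fixed large degree at that point is an eigenvector of a matrix depending only on
  \<open>G\<close>, with eigenvalue \<open>\<epsilon>\<close>.\<close>

lemma finite_singular_parameters:
  assumes G: "G \<in> forms n d" and d: "d > 0"
  shows "finite {\<epsilon>. \<exists>v\<in>nonzero_vecs n. \<forall>i\<le>n. poly_partial i G v + \<epsilon> * of_nat d * v i ^ (d - 1) = 0}" (is "finite ?E")
proof -
  \<comment> \<open>By the pigeonhole principle a monomial of this degree in n + 1 variables has an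
    exponent of at least \<open>d\<close>.\<close>
  define N where "N = (n + 1) * d"
  define Ms where "Ms = {a :: nat \<Rightarrow>\<^sub>0 nat. Poly_Mapping.keys a \<subseteq> {..n} \<and> mono_deg a = N}"
  have finM: "finite Ms" unfolding Ms_def by (rule finite_monomials)
  have "\<exists>i\<le>n. Poly_Mapping.lookup a i \<ge> d" if a: "a \<in> Ms" for a
  proof (rule ccontr)
    assume "\<not> ?thesis"
    then have "\<And>i. i \<le> n \<Longrightarrow> Poly_Mapping.lookup a i \<le> d - 1" by force
    then have "(\<Sum>i\<in>{..n}. Poly_Mapping.lookup a i) \<le> (\<Sum>i\<in>{..n}. d - 1)" by (intro sum_mono) auto
    also have "\<dots> = (n + 1) * (d - 1)" by simp
    also have "\<dots> < N" unfolding N_def using d by (intro mult_strict_left_mono) auto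
    finally show False using a mono_deg_superset[of "{..n}" a] by (auto simp: Ms_def)
  qed
  then obtain \<iota> where \<iota>: "\<And>a. a \<in> Ms \<Longrightarrow> \<iota> a \<le> n" "\<And>a. a \<in> Ms \<Longrightarrow> Poly_Mapping.lookup a (\<iota> a) \<ge> d" by metis
  \<comment> \<open>Multiplying the i-th equation, for i = \<open>\<iota> a\<close>, by x_i and by
    the monomial \<open>r a\<close> expresses \<epsilon> times the monomial \<open>a\<close> through
    monomials of the same degree; the coefficients form the matrix \<open>T\<close>.\<close>
  define r where "r a = a - Poly_Mapping.single (\<iota> a) d" for a
  have ra: "a = r a + Poly_Mapping.single (\<iota> a) d" if "a \<in> Ms" for a
    unfolding r_def by (rule poly_mapping_eqI) (use \<iota>(2)[OF that] in \<open>auto simp: lookup_add lookup_minus lookup_single when_def\<close>)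
  have rM: "r a + m \<in> Ms" if a: "a \<in> Ms" and m: "m \<in> Poly_Mapping.keys G" for a m
  proof -
    have "mono_deg a = mono_deg (r a) + d" using arg_cong[OF ra[OF a], of mono_deg] d by (simp add: mono_deg_add mono_deg_def[of "Poly_Mapping.single _ _"])
    moreover have "mono_deg m = d" "Poly_Mapping.keys m \<subseteq> {..n}" using G m by (auto simp: forms_iff)
    moreover have "Poly_Mapping.keys (r a) \<subseteq> Poly_Mapping.keys a"
      unfolding r_def by (auto simp: in_keys_iff lookup_minus)
    ultimately show ?thesis using a Poly_Mapping.keys_add[of "r a" m] by (auto simp: Ms_def mono_deg_add)
  qed
  define T where "T a b = - (\<Sum>m\<in>{m\<in>Poly_Mapping.keys G. r a + m = b}. Poly_Mapping.lookup G m * of_nat (Poly_Mapping.lookup m (\<iota> a))) / of_nat d" for a b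
  have key: "(\<Sum>b\<in>Ms. T a b * mono_val b v) = \<epsilon> * mono_val a v"
    if a: "a \<in> Ms" and sing: "\<And>i. i \<le> n \<Longrightarrow> poly_partial i G v + \<epsilon> * of_nat d * v i ^ (d - 1) = 0" for a v \<epsilon>
  proof -
    let ?i = "\<iota> a"
    have "(\<Sum>b\<in>Ms. T a b * mono_val b v) = (\<Sum>b\<in>Ms. - (\<Sum>m\<in>{m\<in>Poly_Mapping.keys G. r a + m = b}. Poly_Mapping.lookup G m * of_nat (Poly_Mapping.lookup m ?i) * mono_val (r a + m) v) / of_nat d)"
      by (intro sum.cong refl) (auto simp: T_def sum_distrib_right intro!: sum.cong)
    also have "\<dots> = - (\<Sum>b\<in>Ms. \<Sum>m\<in>{m\<in>Poly_Mapping.keys G. r a + m = b}. Poly_Mapping.lookup G m * of_nat (Poly_Mapping.lookup m ?i) * mono_val (r a + m) v) / of_nat d"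
      by (simp add: sum_divide_distrib sum_negf)
    also have "(\<Sum>b\<in>Ms. \<Sum>m\<in>{m\<in>Poly_Mapping.keys G. r a + m = b}. Poly_Mapping.lookup G m * of_nat (Poly_Mapping.lookup m ?i) * mono_val (r a + m) v)
       = (\<Sum>m\<in>Poly_Mapping.keys G. Poly_Mapping.lookup G m * of_nat (Poly_Mapping.lookup m ?i) * mono_val (r a + m) v)"
      by (rule sum.group) (use finM rM[OF a] in auto)
    also have "\<dots> = mono_val (r a) v * (v ?i * poly_partial ?i G v)"
      unfolding poly_partial_euler by (simp add: sum_distrib_left mono_val_add mult_ac)
    also have "poly_partial ?i G v = - (\<epsilon> * of_nat d * v ?i ^ (d - 1))" using sing[OF \<iota>(1)[OF a]] by (simp add: add_eq_0_iff2)
    also have "mono_val (r a) v * (v ?i * - (\<epsilon> * of_nat d * v ?i ^ (d - 1))) = - (of_nat d * (\<epsilon> * (mono_val (r a) v * v ?i ^ d)))"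
      using d by (cases d) (auto simp: mult_ac)
    also have "mono_val (r a) v * v ?i ^ d = mono_val a v"
    proof -
      have "mono_val (Poly_Mapping.single ?i d) v = v ?i ^ d" using d by (simp add: mono_val_def)
      then show ?thesis by (subst (2) ra[OF a]) (simp add: mono_val_add)
    qed
    finally show ?thesis using d by simp
  qed
  obtain e where e: "bij_betw e {0..<card Ms} Ms" using ex_bij_betw_nat_finite[OF finM] by blast
  define A where "A = mat (card Ms) (card Ms) (\<lambda>(p, q). T (e p) (e q))"
  have Ac: "A \<in> carrier_mat (card Ms) (card Ms)" by (simp add: A_def)
  have "?E \<subseteq> spectrum A"
  proof
    fix \<epsilon> assume "\<epsilon> \<in> ?E"
    then obtain v where v: "v \<in> nonzero_vecs n" and sing: "\<And>i. i \<le> n \<Longrightarrow> poly_partial i G v + \<epsilon> * of_nat d * v i ^ (d - 1) = 0" by blast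
    define x where "x = vec (card Ms) (\<lambda>p. mono_val (e p) v)"
    have "A *\<^sub>v x = \<epsilon> \<cdot>\<^sub>v x"
    proof (rule eq_vecI)
      show "dim_vec (A *\<^sub>v x) = dim_vec (\<epsilon> \<cdot>\<^sub>v x)" by (simp add: A_def x_def)
      fix p assume "p < dim_vec (\<epsilon> \<cdot>\<^sub>v x)"
      then have p: "p < card Ms" by (simp add: x_def)
      then have ep: "e p \<in> Ms" using e by (auto simp: bij_betw_def)
      have "vec_index (A *\<^sub>v x) p = (\<Sum>q\<in>{0..<card Ms}. T (e p) (e q) * mono_val (e q) v)"
        using p by (simp add: A_def x_def scalar_prod_def)
      also have "\<dots> = (\<Sum>b\<in>Ms. T (e p) b * mono_val b v)" by (rule sum.reindex_bij_betw[OF e])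
      also have "\<dots> = \<epsilon> * mono_val (e p) v" by (rule key[OF ep sing])
      finally show "vec_index (A *\<^sub>v x) p = vec_index (\<epsilon> \<cdot>\<^sub>v x) p" using p by (simp add: x_def)
    qed
    moreover have "x \<noteq> 0\<^sub>v (card Ms)"
    proof
      assume x0: "x = 0\<^sub>v (card Ms)"
      \<comment> \<open>The entry of \<open>x\<close> belonging to the monomial x_i^N shows that the
        eigenvector is nonzero.\<close>
      obtain i where i: "i \<le> n" "v i \<noteq> 0" using v by (auto simp: nonzero_vecs_def)
      have N0: "N > 0" using d by (simp add: N_def)
      let ?a = "Poly_Mapping.single i N"
      have "?a \<in> Ms" using i N0 by (simp add: Ms_def mono_deg_def)
      then have "?a \<in> e ` {0..<card Ms}" using e by (simp add: bij_betw_def)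
      then obtain p where "?a = e p" "p \<in> {0..<card Ms}" by (rule imageE)
      then have p: "p < card Ms" "e p = ?a" by simp_all
      have "vec_index x p = 0" unfolding x0 using p by simp
      then have "mono_val ?a v = 0" using p by (simp add: x_def)
      then show False using i N0 by (simp add: mono_val_def)
    qed
    moreover have "x \<in> carrier_vec (card Ms)" by (simp add: x_def)
    ultimately have "eigenvector A x \<epsilon>" using Ac by (simp add: eigenvector_def)
    then show "\<epsilon> \<in> spectrum A" by (auto simp: spectrum_def eigenvalue_def)
  qed
  then show ?thesis by (rule finite_subset) (rule card_finite_spectrum(1)[OF Ac])
qed

subsection \<open>Curves in hypersurfaces\<close>

text \<open>Cancelling the smaller power would equate a unit with a function that vanishes at
  z.\<close>

lemma local_order_unique:
  assumes h: "h analytic_on {z::complex}" "h z \<noteq> 0" and g: "g analytic_on {z}" "g z \<noteq> 0"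
    and eq: "\<forall>\<^sub>F w in nhds z. (w - z) ^ e * h w = (w - z) ^ m * g w"
  shows "e = m"
proof -
  have le: "\<not> e < m" if h: "h analytic_on {z}" "h z \<noteq> 0" and g: "g analytic_on {z}"
    and eq: "\<forall>\<^sub>F w in nhds z. (w - z) ^ e * h w = (w - z) ^ m * g w" for e m and h g :: "complex \<Rightarrow> complex"
  proof
    assume em: "e < m"
    have "\<forall>\<^sub>F w in at z. (w - z) ^ e * h w = (w - z) ^ m * g w" using eq by (simp add: eventually_nhds_conv_at)
    then have "\<forall>\<^sub>F w in at z. h w = (w - z) ^ (m - e) * g w"
      using eventually_neq_at_within[of z z UNIV]
    proof eventually_elim
      case (elim w)
      have "(w - z) ^ m = (w - z) ^ e * (w - z) ^ (m - e)" using em by (simp add: power_add[symmetric])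
      with elim show ?case by simp
    qed
    then have "h z = (z - z) ^ (m - e) * g z"
      by (intro analytic_eq_of_eventually_eq[of h z "\<lambda>w. (w - z) ^ (m - e) * g w"] h)
         (auto intro!: analytic_intros g)
    then show False using em h(2) by simp
  qed
  have eq': "\<forall>\<^sub>F w in nhds z. (w - z) ^ m * g w = (w - z) ^ e * h w" using eq by (simp add: eq_commute)
  from le[OF h g(1) eq] le[OF g h(1) eq'] show ?thesis by simp
qed

text \<open>At a zero of \<open>f\<close> the cofactor \<open>R\<close> is a unit, so
  \<open>K\<close> times the order of \<open>y\<close> equals \<open>e\<close> times the order of
  \<open>f\<close>; \<open>ord\<close> is the arithmetic consequence drawn from this
  equation.\<close>

lemma zero_orders_geI:
  assumes y: "y holomorphic_on UNIV" and R: "R holomorphic_on UNIV"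
    and eq: "\<And>z. y z ^ K = f z ^ e * R z" and Rnz: "\<And>z. f z = 0 \<Longrightarrow> R z \<noteq> 0" and e: "e > 0"
    and ord: "\<And>r o'. r * K = o' * e \<Longrightarrow> o' > 0 \<Longrightarrow> q \<le> o'"
  shows "zero_orders_ge q f"
  unfolding zero_orders_ge_def
proof (intro allI impI)
  fix z d h assume h: "h analytic_on {z}" "h z \<noteq> 0" and fd: "\<forall>\<^sub>F w in nhds z. f w = (w - z) ^ d * h w"
  have ya: "y analytic_on {z}" and Ra: "R analytic_on {z}" using y R analytic_at by blast+
  show "d = 0 \<or> q \<le> d"
  proof (cases "d = 0")
    case False
    have "f z = 0" using eventually_nhds_x_imp_x[OF fd] False by simp
    then have Rz: "R z \<noteq> 0" by (rule Rnz)
    have yK: "\<forall>\<^sub>F w in nhds z. y w ^ K = (w - z) ^ (d * e) * (h w ^ e * R w)"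
      using fd by eventually_elim (simp add: eq power_mult_distrib power_mult)
    have "\<forall>\<^sub>F w in nhds z. h w \<noteq> 0 \<and> R w \<noteq> 0"
      using analytic_nonzero_nhds[OF h] analytic_nonzero_nhds[OF Ra Rz] by eventually_elim auto
    then have hR: "\<forall>\<^sub>F w in at z. h w \<noteq> 0 \<and> R w \<noteq> 0" by (simp add: eventually_nhds_conv_at)
    show ?thesis
    proof (cases "K = 0")
      case True
      have "\<forall>\<^sub>F w in nhds z. (w - z) ^ 0 * 1 = (w - z) ^ (d * e) * (h w ^ e * R w)" using yK True by simp
      moreover have "(\<lambda>w. h w ^ e * R w) analytic_on {z}" by (intro analytic_intros h Ra)
      moreover have "h z ^ e * R z \<noteq> 0" using h Rz by simp
      ultimately have "0 = d * e"
        by (intro local_order_unique[where z = z and e = 0 and h = "\<lambda>_. 1" and m = "d * e" and g = "\<lambda>w. h w ^ e * R w"]) simp_all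
      then show ?thesis using e by simp
    next
      case K: False
      have "\<not> (\<forall>\<^sub>F w in nhds z. y w = 0)"
      proof
        assume "\<forall>\<^sub>F w in nhds z. y w = 0"
        with yK have "\<forall>\<^sub>F w in nhds z. (w - z) ^ (d * e) * (h w ^ e * R w) = 0"
          by eventually_elim (use K in \<open>simp add: power_0_left\<close>)
        then have "\<forall>\<^sub>F w in at z. (w - z) ^ (d * e) * (h w ^ e * R w) = 0" by (simp add: eventually_nhds_conv_at)
        with hR eventually_neq_at_within[of z z UNIV] have "\<forall>\<^sub>F w in at z. False"
          by eventually_elim auto
        then show False by simp
      qed
      then obtain r g where g: "g analytic_on {z}" "g z \<noteq> 0" "\<forall>\<^sub>F w in nhds z. y w = (w - z) ^ r * g w"
        using analytic_local_order[OF ya] by blast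
      have "\<forall>\<^sub>F w in nhds z. (w - z) ^ (r * K) * g w ^ K = (w - z) ^ (d * e) * (h w ^ e * R w)"
        using yK g(3) by eventually_elim (simp add: power_mult_distrib power_mult)
      moreover have "(\<lambda>w. h w ^ e * R w) analytic_on {z}" by (intro analytic_intros h Ra)
      moreover have "h z ^ e * R z \<noteq> 0" using h Rz by simp
      moreover have "(\<lambda>w. g w ^ K) analytic_on {z}" by (intro analytic_intros g)
      moreover have "g z ^ K \<noteq> 0" using g by simp
      ultimately have "r * K = d * e"
        by (intro local_order_unique[where z = z and e = "r * K" and h = "\<lambda>w. g w ^ K" and m = "d * e" and g = "\<lambda>w. h w ^ e * R w"])
      then show ?thesis using ord False by blast
    qed
  qed simp
qed

text \<open>Each ratio of coordinates is an entire function with constant d-th power, hence bounded,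
  and Liouville's theorem applies.\<close>

lemma (in entire_curve) constant_of_powers_proportional:
  assumes i: "\<And>z. v z i \<noteq> 0" and d: "d > 0"
    and pow: "\<And>j. j \<le> N \<Longrightarrow> \<exists>c. \<forall>z. v z j ^ d = c * v z i ^ d"
  shows "proj_point (v z) = proj_point (v 0)"
proof -
  have ratio: "v z j / v z i = v 0 j / v 0 i" for j
  proof (cases "j \<le> N")
    case True
    obtain c where c: "\<And>z. v z j ^ d = c * v z i ^ d" using pow[OF True] by blast
    define g where "g z = v z j / v z i" for z
    have g: "g holomorphic_on UNIV" unfolding g_def by (intro holomorphic_intros hol) (use i in auto)
    have gd: "g z ^ d = c" for z using c[of z] i[of z] by (simp add: g_def power_divide)
    have "cmod (g z) \<le> max 1 (cmod c)" for z
    proof (cases "cmod (g z) \<le> 1")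
      case False
      then have "cmod (g z) ^ 1 \<le> cmod (g z) ^ d" using d by (intro power_increasing) auto
      also have "\<dots> = cmod c" using gd[of z] by (simp flip: norm_power)
      finally show ?thesis by simp
    qed simp
    then have "bounded (range g)" by (auto simp: bounded_iff)
    from Liouville_theorem[OF g this] obtain k where "\<And>z. g z = k" by (auto simp: constant_on_def)
    then show ?thesis by (simp add: g_def)
  qed (simp add: supp)
  have "v z j = v z i / v 0 i * v 0 j" for j
  proof -
    have "v z j = v z j / v z i * v z i" using i[of z] by simp
    also have "\<dots> = v 0 j / v 0 i * v z i" by (simp only: ratio)
    finally show ?thesis by (simp add: mult_ac)
  qed
  then have eq: "v z = (\<lambda>j. v z i / v 0 i * v 0 j)" by (rule ext)
  have "v z i / v 0 i \<noteq> 0" using i[of z] i[of 0] by simp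
  with eq show ?thesis unfolding proj_point_eq_iff by blast
qed

lemma proj_holomorphic_lift_curve:
  assumes "proj_holomorphic_on N f UNIV"
  shows "\<exists>v. entire_curve N v \<and> (\<forall>z. f z = proj_point (v z))"
proof (rule proj_holomorphic_lift[OF assms])
  fix v assume v: "\<And>i. (\<lambda>z. v z i) holomorphic_on UNIV" "\<And>z. v z \<in> nonzero_vecs N" "\<And>z. f z = proj_point (v z)"
  have "entire_curve N v" by (rule entire_curve.intro) (rule v)+
  then show ?thesis using v(3) by (intro exI[of _ v] conjI allI)
qed

lemma not_brody_hyperbolic_curve:
  assumes "\<not> brody_hyperbolic N X"
  obtains v where "entire_curve N v" "\<And>z. proj_point (v z) \<in> X" "\<exists>z. curve_speed N v z \<noteq> 0"
proof -
  obtain f where f: "proj_holomorphic_on N f UNIV" "range f \<subseteq> X" "\<not> f constant_on UNIV"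
    using assms by (auto simp: brody_hyperbolic_def)
  obtain v where vv: "entire_curve N v \<and> (\<forall>z. f z = proj_point (v z))"
    using proj_holomorphic_lift_curve[OF f(1)] by (rule exE)
  then interpret entire_curve N v by (rule conjunct1)
  have v3: "f z = proj_point (v z)" for z using vv by simp
  have "\<exists>z. curve_speed N v z \<noteq> 0"
  proof (rule ccontr)
    assume "\<not> ?thesis"
    then have "f z = f 0" for z unfolding v3 using speed_zero_imp_constant by blast
    then show False using f(3) unfolding constant_on_def by blast
  qed
  moreover have "proj_point (v z) \<in> X" for z unfolding v3[symmetric] using f(2) by auto
  ultimately show thesis by (intro that[OF entire_curve_axioms])
qed

lemma not_brody_hyperbolicI:
  assumes "entire_curve N v" "\<And>z. proj_point (v z) \<in> X" "proj_point (v z1) \<noteq> proj_point (v z2)"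
  shows "\<not> brody_hyperbolic N X"
proof
  assume "brody_hyperbolic N X"
  moreover have "proj_holomorphic_on N (\<lambda>z. proj_point (v z)) UNIV"
    unfolding proj_holomorphic_on_def
  proof
    fix z :: complex
    show "\<exists>U F. open U \<and> z \<in> U \<and> U \<subseteq> UNIV \<and> (\<forall>i. (\<lambda>w. F w i) holomorphic_on U) \<and>
        (\<forall>w\<in>U. F w \<in> nonzero_vecs N \<and> proj_point (v w) = proj_point (F w))"
      by (rule exI[of _ UNIV], rule exI[of _ v])
         (simp add: entire_curve.hol[OF assms(1)] entire_curve.nz[OF assms(1)])
  qed
  ultimately have "(\<lambda>z. proj_point (v z)) constant_on UNIV" using assms(2) by (auto simp: brody_hyperbolic_def)
  then show False using assms(3) by (auto simp: constant_on_def)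
qed

section \<open>Hypersurfaces and their zero loci\<close>

lemma map_one_mem_proj_form: "Poly_Mapping.map ((*) 1) F \<in> proj_form F"
  unfolding proj_form_def by (rule CollectI, rule exI[of _ 1], rule conjI[OF refl one_neq_zero])

lemma mem_zero_locus_iff:
  assumes F: "F \<in> forms n k" and v: "v \<in> nonzero_vecs n"
  shows "proj_point v \<in> zero_locus n (proj_form F) \<longleftrightarrow> eval_poly F v = 0"
proof
  assume "eval_poly F v = 0"
  then have "\<forall>G\<in>proj_form F. eval_poly G v = 0" by (auto simp: proj_form_def)
  with v show "proj_point v \<in> zero_locus n (proj_form F)"
    unfolding zero_locus_def by (intro CollectI exI[of _ v] conjI refl)
next
  assume "proj_point v \<in> zero_locus n (proj_form F)"
  then have "\<exists>w. proj_point v = proj_point w \<and> w \<in> nonzero_vecs n \<and> (\<forall>G\<in>proj_form F. eval_poly G w = 0)"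
    unfolding zero_locus_def by (rule CollectD)
  then obtain w where "proj_point v = proj_point w \<and> w \<in> nonzero_vecs n \<and> (\<forall>G\<in>proj_form F. eval_poly G w = 0)"
    by (rule exE)
  then have w: "proj_point v = proj_point w" "\<forall>G\<in>proj_form F. eval_poly G w = 0" by simp_all
  have "Poly_Mapping.map ((*) 1) F \<in> proj_form F" by (rule map_one_mem_proj_form)
  with w(2) have "eval_poly (Poly_Mapping.map ((*) 1) F) w = 0" by blast
  then have "eval_poly F w = 0" by simp
  moreover obtain c where "c \<noteq> 0 \<and> v = (\<lambda>i. c * w i)" using w(1)[unfolded proj_point_eq_iff] by (rule exE)
  ultimately show "eval_poly F v = 0" by (simp add: eval_poly_scale[OF F])
qed

lemma hypersurfacesE:
  assumes "X \<in> hypersurfaces n k"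
  obtains F where "F \<in> forms n k" "F \<noteq> 0" "X = proj_form F"
proof -
  obtain F where "X = proj_form F" "F \<in> forms n k - {0}" using assms unfolding hypersurfaces_def by (rule imageE)
  then show thesis by (intro that[of F]) simp_all
qed

subsection \<open>Cyclic covers\<close>

definition cover_poly :: "nat \<Rightarrow> nat \<Rightarrow> cpoly \<Rightarrow> cpoly" where
  "cover_poly n d s = var_poly (n + 1) ^ d - s"

lemma eval_cover_poly: "eval_poly (cover_poly n d s) v = v (n + 1) ^ d - eval_poly s v"
  by (simp add: cover_poly_def)

lemma cover_poly_forms:
  assumes "s \<in> forms n d"
  shows "cover_poly n d s \<in> forms (n + 1) d"
proof -
  have "var_poly (n + 1) ^ d \<in> forms (n + 1) (1 * d)" by (intro forms_power forms_var) simp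
  then show ?thesis unfolding cover_poly_def by (intro forms_diff forms_mono[OF assms]) auto
qed

lemma poly_partial_map_scale: "poly_partial i (Poly_Mapping.map ((*) c) F) v = c * poly_partial i F v"
  by (rule poly_partialI) (use DERIV_cmult[OF eval_poly_has_partial[of F v i], of c] in simp)

lemma poly_partial_zero: "poly_partial i 0 v = 0"
  by (rule poly_partialI) simp

text \<open>The projection forgets the last coordinate y and has centre (0 : ... : 0 : 1). The
  y-derivative of the cover vanishes only for y = 0, and at such points the derivatives of
  \<open>s\<close> take over.\<close>

lemma cyclic_hypersurface:
  assumes s: "s \<in> forms n d" and d: "d \<ge> 2"
    and smooth: "\<And>v. v \<in> nonzero_vecs n \<Longrightarrow> \<exists>i\<le>n. poly_partial i s v \<noteq> 0"
    and hyp: "brody_hyperbolic (n + 1) (zero_locus (n + 1) (proj_form (cover_poly n d s)))"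
  shows "\<exists>W \<in> hypersurfaces (n + 1) d.
           smooth_hypersurface (n + 1) W \<and>
           brody_hyperbolic (n + 1) (zero_locus (n + 1) W) \<and>
           (\<exists>A. linear_projection n A \<and> cyclic_cover n d A (zero_locus (n + 1) W))"
proof (intro bexI conjI)
  let ?P = "cover_poly n d s"
  let ?W = "proj_form ?P"
  have P: "?P \<in> forms (n + 1) d" by (rule cover_poly_forms[OF s])
  have "?P \<noteq> 0"
  proof
    assume P0: "?P = 0"
    let ?e = "\<lambda>i. if i = n + 1 then 1 else (0::complex)"
    have "eval_poly s ?e = eval_poly s (\<lambda>i. 0 * ?e i)" by (rule eval_poly_cong[OF s]) auto
    also have "\<dots> = 0" unfolding eval_poly_scale[OF s] using d by simp
    finally have "eval_poly ?P ?e = 1" by (simp add: eval_cover_poly)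
    then show False by (simp add: P0)
  qed
  then show "?W \<in> hypersurfaces (n + 1) d" using P by (auto simp: hypersurfaces_def)
  show "brody_hyperbolic (n + 1) (zero_locus (n + 1) ?W)" by (rule hyp)
  have partial_s: "poly_partial i ?P v = - poly_partial i s v" if "i \<le> n" for i v
  proof (rule poly_partialI)
    have "((\<lambda>z. v (n + 1) ^ d - eval_poly s (v(i := z))) has_field_derivative 0 - poly_partial i s v) (at (v i))"
      by (intro DERIV_diff eval_poly_has_partial DERIV_const)
    then show "((\<lambda>z. eval_poly ?P (v(i := z))) has_field_derivative - poly_partial i s v) (at (v i))"
      using that by (simp add: eval_cover_poly)
  qed
  have partial_y: "poly_partial (n + 1) ?P v = of_nat d * v (n + 1) ^ (d - 1)" for v
  proof (rule poly_partialI)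
    have "eval_poly s (v(n + 1 := z)) = eval_poly s v" for z by (rule eval_poly_cong[OF s]) auto
    moreover have "((\<lambda>z. z ^ d - eval_poly s v) has_field_derivative of_nat d * v (n + 1) ^ (d - 1)) (at (v (n + 1)))"
      by (auto intro!: derivative_eq_intros)
    ultimately show "((\<lambda>z. eval_poly ?P (v(n + 1 := z))) has_field_derivative of_nat d * v (n + 1) ^ (d - 1)) (at (v (n + 1)))"
      by (simp add: eval_cover_poly)
  qed
  show "smooth_hypersurface (n + 1) ?W"
    unfolding smooth_hypersurface_def
  proof (intro ballI impI)
    fix G v assume G: "G \<in> ?W" and v: "v \<in> nonzero_vecs (n + 1)"
    obtain c where c: "c \<noteq> 0" "G = Poly_Mapping.map ((*) c) ?P" using G by (auto simp: proj_form_def)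
    have "\<exists>i\<le>n + 1. poly_partial i ?P v \<noteq> 0"
    proof (cases "v (n + 1) = 0")
      case True
      have "v i = 0" if "i > n" for i using that True v by (cases "i = n + 1") (auto simp: nonzero_vecs_def)
      moreover have "\<exists>i\<le>n. v i \<noteq> 0" using v True by (auto simp: nonzero_vecs_def le_Suc_eq)
      ultimately have "v \<in> nonzero_vecs n" by (simp add: nonzero_vecs_def)
      from smooth[OF this] obtain i where "i \<le> n" "poly_partial i s v \<noteq> 0" by blast
      then show ?thesis by (intro exI[of _ i]) (simp add: partial_s)
    next
      case False
      then have "poly_partial (n + 1) ?P v \<noteq> 0" unfolding partial_y using d by simp
      then show ?thesis by (intro exI[of _ "n + 1"] conjI order_refl)
    qed
    then show "\<exists>i\<le>n + 1. poly_partial i G v \<noteq> 0" using c by (simp add: poly_partial_map_scale)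
  qed
  define A :: "nat \<Rightarrow> nat \<Rightarrow> complex" where "A i j = (if i = j then 1 else 0)" for i j
  have lin: "lin_map n A v = (\<lambda>i. if i \<le> n then v i else 0)" for v
    unfolding lin_map_def A_def by (rule ext) (auto simp: if_distrib[of "\<lambda>x. x * _"] cong: if_cong)
  have "linear_projection n A"
    unfolding linear_projection_def
  proof
    fix w assume w: "w \<in> nonzero_vecs n"
    show "\<exists>v\<in>nonzero_vecs (n + 1). lin_map n A v = w"
    proof (rule bexI[of _ w])
      show "lin_map n A w = w" unfolding lin using w by (auto simp: nonzero_vecs_def)
      show "w \<in> nonzero_vecs (n + 1)" using w by (auto simp: nonzero_vecs_def intro: le_SucI)
    qed
  qed
  moreover have "cyclic_cover n d A (zero_locus (n + 1) ?W)"
    unfolding cyclic_cover_def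
  proof (intro exI bexI conjI)
    let ?t = "\<lambda>j. if j = n + 1 then 1 else (0::complex)"
    have t: "(\<Sum>j\<le>n + 1. ?t j * v j) = v (n + 1)" for v
      by (simp add: if_distrib[of "\<lambda>x. x * _"] cong: if_cong)
    have evs: "eval_poly s (lin_map n A v) = eval_poly s v" for v
      by (rule eval_poly_cong[OF s]) (simp add: lin)
    show "s \<in> forms n d - {0}"
    proof -
      have "(\<lambda>i. if i = 0 then 1 else 0) \<in> nonzero_vecs n" by (auto simp: nonzero_vecs_def)
      from smooth[OF this] have "s \<noteq> 0" by (auto simp: poly_partial_zero)
      with s show ?thesis by simp
    qed
    show "\<forall>v\<in>nonzero_vecs (n + 1). lin_map n A v = (\<lambda>_. 0) \<longrightarrow> (\<Sum>j\<le>n + 1. ?t j * v j) \<noteq> 0"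
    proof (intro ballI impI)
      fix v assume v: "v \<in> nonzero_vecs (n + 1)" and l0: "lin_map n A v = (\<lambda>_. 0)"
      have "v i = 0" if "i \<le> n" for i using fun_cong[OF l0, of i] that by (simp add: lin)
      then show "(\<Sum>j\<le>n + 1. ?t j * v j) \<noteq> 0" unfolding t using v by (auto simp: nonzero_vecs_def le_Suc_eq)
    qed
    show "zero_locus (n + 1) ?W = {proj_point v | v. v \<in> nonzero_vecs (n + 1) \<and>
               (\<Sum>j\<le>n + 1. ?t j * v j) ^ d = eval_poly s (lin_map n A v)}"
    proof -
      have *: "(\<forall>F\<in>?W. eval_poly F v = 0) \<longleftrightarrow> v (n + 1) ^ d = eval_poly s v" for v
      proof
        assume "\<forall>F\<in>?W. eval_poly F v = 0"
        moreover have "Poly_Mapping.map ((*) 1) ?P \<in> ?W" by (rule map_one_mem_proj_form)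
        ultimately have "eval_poly (Poly_Mapping.map ((*) 1) ?P) v = 0" by blast
        then show "v (n + 1) ^ d = eval_poly s v" by (simp add: eval_cover_poly)
      qed (auto simp: proj_form_def eval_cover_poly)
      show ?thesis unfolding zero_locus_def t evs * ..
    qed
  qed
  ultimately show "\<exists>A. linear_projection n A \<and> cyclic_cover n d A (zero_locus (n + 1) ?W)" by blast
qed

definition fermat_poly :: "nat \<Rightarrow> nat \<Rightarrow> cpoly" where
  "fermat_poly n d = (\<Sum>i\<le>n. var_poly i ^ d)"

lemma eval_fermat_poly [simp]: "eval_poly (fermat_poly n d) v = (\<Sum>i\<le>n. v i ^ d)"
  by (simp add: fermat_poly_def)

lemma fermat_poly_forms: "fermat_poly n d \<in> forms n d"
  unfolding fermat_poly_def
proof (rule forms_sum)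
  fix i assume "i \<in> {..n}"
  then show "var_poly i ^ d \<in> forms n d" using forms_power[OF forms_var[of i n], of d] by simp
qed

lemma poly_partial_fermat: "i \<le> n \<Longrightarrow> poly_partial i (fermat_poly n d) v = of_nat d * v i ^ (d - 1)"
proof (rule poly_partialI)
  assume i: "i \<le> n"
  have eq: "eval_poly (fermat_poly n d) (v(i := z)) = z ^ d + (\<Sum>j\<in>{..n}-{i}. v j ^ d)" for z
    using i by (simp add: sum.remove[of "{..n}" i])
  show "((\<lambda>z. eval_poly (fermat_poly n d) (v(i := z))) has_field_derivative of_nat d * v i ^ (d - 1)) (at (v i))"
    unfolding eq by (auto intro!: derivative_eq_intros)
qed

lemma poly_partial_add: "poly_partial i (F + G) v = poly_partial i F v + poly_partial i G v"
  by (rule poly_partialI) (use DERIV_add[OF eval_poly_has_partial[of F v i] eval_poly_has_partial[of G v i]] in simp)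

lemma poly_partial_const_mult: "poly_partial i (const_poly c * F) v = c * poly_partial i F v"
  by (rule poly_partialI) (use DERIV_cmult[OF eval_poly_has_partial[of F v i], of c] in simp)

subsection \<open>Low degree\<close>

lemma mono_deg_Suc:
  assumes "mono_deg m = Suc d"
  obtains i m' where "m = Poly_Mapping.single i 1 + m'" "mono_deg m' = d"
proof -
  have "Poly_Mapping.keys m \<noteq> {}" using assms by (auto simp: mono_deg_def)
  then obtain i where i: "i \<in> Poly_Mapping.keys m" by blast
  define m' where "m' = m - Poly_Mapping.single i 1"
  have m: "m = Poly_Mapping.single i 1 + m'"
    by (rule poly_mapping_eqI) (use i in \<open>auto simp: m'_def lookup_add lookup_minus lookup_single when_def in_keys_iff\<close>)
  have "mono_deg (Poly_Mapping.single i 1) = 1" by (simp add: mono_deg_def)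
  then have "mono_deg m' = d" using assms m mono_deg_add[of "Poly_Mapping.single i 1" m'] by simp
  with m show thesis by (rule that)
qed

lemma mono_deg_0: "mono_deg m = 0 \<Longrightarrow> m = 0"
  by (rule poly_mapping_eqI) (auto simp: mono_deg_def in_keys_iff)

lemma mono_val_single_1 [simp]: "mono_val (Poly_Mapping.single i (Suc 0)) v = v i"
  by (simp add: mono_val_def)

lemma quadratic_form_polarization:
  assumes G: "G \<in> forms n 2"
  shows "\<exists>B. (\<forall>x y. eval_poly G (\<lambda>i. x i + y i) = eval_poly G x + eval_poly G y + B x y) \<and>
    (\<forall>c x y. B (\<lambda>i. c * x i) y = c * B x y) \<and> (\<forall>c x y. B x (\<lambda>i. c * y i) = c * B x y) \<and>
    (\<forall>x y z. B x (\<lambda>i. y i + z i) = B x y + B x z)"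
proof -
  have "\<exists>i j. \<forall>v. mono_val m v = v i * v j" if m: "m \<in> Poly_Mapping.keys G" for m
  proof -
    have "mono_deg m = Suc 1" using G m by (simp add: forms_iff)
    then obtain i m1 where m1: "m = Poly_Mapping.single i 1 + m1" "mono_deg m1 = 1" by (rule mono_deg_Suc)
    from m1(2) have "mono_deg m1 = Suc 0" by simp
    then obtain j m2 where m2: "m1 = Poly_Mapping.single j 1 + m2" "mono_deg m2 = 0" by (rule mono_deg_Suc)
    have "mono_val m v = v i * v j" for v
      unfolding m1(1) m2(1) mono_deg_0[OF m2(2)] mono_val_add by simp
    then show ?thesis by blast
  qed
  then obtain I J where IJ: "\<And>m v. m \<in> Poly_Mapping.keys G \<Longrightarrow> mono_val m v = v (I m) * v (J m)" by metis
  have ev: "eval_poly G v = (\<Sum>m\<in>Poly_Mapping.keys G. Poly_Mapping.lookup G m * (v (I m) * v (J m)))" for v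
    unfolding eval_poly_altdef by (intro sum.cong refl) (simp add: IJ)
  define B where "B x y = (\<Sum>m\<in>Poly_Mapping.keys G. Poly_Mapping.lookup G m * (x (I m) * y (J m) + y (I m) * x (J m)))" for x y
  show ?thesis
  proof (rule exI[of _ B], intro conjI allI)
    show "eval_poly G (\<lambda>i. x i + y i) = eval_poly G x + eval_poly G y + B x y" for x y
      unfolding ev B_def sum.distrib[symmetric] by (intro sum.cong refl) (simp add: algebra_simps)
    show "B (\<lambda>i. c * x i) y = c * B x y" "B x (\<lambda>i. c * y i) = c * B x y" for c x y
      unfolding B_def sum_distrib_left by (intro sum.cong refl; simp add: algebra_simps)+
    show "B x (\<lambda>i. y i + z i) = B x y + B x z" for x y z
      unfolding B_def sum.distrib[symmetric] by (intro sum.cong refl) (simp add: algebra_simps)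
  qed
qed

lemma binary_quadratic_zero:
  fixes \<alpha> \<beta> \<gamma> :: complex
  obtains r t where "\<alpha> * r\<^sup>2 + \<beta> * (r * t) + \<gamma> * t\<^sup>2 = 0" "r \<noteq> 0 \<or> t \<noteq> 0"
proof (cases "\<alpha> = 0")
  case True
  then show thesis by (intro that[of 1 0]) auto
next
  case False
  define s where "s = csqrt (\<beta>\<^sup>2 - 4 * \<alpha> * \<gamma>)"
  define r where "r = (s - \<beta>) / (2 * \<alpha>)"
  have s: "s\<^sup>2 = \<beta>\<^sup>2 - 4 * \<alpha> * \<gamma>" by (simp add: s_def)
  have r: "2 * \<alpha> * r = s - \<beta>" using False by (simp add: r_def)
  have "4 * \<alpha> * (\<alpha> * r\<^sup>2 + \<beta> * r + \<gamma>) = (2 * \<alpha> * r)\<^sup>2 + 2 * \<beta> * (2 * \<alpha> * r) + 4 * \<alpha> * \<gamma>"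
    by (simp add: power2_eq_square algebra_simps)
  also have "\<dots> = s\<^sup>2 - \<beta>\<^sup>2 + 4 * \<alpha> * \<gamma>" unfolding r by (simp add: power2_eq_square algebra_simps)
  also have "\<dots> = 0" by (simp add: s)
  finally have "\<alpha> * r\<^sup>2 + \<beta> * r + \<gamma> = 0" using False by simp
  then show thesis by (intro that[of r 1]) auto
qed

text \<open>In the plane of the first three coordinates, take a point P of the conic on a coordinate
  line and write G(u P + r e_q + t e_2) = u (\<beta> r + \<gamma> t) + Q2(r, t). If the linear form
  is nonzero, normalising it to 1 and solving for u gives a polynomial curve, as in stereographic
  projection. Otherwise the conic is a cone with vertex P, and the line joining P to a zero of Q2
  lies in it.\<close>

lemma quadric_not_hyperbolic:
  assumes G: "G \<in> forms n 2" and n: "n \<ge> 2"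
    and X: "\<And>v. v \<in> nonzero_vecs n \<Longrightarrow> eval_poly G v = 0 \<Longrightarrow> proj_point v \<in> X"
  shows "\<not> brody_hyperbolic n X"
proof -
  obtain B where "(\<forall>x y. eval_poly G (\<lambda>i. x i + y i) = eval_poly G x + eval_poly G y + B x y) \<and>
    (\<forall>c x y. B (\<lambda>i. c * x i) y = c * B x y) \<and> (\<forall>c x y. B x (\<lambda>i. c * y i) = c * B x y) \<and>
    (\<forall>x y z. B x (\<lambda>i. y i + z i) = B x y + B x z)"
    using quadratic_form_polarization[OF G] by (rule exE)
  then have pol: "\<And>x y. eval_poly G (\<lambda>i. x i + y i) = eval_poly G x + eval_poly G y + B x y"
    and B: "\<And>c x y. B (\<lambda>i. c * x i) y = c * B x y" "\<And>c x y. B x (\<lambda>i. c * y i) = c * B x y"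
    "\<And>x y z. B x (\<lambda>i. y i + z i) = B x y + B x z"
    by simp_all
  define e :: "nat \<Rightarrow> cvec" where "e i = (\<lambda>l. if l = i then 1 else 0)" for i
  have Qsum: "eval_poly G (\<lambda>l. r * x l + t * y l) = r\<^sup>2 * eval_poly G x + r * t * B x y + t\<^sup>2 * eval_poly G y" for r t x y
    by (simp add: pol[of "\<lambda>l. r * x l" "\<lambda>l. t * y l"] B eval_poly_scale[OF G])
  obtain a0 a1 where a: "eval_poly G (e 0) * a0\<^sup>2 + B (e 0) (e 1) * (a0 * a1) + eval_poly G (e 1) * a1\<^sup>2 = 0" "a0 \<noteq> 0 \<or> a1 \<noteq> 0"
    by (rule binary_quadratic_zero)
  define P where "P = (\<lambda>l. a0 * e 0 l + a1 * e 1 l)"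
  have QP: "eval_poly G P = 0" unfolding P_def Qsum using a(1) by (simp add: mult_ac)
  \<comment> \<open>P lies on the line through e_0 and e_1 and has nonzero p-th coordinate, so P,
    e_q and e_2 span the plane.\<close>
  define p :: nat where "p = (if a0 \<noteq> 0 then 0 else 1)"
  define q :: nat where "q = 1 - p"
  have pq: "p \<noteq> q" "p < 2" "q < 2" "P p \<noteq> 0" using a(2) by (auto simp: p_def q_def P_def e_def)
  define \<beta> where "\<beta> = B P (e q)"
  define \<gamma> where "\<gamma> = B P (e 2)"
  define Q2 where "Q2 r t = r\<^sup>2 * eval_poly G (e q) + r * t * B (e q) (e 2) + t\<^sup>2 * eval_poly G (e 2)" for r t
  define V where "V u r t = (\<lambda>l. u * P l + (r * e q l + t * e 2 l))" for u r t
  have QV: "eval_poly G (V u r t) = u * (r * \<beta> + t * \<gamma>) + Q2 r t" for u r t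
    unfolding V_def pol[of "\<lambda>l. u * P l" "\<lambda>l. r * e q l + t * e 2 l"] Qsum eval_poly_scale[OF G] B QP
    by (simp add: Q2_def \<beta>_def \<gamma>_def algebra_simps)
  have Vp: "V u r t p = u * P p" "V u r t q = u * P q + r" "V u r t 2 = t" for u r t
    using pq by (auto simp: V_def e_def P_def)
  have V0: "V u r t \<in> nonzero_vecs n" if "u \<noteq> 0 \<or> r \<noteq> 0 \<or> t \<noteq> 0" for u r t
  proof -
    have "V u r t p \<noteq> 0 \<or> V u r t q \<noteq> 0 \<or> V u r t 2 \<noteq> 0" unfolding Vp using that pq(4) by auto
    then have "\<exists>l\<le>n. V u r t l \<noteq> 0" using pq(2,3) n by (meson less_imp_le order_trans order_refl)
    moreover have "V u r t l = 0" if "l > n" for l using that n pq(3) by (auto simp: V_def e_def P_def)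
    ultimately show ?thesis by (simp add: nonzero_vecs_def)
  qed
  have main: "\<not> brody_hyperbolic n X"
    if u: "u holomorphic_on UNIV" and r: "r holomorphic_on UNIV" and t: "t holomorphic_on UNIV"
      and nz: "\<And>z. u z \<noteq> 0 \<or> r z \<noteq> 0 \<or> t z \<noteq> 0"
      and eq: "\<And>z. u z * (r z * \<beta> + t z * \<gamma>) + Q2 (r z) (t z) = 0"
      and np: "\<And>k. k \<noteq> 0 \<Longrightarrow> u 1 = k * u 0 \<Longrightarrow> r 1 = k * r 0 \<Longrightarrow> t 1 = k * t 0 \<Longrightarrow> False" for u r t
  proof (rule not_brody_hyperbolicI[of n "\<lambda>z. V (u z) (r z) (t z)" X 1 0])
    show "entire_curve n (\<lambda>z. V (u z) (r z) (t z))"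
    proof
      show "(\<lambda>z. V (u z) (r z) (t z) i) holomorphic_on UNIV" for i
        unfolding V_def by (intro holomorphic_intros u r t)
      show "V (u z) (r z) (t z) \<in> nonzero_vecs n" for z by (rule V0[OF nz])
    qed
    show "proj_point (V (u z) (r z) (t z)) \<in> X" for z
      by (rule X[OF V0[OF nz]]) (simp add: QV eq)
    show "proj_point (V (u 1) (r 1) (t 1)) \<noteq> proj_point (V (u 0) (r 0) (t 0))"
    proof
      assume "proj_point (V (u 1) (r 1) (t 1)) = proj_point (V (u 0) (r 0) (t 0))"
      then obtain k where k: "k \<noteq> 0 \<and> V (u 1) (r 1) (t 1) = (\<lambda>l. k * V (u 0) (r 0) (t 0) l)"
        unfolding proj_point_eq_iff by (rule exE)
      then have *: "V (u 1) (r 1) (t 1) l = k * V (u 0) (r 0) (t 0) l" for l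
        using fun_cong[of "V (u 1) (r 1) (t 1)" "\<lambda>l. k * V (u 0) (r 0) (t 0) l" l] by simp
      have "u 1 = k * u 0" using *[of p] pq(4) unfolding Vp by simp
      moreover have "t 1 = k * t 0" using *[of 2] unfolding Vp .
      moreover have "r 1 = k * r 0" using *[of q] calculation(1) unfolding Vp by (simp add: algebra_simps)
      ultimately show False using np k by blast
    qed
  qed
  show ?thesis
  proof (cases "\<beta> = 0")
    case False
    have nz: "(1 - \<gamma> * z) / \<beta> \<noteq> 0 \<or> z \<noteq> 0" for z using False by (cases "z = 0") auto
    show ?thesis
    proof (rule main[of "\<lambda>z. - Q2 ((1 - \<gamma> * z) / \<beta>) z" "\<lambda>z. (1 - \<gamma> * z) / \<beta>" "\<lambda>z. z"])
      show "- Q2 ((1 - \<gamma> * z) / \<beta>) z \<noteq> 0 \<or> (1 - \<gamma> * z) / \<beta> \<noteq> 0 \<or> z \<noteq> 0" for z using nz by blast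
      show "- Q2 ((1 - \<gamma> * z) / \<beta>) z * ((1 - \<gamma> * z) / \<beta> * \<beta> + z * \<gamma>) + Q2 ((1 - \<gamma> * z) / \<beta>) z = 0" for z
      proof -
        have "(1 - \<gamma> * z) / \<beta> * \<beta> + z * \<gamma> = 1" using False by simp
        then show ?thesis by (simp only: mult_1_right add.left_inverse)
      qed
    qed (use False in \<open>auto simp: Q2_def intro!: holomorphic_intros\<close>)
  next
    case b0: True
    show ?thesis
    proof (cases "\<gamma> = 0")
      case False
      show ?thesis
      proof (rule main[of "\<lambda>z. - Q2 z (1 / \<gamma>)" "\<lambda>z. z" "\<lambda>z. 1 / \<gamma>"])
        show "- Q2 z (1 / \<gamma>) * (z * \<beta> + 1 / \<gamma> * \<gamma>) + Q2 z (1 / \<gamma>) = 0" for z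
          using False b0 by simp
      qed (use False in \<open>auto simp: Q2_def intro!: holomorphic_intros\<close>)
    next
      case True
      obtain r t where rt: "eval_poly G (e q) * r\<^sup>2 + B (e q) (e 2) * (r * t) + eval_poly G (e 2) * t\<^sup>2 = 0" "r \<noteq> 0 \<or> t \<noteq> 0"
        by (rule binary_quadratic_zero)
      have Q0: "Q2 r t = 0" using rt(1) by (simp add: Q2_def mult_ac)
      show ?thesis
      proof (rule main[of "\<lambda>z. z" "\<lambda>z. r" "\<lambda>z. t"])
        fix k :: complex assume k: "k \<noteq> 0" "1 = k * 0"
        then show False by simp
      qed (use rt b0 True Q0 in \<open>auto intro!: holomorphic_intros\<close>)
    qed
  qed
qed

lemma hyperbolic_hypersurface_degree:
  assumes F: "F \<in> forms n k" and k: "k > 0" and n: "n \<ge> 2"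
    and hyp: "brody_hyperbolic n (zero_locus n (proj_form F))"
  shows "k \<ge> 3"
proof (rule ccontr)
  assume "\<not> k \<ge> 3"
  then have k12: "k = 1 \<or> k = 2" using k by auto
  \<comment> \<open>A hyperplane is treated as the quadric F^2, which has the same zeros.\<close>
  define p where "p = 2 div k"
  have p: "k * p = 2" "p > 0" using k12 by (auto simp: p_def)
  have "F ^ p \<in> forms n 2" using forms_power[OF F, of p] p by simp
  then have "\<not> brody_hyperbolic n (zero_locus n (proj_form F))"
  proof (rule quadric_not_hyperbolic[OF _ n])
    fix v assume v: "v \<in> nonzero_vecs n" and "eval_poly (F ^ p) v = 0"
    then have "eval_poly F v = 0" using p by simp
    then show "proj_point v \<in> zero_locus n (proj_form F)" using mem_zero_locus_iff[OF F v] by simp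
  qed
  with hyp show False by blast
qed

section \<open>The complement of a point in the projective line\<close>

lemma linear_form_eval:
  assumes F: "F \<in> forms n 1"
  shows "eval_poly F (\<lambda>i. x i + c * y i) = eval_poly F x + c * eval_poly F y"
proof -
  have "mono_val m (\<lambda>i. x i + c * y i) = mono_val m x + c * mono_val m y" if "m \<in> Poly_Mapping.keys F" for m
  proof -
    have "mono_deg m = Suc 0" using F that by (simp add: forms_iff)
    then obtain i m' where m: "m = Poly_Mapping.single i 1 + m'" "mono_deg m' = 0" by (rule mono_deg_Suc)
    show ?thesis unfolding m(1) mono_deg_0[OF m(2)] by simp
  qed
  then have "eval_poly F (\<lambda>i. x i + c * y i) = (\<Sum>m\<in>Poly_Mapping.keys F. Poly_Mapping.lookup F m * mono_val m x + c * (Poly_Mapping.lookup F m * mono_val m y))"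
    unfolding eval_poly_altdef by (intro sum.cong refl) (simp add: algebra_simps)
  then show ?thesis by (simp add: eval_poly_altdef sum.distrib sum_distrib_left)
qed

lemma linear_form_nonzero:
  assumes F: "F \<in> forms n 1" "F \<noteq> 0"
  obtains i where "i \<le> n" "eval_poly F (\<lambda>l. if l = i then 1 else 0) \<noteq> 0"
proof -
  have deg1: "\<exists>i. m = Poly_Mapping.single i 1" if "m \<in> Poly_Mapping.keys F" for m
  proof -
    have "mono_deg m = Suc 0" using F that by (simp add: forms_iff)
    then obtain i m' where m: "m = Poly_Mapping.single i 1 + m'" "mono_deg m' = 0" by (rule mono_deg_Suc)
    then show ?thesis using mono_deg_0[OF m(2)] by auto
  qed
  have "Poly_Mapping.keys F \<noteq> {}"
  proof
    assume "Poly_Mapping.keys F = {}"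
    then have "F = 0" by (intro poly_mapping_eqI) (auto simp: in_keys_iff)
    with F(2) show False by simp
  qed
  then obtain m where m: "m \<in> Poly_Mapping.keys F" by blast
  then obtain i where i: "m = Poly_Mapping.single i 1" using deg1 by blast
  let ?e = "\<lambda>l. if l = i then 1 else (0::complex)"
  have "eval_poly F ?e = (\<Sum>m'\<in>Poly_Mapping.keys F. if m' = m then Poly_Mapping.lookup F m else 0)"
    unfolding eval_poly_altdef
  proof (rule sum.cong[OF refl])
    fix m' assume "m' \<in> Poly_Mapping.keys F"
    then obtain j where j: "m' = Poly_Mapping.single j 1" using deg1 by blast
    have "m' = m \<longleftrightarrow> j = i"
    proof
      assume "m' = m"
      then have "Poly_Mapping.lookup (Poly_Mapping.single j (1::nat)) i = Poly_Mapping.lookup (Poly_Mapping.single i 1) i" by (simp add: i j)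
      then show "j = i" by (auto simp: lookup_single when_def split: if_splits)
    qed (simp add: i j)
    moreover have "mono_val m' ?e = (if j = i then 1 else 0)" unfolding j by simp
    ultimately show "Poly_Mapping.lookup F m' * mono_val m' ?e = (if m' = m then Poly_Mapping.lookup F m else 0)"
      by (cases "j = i") simp_all
  qed
  also have "\<dots> = Poly_Mapping.lookup F m" using m by simp
  finally have "eval_poly F ?e \<noteq> 0" using m by (simp add: in_keys_iff)
  moreover have "i \<le> n" using F(1) m i by (auto simp: forms_iff)
  ultimately show thesis by (rule that[rotated])
qed

text \<open>The complement is an affine line, parametrized by z -> e_i + z w with F(e_i) \<noteq> 0
  and F(w) = 0. It contains discs of arbitrarily large radius, so two of its points have Kobayashi
  distance 0 and no neighbourhoods separate them.\<close>

lemma HE_1_1_empty: "HE 1 1 = {}"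
proof (rule ccontr)
  assume "HE 1 1 \<noteq> {}"
  then obtain X where X: "X \<in> hypersurfaces 1 1" and emb: "hyperbolically_embedded 1 (proj_space 1 - zero_locus 1 X)"
    by (auto simp: HE_def)
  obtain F where F: "F \<in> forms 1 1" "F \<noteq> 0" "X = proj_form F" by (rule hypersurfacesE[OF X])
  define Y where "Y = proj_space 1 - zero_locus 1 X"
  obtain i where i: "i \<le> 1" "eval_poly F (\<lambda>l. if l = i then 1 else 0) \<noteq> 0" by (rule linear_form_nonzero[OF F(1,2)])
  define e :: "nat \<Rightarrow> cvec" where "e j = (\<lambda>l. if l = j then 1 else 0)" for j
  define k where "k = 1 - i"
  have ki: "k \<noteq> i" "k \<le> 1" using i(1) unfolding k_def by (cases i; simp)+
  define \<alpha> where "\<alpha> = eval_poly F (e i)"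
  have \<alpha>: "\<alpha> \<noteq> 0" using i(2) by (simp add: \<alpha>_def e_def)
  define w where "w = (\<lambda>l. \<alpha> * e k l + (- eval_poly F (e k)) * e i l)"
  have Fw: "eval_poly F w = 0"
    unfolding w_def linear_form_eval[OF F(1), of "\<lambda>l. \<alpha> * e k l"] eval_poly_scale[OF F(1)] by (simp add: \<alpha>_def)
  have wk: "w k = \<alpha>" using ki by (simp add: w_def e_def)
  define g where "g z = (\<lambda>l. e i l + z * w l)" for z
  have gk: "g z k = z * \<alpha>" for z using ki wk by (simp add: g_def e_def)
  have Fg: "eval_poly F (g z) = \<alpha>" for z unfolding g_def linear_form_eval[OF F(1)] by (simp add: Fw \<alpha>_def)
  have gi0: "g 0 i = 1" by (simp add: g_def e_def)
  have gnz: "g z \<in> nonzero_vecs 1" for z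
  proof -
    have "g z l = 0" if "l > 1" for l using that i(1) ki(2) by (auto simp: g_def e_def w_def)
    moreover have "\<exists>l\<le>1. g z l \<noteq> 0"
    proof (cases "z = 0")
      case True
      then show ?thesis using i(1) gi0 by (intro exI[of _ i]) simp
    next
      case False
      then show ?thesis using gk[of z] \<alpha> ki(2) by (intro exI[of _ k]) simp
    qed
    ultimately show ?thesis unfolding nonzero_vecs_def by blast
  qed
  have gY: "proj_point (g z) \<in> Y" for z
    unfolding Y_def using gnz[of z] mem_zero_locus_iff[OF F(1) gnz, of z] Fg[of z] \<alpha> F(3) by (auto simp: proj_space_def)
  define p q where "p = proj_point (g 0)" and "q = proj_point (g 1)"
  have pq: "p \<noteq> q"
  proof
    assume "p = q"
    then have "\<exists>c. c \<noteq> 0 \<and> g 0 = (\<lambda>l. c * g 1 l)" unfolding p_def q_def proj_point_eq_iff .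
    then obtain c where "c \<noteq> 0 \<and> g 0 = (\<lambda>l. c * g 1 l)" by (rule exE)
    then have "c \<noteq> 0" "g 0 k = c * g 1 k" using fun_cong[of "g 0" "\<lambda>l. c * g 1 l" k] by simp_all
    then show False using gk \<alpha> by simp
  qed
  have cl: "Y \<subseteq> proj_topology 1 closure_of Y"
    by (rule closure_of_subset) (auto simp: topspace_proj_topology Y_def)
  then have "p \<in> proj_topology 1 closure_of Y" "q \<in> proj_topology 1 closure_of Y"
    using gY by (auto simp: p_def q_def)
  moreover from emb have "\<forall>p \<in> proj_topology 1 closure_of Y. \<forall>q \<in> proj_topology 1 closure_of Y. p \<noteq> q \<longrightarrow>
        (\<exists>U V. openin (proj_topology 1) U \<and> p \<in> U \<and> openin (proj_topology 1) V \<and> q \<in> V \<and>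
               kobayashi_setdist 1 Y (U \<inter> Y) (V \<inter> Y) > 0)"
    unfolding hyperbolically_embedded_def Y_def[symmetric] by (elim conjE)
  ultimately have "\<exists>U V. openin (proj_topology 1) U \<and> p \<in> U \<and> openin (proj_topology 1) V \<and> q \<in> V \<and>
               kobayashi_setdist 1 Y (U \<inter> Y) (V \<inter> Y) > 0" using pq by simp
  then obtain U V where U: "p \<in> U" and V: "q \<in> V" and pos: "kobayashi_setdist 1 Y (U \<inter> Y) (V \<inter> Y) > 0"
    by (elim exE conjE)
  have "kobayashi_setdist 1 Y (U \<inter> Y) (V \<inter> Y) \<le> (INF q\<in>V \<inter> Y. kobayashi_dist 1 Y p q)"
    unfolding kobayashi_setdist_def by (rule INF_lower) (use U gY in \<open>simp add: p_def\<close>)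
  also have "\<dots> \<le> kobayashi_dist 1 Y p q"
    by (rule INF_lower) (use V gY in \<open>simp add: q_def\<close>)
  finally have setle: "kobayashi_setdist 1 Y (U \<inter> Y) (V \<inter> Y) \<le> kobayashi_dist 1 Y p q" .
  \<comment> \<open>A chain of one link: the disc of radius R in the affine line, rescaled to the
    unit disc, reaches \<open>p\<close> at 0 and \<open>q\<close> at 1 / R.\<close>
  have le: "kobayashi_dist 1 Y p q \<le> ereal (poincare_dist 0 (of_real (1 / R)))" if R: "R > 1" for R :: real
    unfolding kobayashi_dist_def
  proof (rule Inf_lower, rule CollectI)
    let ?f = "\<lambda>(_::nat) z. proj_point (g (of_real R * z))"
    let ?a = "\<lambda>_::nat. 0::complex" and ?b = "\<lambda>_::nat. complex_of_real (1 / R)"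
    let ?x = "\<lambda>j::nat. if j = 0 then p else q"
    have hol: "proj_holomorphic_on 1 (\<lambda>z. proj_point (g (of_real R * z))) (ball 0 1)"
      unfolding proj_holomorphic_on_def
    proof
      fix z :: complex assume z: "z \<in> ball 0 1"
      have "(\<lambda>w. g (of_real R * w) l) holomorphic_on ball 0 1" for l
        unfolding g_def by (intro holomorphic_intros)
      then show "\<exists>U Fa. open U \<and> z \<in> U \<and> U \<subseteq> ball 0 1 \<and> (\<forall>i. (\<lambda>w. Fa w i) holomorphic_on U) \<and>
        (\<forall>w\<in>U. Fa w \<in> nonzero_vecs 1 \<and> proj_point (g (of_real R * w)) = proj_point (Fa w))"
        using z by (intro exI[of _ "ball 0 1"] exI[of _ "\<lambda>w. g (of_real R * w)"]) (simp add: gnz[simplified])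
    qed
    have Rb: "cmod (complex_of_real (1 / R)) < 1" using R by (simp add: norm_divide)
    have RR: "complex_of_real R * complex_of_real (1 / R) = 1" using R by (simp flip: of_real_mult)
    show "\<exists>(m::nat) f a b x. ereal (poincare_dist 0 (of_real (1 / R))) = ereal (\<Sum>i<m. poincare_dist (a i) (b i)) \<and>
            x 0 = p \<and> x m = q \<and>
            (\<forall>i<m. proj_holomorphic_on 1 (f i) (ball 0 1) \<and> f i ` ball 0 1 \<subseteq> Y \<and>
                   a i \<in> ball 0 1 \<and> b i \<in> ball 0 1 \<and>
                   f i (a i) = x i \<and> f i (b i) = x (Suc i))"
    proof (rule exI[of _ 1], rule exI[of _ ?f], rule exI[of _ ?a], rule exI[of _ ?b], rule exI[of _ ?x], intro conjI allI impI)
      show "?f i ` ball 0 1 \<subseteq> Y" for i using gY by auto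
      show "?b i \<in> ball 0 1" for i using Rb by simp
      show "?f i (?b i) = ?x (Suc i)" for i unfolding RR by (simp add: q_def)
    qed (use hol in \<open>auto simp: p_def\<close>)
  qed
  have lim: "((\<lambda>R. poincare_dist 0 (of_real (1 / R))) \<longlongrightarrow> 0) at_top"
  proof -
    have "((\<lambda>R::real. 2 * artanh (1 / R)) \<longlongrightarrow> 0) at_top"
    proof -
      have "((\<lambda>R::real. 1 / R) \<longlongrightarrow> 0) at_top" by real_asymp
      from tendsto_artanh[OF this] have "((\<lambda>R::real. artanh (1 / R)) \<longlongrightarrow> artanh 0) at_top" by simp
      from tendsto_mult[OF tendsto_const this, of 2] show ?thesis by simp
    qed
    moreover have "\<forall>\<^sub>F R in at_top. 2 * artanh (1 / R) = poincare_dist 0 (of_real (1 / R))"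
      using eventually_gt_at_top[of 0] by eventually_elim (simp add: poincare_dist_def norm_divide)
    ultimately show ?thesis by (rule Lim_transform_eventually)
  qed
  have "kobayashi_dist 1 Y p q \<le> ereal 0"
  proof (rule tendsto_lowerbound[of "\<lambda>R. ereal (poincare_dist 0 (of_real (1 / R)))" "ereal 0" at_top])
    show "((\<lambda>R. ereal (poincare_dist 0 (of_real (1 / R)))) \<longlongrightarrow> ereal 0) at_top" using lim by (rule tendsto_ereal)
    show "\<forall>\<^sub>F R in at_top. kobayashi_dist 1 Y p q \<le> ereal (poincare_dist 0 (of_real (1 / R)))"
      using eventually_gt_at_top[of 1] by eventually_elim (rule le)
  qed simp
  with setle pos show False by (simp add: zero_ereal_def)
qed

text \<open>The powers x_0^d and x_1^d have sum x_2^d, and the zeros of all three have order at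
  least d \<ge> 4, so \<open>sum_of_high_order_functions\<close> makes them proportional.\<close>

lemma fermat_curve_hyperbolic:
  assumes d: "d \<ge> 4"
  shows "brody_hyperbolic 2 (zero_locus 2 (proj_form (cover_poly 1 d (fermat_poly 1 d))))"
proof (rule ccontr)
  assume nh: "\<not> ?thesis"
  obtain v where v: "entire_curve 2 v" and inX: "\<And>z. proj_point (v z) \<in> zero_locus 2 (proj_form (cover_poly 1 d (fermat_poly 1 d)))"
    and nc: "\<exists>z. curve_speed 2 v z \<noteq> 0"
    using not_brody_hyperbolic_curve[OF nh] by metis
  interpret entire_curve 2 v by (rule v)
  have P: "cover_poly 1 d (fermat_poly 1 d) \<in> forms 2 d" using cover_poly_forms[OF fermat_poly_forms, of 1 d] by (simp add: numeral_2_eq_2)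
  have eq: "v z 2 ^ d = v z 0 ^ d + v z 1 ^ d" for z
    using inX[of z] unfolding mem_zero_locus_iff[OF P nz] by (simp add: eval_cover_poly numeral_2_eq_2)
  let ?a = "\<lambda>z. v z 0 ^ d" and ?b = "\<lambda>z. v z 1 ^ d"
  have nzab: "?a z \<noteq> 0 \<or> ?b z \<noteq> 0" for z
  proof (rule ccontr)
    assume "\<not> ?thesis"
    then have ab: "?a z = 0" "?b z = 0" by simp_all
    moreover have "v z 2 ^ d = 0" unfolding eq ab by simp
    ultimately have "v z 0 = 0" "v z 1 = 0" "v z 2 = 0" by simp_all
    then have "v z i = 0" if "i \<le> 2" for i using that by (auto simp: le_Suc_eq numeral_2_eq_2)
    then show False using nz[of z] by (auto simp: nonzero_vecs_def)
  qed
  have ha: "?a holomorphic_on UNIV" "?b holomorphic_on UNIV" by (intro holomorphic_intros hol)+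
  have zo: "zero_orders_ge q (\<lambda>z. v z i ^ d)" if "q \<le> d" for q i
  proof (rule zero_orders_geI[of "\<lambda>z. v z i" "\<lambda>_. 1" d _ 1])
    fix r o' :: nat assume "r * d = o' * 1" "o' > 0"
    then show "q \<le> o'" using that by (cases r) auto
  qed (auto intro: hol)
  have "zero_orders_ge 3 (\<lambda>z. ?a z + ?b z)" using zo[of 3 2] d unfolding eq by simp
  from sum_of_high_order_functions[OF ha nzab zo zo this] d
  have w: "deriv ?a z * ?b z = ?a z * deriv ?b z" for z by simp
  \<comment> \<open>Stated without division, since either power may vanish at \<open>z0\<close>; the
    two cases exchange the roles of the powers.\<close>
  have propo: "?a z * ?b z0 = ?a z0 * ?b z" for z z0
  proof (cases "?b z0 = 0")
    case False
    then show ?thesis using wronskian_zero_imp_proportional[OF ha w] by blast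
  next
    case True
    then have a0: "?a z0 \<noteq> 0" using nzab by blast
    have "?b z * ?a z0 = ?b z0 * ?a z"
      by (rule wronskian_zero_imp_proportional[OF ha(2,1) _ a0]) (metis w mult.commute)
    then show ?thesis by (simp add: mult.commute)
  qed
  have const: "proj_point (v z) = proj_point (v 0)" if i: "i \<in> {0, 1}" "v 0 i \<noteq> 0" for i z
  proof -
    have c: "\<exists>c. \<forall>z. v z j ^ d = c * v z i ^ d" if j: "j \<le> 2" for j
    proof -
      have 01: "\<exists>c. \<forall>z. v z j ^ d = c * v z i ^ d" if j: "j \<in> {0,1}" for j
      proof -
        have "v z j ^ d = v 0 j ^ d / v 0 i ^ d * v z i ^ d" for z
          using propo[of z 0] propo[of 0 z] i j by (auto simp: field_simps)
        then show ?thesis by blast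
      qed
      from 01[of 0] 01[of 1] obtain c0 c1 where "\<And>z. v z 0 ^ d = c0 * v z i ^ d" "\<And>z. v z 1 ^ d = c1 * v z i ^ d" by auto
      then have "\<And>z. v z 2 ^ d = (c0 + c1) * v z i ^ d" by (simp add: eq algebra_simps)
      then show ?thesis using 01[of 0] 01[of 1] j by (auto simp: le_Suc_eq numeral_2_eq_2)
    qed
    have "v z i \<noteq> 0" for z
    proof
      assume vi: "v z i = 0"
      obtain c0 c1 where "\<forall>z. v z 0 ^ d = c0 * v z i ^ d" "\<forall>z. v z 1 ^ d = c1 * v z i ^ d"
        using c[of 0] c[of 1] by auto
      then have "v z 0 ^ d = c0 * v z i ^ d" "v z 1 ^ d = c1 * v z i ^ d" by simp_all
      then have "v z 0 ^ d = 0" "v z 1 ^ d = 0" using vi d by (simp_all add: power_0_left)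
      then show False using nzab[of z] by blast
    qed
    then show ?thesis using constant_of_powers_proportional[of i d] c d by auto
  qed
  have "v 0 0 \<noteq> 0 \<or> v 0 1 \<noteq> 0" using nzab[of 0] d by auto
  then have pc: "proj_point (v z) = proj_point (v 0)" for z using const[of 0] const[of 1] by blast
  have "curve_speed 2 v z = 0" for z
  proof -
    have "v w i * v z j = v w j * v z i" for w i j
    proof -
      obtain k where "v w = (\<lambda>i. k * v z i)" using pc[of w] pc[of z] proj_point_eq_iff by metis
      then show ?thesis by simp
    qed
    then have "deriv (\<lambda>w. v w i * v z j) z = deriv (\<lambda>w. v w j * v z i) z" for i j by presburger
    moreover have "deriv (\<lambda>w. v w i * v z j) z = deriv (\<lambda>w. v w i) z * v z j" for i j
      by (intro DERIV_imp_deriv DERIV_cmult_right analytic_derivI an)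
    ultimately show ?thesis by (simp add: curve_speed_def mult.commute)
  qed
  with nc show False by blast
qed

subsection \<open>Deformation to the cone\<close>

text \<open>The part of the cone cover lying over one point of the base hypersurface, whose
  coordinates enter only through the constants \<sigma>. The conclusion has the form required by
  \<open>constant_of_powers_proportional\<close>.\<close>

lemma fibre_curve_constant:
  fixes c y U :: "complex \<Rightarrow> complex"
  assumes hol: "c holomorphic_on UNIV" "y holomorphic_on UNIV" "U holomorphic_on UNIV"
    and eq: "\<And>z. y z ^ (k * m) = U z ^ m + (\<Sum>i\<le>n. \<sigma> i * (c z ^ k) ^ (i + 2) * U z ^ (m - i - 2))"
    and nocom: "\<And>z. c z \<noteq> 0 \<or> y z \<noteq> 0" and cz0: "c z0 \<noteq> 0"
    and \<sigma>: "i0 \<le> n" "\<sigma> i0 \<noteq> 0" and k: "k \<ge> 3" and m: "m \<ge> n + 2"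
  shows "\<exists>\<kappa>. \<forall>z. y z ^ (k * m) = \<kappa> * c z ^ (k * m)"
proof -
  define p :: "complex poly" where "p = Polynomial.monom 1 m + (\<Sum>i\<le>n. Polynomial.monom (\<sigma> i) (m - i - 2))"
  have cp: "Polynomial.coeff p j = (if m = j then 1 else 0) + (\<Sum>i\<le>n. if m - i - 2 = j then \<sigma> i else 0)" for j
    by (simp add: p_def coeff_sum)
  have cpm: "Polynomial.coeff p m = 1" unfolding cp using m by (subst sum.neutral) auto
  \<comment> \<open>The roots have sum 0. A single root of multiplicity m would therefore be 0 and
    leave no lower coefficient, contradicting \<open>cpi\<close>.\<close>
  have cpm1: "Polynomial.coeff p (m - 1) = 0" unfolding cp using m by (subst sum.neutral) auto
  have cpi: "Polynomial.coeff p (m - i0 - 2) = \<sigma> i0"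
  proof -
    have "(\<Sum>i\<le>n. if m - i - 2 = m - i0 - 2 then \<sigma> i else 0) = (\<Sum>i\<le>n. if i = i0 then \<sigma> i0 else 0)"
      using m \<sigma>(1) by (intro sum.cong refl) auto
    then show ?thesis unfolding cp using \<sigma>(1) m by simp
  qed
  have dp: "Polynomial.degree p = m"
  proof (rule antisym)
    show "Polynomial.degree p \<le> m"
      by (rule Polynomial.degree_le) (auto simp: cp intro!: sum.neutral)
    show "m \<le> Polynomial.degree p" by (rule Polynomial.le_degree) (simp add: cpm)
  qed
  have p0: "p \<noteq> 0" using cpm by auto
  define Z where "Z = {z. poly p z = 0}"
  have finZ: "finite Z" unfolding Z_def by (rule poly_roots_finite[OF p0])
  define e where "e z = Polynomial.order z p" for z
  have pfac: "(\<Prod>z\<in>Z. [:-z, 1:] ^ e z) = p"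
    using complex_poly_decompose[of p] dp cpm by (simp add: Z_def e_def)
  have sume: "(\<Sum>z\<in>Z. e z) = m"
  proof -
    have "Polynomial.degree (\<Prod>z\<in>Z. [:-z, 1:] ^ e z) = (\<Sum>z\<in>Z. Polynomial.degree ([:-z, 1:] ^ e z))"
      by (rule degree_prod_sum_eq) simp
    also have "\<dots> = (\<Sum>z\<in>Z. e z)" by (simp add: degree_power_eq)
    finally show ?thesis using pfac dp by simp
  qed
  have epos: "e z > 0" if "z \<in> Z" for z
    using that p0 order_root[of p z] by (simp add: Z_def e_def)
  have "\<exists>\<alpha>\<in>Z. \<exists>\<beta>\<in>Z. \<alpha> \<noteq> \<beta>"
  proof (rule ccontr)
    assume single: "\<not> ?thesis"
    have "Z \<noteq> {}" using sume m by auto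
    then obtain \<alpha> where "\<alpha> \<in> Z" by blast
    with single have Z: "Z = {\<alpha>}" by blast
    then have "e \<alpha> = m" using sume by simp
    with pfac Z have pp: "p = [:-\<alpha>, 1:] ^ m" by simp
    have "Polynomial.coeff p (m - 1) = of_nat (m choose (m - 1)) * 1 ^ (m - 1) * (-\<alpha>) ^ (m - (m - 1))"
      unfolding pp by (rule coeff_linear_poly_power) simp
    also have "m - (m - 1) = 1" using m by simp
    also have "m choose (m - 1) = m" using m binomial_symmetric[of 1 m] by simp
    finally have "\<alpha> = 0" using cpm1 m by simp
    have "Polynomial.coeff p (m - i0 - 2) = of_nat (m choose (m - i0 - 2)) * 1 ^ (m - i0 - 2) * (-\<alpha>) ^ (m - (m - i0 - 2))"
      unfolding pp by (rule coeff_linear_poly_power) simp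
    also have "\<dots> = 0" using \<open>\<alpha> = 0\<close> m \<sigma>(1) by (simp add: power_0_left)
    finally show False using cpi \<sigma>(2) by simp
  qed
  then obtain \<alpha> \<beta> where ab: "\<alpha> \<in> Z" "\<beta> \<in> Z" "\<alpha> \<noteq> \<beta>" by blast
  have elt: "e \<alpha> \<le> m - 1" "e \<beta> \<le> m - 1"
  proof -
    have "e \<alpha> + e \<beta> = (\<Sum>z\<in>{\<alpha>,\<beta>}. e z)" using ab(3) by simp
    also have "\<dots> \<le> (\<Sum>z\<in>Z. e z)" using ab finZ by (intro sum_mono2) auto
    finally show "e \<alpha> \<le> m - 1" "e \<beta> \<le> m - 1" using epos[OF ab(1)] epos[OF ab(2)] sume by auto
  qed
  \<comment> \<open>The homogenization of \<open>p\<close>, so that it splits into the linear forms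
    u - z t over the roots z.\<close>
  define Ph where "Ph u t = u ^ m + (\<Sum>i\<le>n. \<sigma> i * t ^ (i + 2) * u ^ (m - i - 2))" for u t
  have Ph: "Ph u t = (\<Prod>z\<in>Z. (u - z * t) ^ e z)" for u t
  proof (cases "t = 0")
    case True
    have "(\<Prod>z\<in>Z. u ^ e z) = u ^ m" by (simp add: power_sum[symmetric] sume)
    then show ?thesis using True by (simp add: Ph_def)
  next
    case False
    have "poly p (u / t) = (u / t) ^ m + (\<Sum>i\<le>n. \<sigma> i * (u / t) ^ (m - i - 2))"
      by (simp add: p_def poly_monom poly_sum)
    then have "t ^ m * poly p (u / t) = u ^ m + (\<Sum>i\<le>n. t ^ m * (\<sigma> i * (u / t) ^ (m - i - 2)))"
      using False by (simp add: distrib_left sum_distrib_left power_divide)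
    also have "(\<Sum>i\<le>n. t ^ m * (\<sigma> i * (u / t) ^ (m - i - 2))) = (\<Sum>i\<le>n. \<sigma> i * t ^ (i + 2) * u ^ (m - i - 2))"
    proof (intro sum.cong refl)
      fix i assume "i \<in> {..n}"
      then have "(i + 2) + (m - i - 2) = m" using m by auto
      then have "t ^ m = t ^ (i + 2) * t ^ (m - i - 2)" by (metis power_add)
      then show "t ^ m * (\<sigma> i * (u / t) ^ (m - i - 2)) = \<sigma> i * t ^ (i + 2) * u ^ (m - i - 2)"
        using False by (simp add: power_divide)
    qed
    finally have "Ph u t = t ^ m * poly p (u / t)" by (simp add: Ph_def)
    also have "poly p (u / t) = (\<Prod>z\<in>Z. (u / t - z) ^ e z)"
      by (subst pfac[symmetric]) (simp add: poly_prod)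
    also have "t ^ m = (\<Prod>z\<in>Z. t ^ e z)" by (simp add: power_sum[symmetric] sume)
    also have "(\<Prod>z\<in>Z. t ^ e z) * (\<Prod>z\<in>Z. (u / t - z) ^ e z) = (\<Prod>z\<in>Z. (u - z * t) ^ e z)"
      unfolding prod.distrib[symmetric] power_mult_distrib[symmetric]
      using False by (intro prod.cong refl) (simp add: right_diff_distrib mult.commute)
    finally show ?thesis .
  qed
  define T where "T z = c z ^ k" for z
  have yPh: "y z ^ (k * m) = Ph (U z) (T z)" for z by (simp add: eq Ph_def T_def)
  have km: "k > 0" "m > 0" using k m by auto
  have TU: "T z \<noteq> 0 \<or> U z \<noteq> 0" for z
  proof (rule ccontr)
    assume "\<not> ?thesis"
    then have "y z ^ (k * m) = 0" "c z = 0" using yPh[of z] km by (auto simp: Ph_def T_def)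
    then show False using nocom[of z] by auto
  qed
  \<comment> \<open>The sign s lets one argument serve both summands, which are chosen to add up to
    (\<beta> - \<alpha>) T.\<close>
  have zo: "zero_orders_ge 4 (\<lambda>z. s * (U z - \<gamma> * T z))"
    if \<gamma>: "\<gamma> \<in> Z" "e \<gamma> \<le> m - 1" and s: "s * s = 1" for \<gamma> s
  proof (rule zero_orders_geI[of y "\<lambda>z. s ^ e \<gamma> * (\<Prod>\<zeta>\<in>Z - {\<gamma>}. (U z - \<zeta> * T z) ^ e \<zeta>)" "k * m" _ "e \<gamma>"])
    show "(\<lambda>z. s ^ e \<gamma> * (\<Prod>\<zeta>\<in>Z - {\<gamma>}. (U z - \<zeta> * T z) ^ e \<zeta>)) holomorphic_on UNIV"
      unfolding T_def by (intro holomorphic_intros hol)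
    show "y z ^ (k * m) = (s * (U z - \<gamma> * T z)) ^ e \<gamma> * (s ^ e \<gamma> * (\<Prod>\<zeta>\<in>Z - {\<gamma>}. (U z - \<zeta> * T z) ^ e \<zeta>))" for z
    proof -
      have "(s * (U z - \<gamma> * T z)) ^ e \<gamma> * s ^ e \<gamma> = (U z - \<gamma> * T z) ^ e \<gamma>"
      proof -
        have "(s * (U z - \<gamma> * T z)) ^ e \<gamma> * s ^ e \<gamma> = (s * s * (U z - \<gamma> * T z)) ^ e \<gamma>"
          by (simp only: power_mult_distrib mult_ac)
        then show ?thesis by (simp only: s mult_1_left)
      qed
      then show ?thesis unfolding yPh Ph prod.remove[OF finZ \<gamma>(1)] by (simp add: mult.assoc[symmetric])
    qed
    show "s ^ e \<gamma> * (\<Prod>\<zeta>\<in>Z - {\<gamma>}. (U z - \<zeta> * T z) ^ e \<zeta>) \<noteq> 0" if "s * (U z - \<gamma> * T z) = 0" for z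
    proof
      have s0: "s \<noteq> 0" using s by auto
      then have U\<gamma>: "U z = \<gamma> * T z" using that by simp
      assume "s ^ e \<gamma> * (\<Prod>\<zeta>\<in>Z - {\<gamma>}. (U z - \<zeta> * T z) ^ e \<zeta>) = 0"
      then obtain \<zeta> where "\<zeta> \<noteq> \<gamma>" "U z = \<zeta> * T z" using s0 finZ by auto
      then have "T z = 0" using U\<gamma> by simp
      then show False using TU[of z] U\<gamma> by simp
    qed
    show "e \<gamma> > 0" using \<gamma>(1) by (rule epos)
    fix r q assume rq: "r * (k * m) = q * e \<gamma>" "q > 0"
    \<comment> \<open>As the multiplicity of the root is below m, r k m = q e with q \<le> k would
      force r = 0; so the order exceeds k \<ge> 3.\<close>
    show "4 \<le> q"
    proof (rule ccontr)
      assume "\<not> 4 \<le> q"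
      then have "q \<le> k" using k by simp
      then have "q * e \<gamma> \<le> k * (m - 1)" using \<gamma>(2) by (rule mult_le_mono)
      also have "\<dots> < k * m" using km by simp
      finally have "r * (k * m) < 1 * (k * m)" using rq by simp
      then have "r = 0" using mult_less_cancel2 by (metis less_one)
      then show False using rq epos[OF \<gamma>(1)] by simp
    qed
  qed (rule hol)
  let ?a = "\<lambda>z. 1 * (U z - \<alpha> * T z)" and ?b = "\<lambda>z. (-1) * (U z - \<beta> * T z)"
  have c1: "?a z + ?b z = (\<beta> - \<alpha>) * T z" for z by (simp add: algebra_simps)
  have za: "zero_orders_ge 4 ?a" by (rule zo[OF ab(1) elt(1)]) simp
  have zb: "zero_orders_ge 4 ?b" by (rule zo[OF ab(2) elt(2)]) simp
  have zc: "zero_orders_ge 3 (\<lambda>z. ?a z + ?b z)"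
    unfolding c1
  proof (rule zero_orders_geI[of c "\<lambda>_. 1 / (\<beta> - \<alpha>)" k _ 1])
    show "c z ^ k = ((\<beta> - \<alpha>) * T z) ^ 1 * (1 / (\<beta> - \<alpha>))" for z using ab(3) by (simp add: T_def)
    fix r q assume "r * k = q * 1" "q > 0"
    then show "3 \<le> q" using k by (cases r) auto
  qed (use hol ab(3) in auto)
  have ha: "?a holomorphic_on UNIV" and hb: "?b holomorphic_on UNIV" and hT: "(\<lambda>z. (\<beta> - \<alpha>) * T z) holomorphic_on UNIV"
    unfolding T_def by (intro holomorphic_intros hol)+
  have nzab: "?a z \<noteq> 0 \<or> ?b z \<noteq> 0" for z
  proof (rule ccontr)
    assume n: "\<not> ?thesis"
    have "(\<beta> - \<alpha>) * T z = ?a z + ?b z" by (rule c1[symmetric])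
    also have "\<dots> = 0" using n by simp
    finally have "(\<beta> - \<alpha>) * T z = 0" .
    then have "T z = 0" using ab(3) by simp
    then show False using n TU[of z] by simp
  qed
  have w: "deriv ?a z * ?b z = ?a z * deriv ?b z" for z
    by (rule sum_of_high_order_functions[OF ha hb nzab za zb zc])
  have dsum: "deriv (\<lambda>z. (\<beta> - \<alpha>) * T z) z = deriv ?a z + deriv ?b z" for z
  proof -
    have "(\<lambda>z. (\<beta> - \<alpha>) * T z) = (\<lambda>z. ?a z + ?b z)" using c1 by (intro ext) simp
    moreover have "deriv (\<lambda>z. ?a z + ?b z) z = deriv ?a z + deriv ?b z"
      by (intro deriv_add holomorphic_on_imp_differentiable_at[OF ha] holomorphic_on_imp_differentiable_at[OF hb]) auto
    ultimately show ?thesis by simp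
  qed
  have w': "deriv ?a z * ((\<beta> - \<alpha>) * T z) = ?a z * deriv (\<lambda>z. (\<beta> - \<alpha>) * T z) z" for z
    unfolding dsum unfolding c1[symmetric] using w[of z] by (simp only: distrib_left mult.commute)
  have Tz0: "(\<beta> - \<alpha>) * T z0 \<noteq> 0" using ab(3) cz0 by (simp add: T_def)
  have pr: "?a z * ((\<beta> - \<alpha>) * T z0) = ?a z0 * ((\<beta> - \<alpha>) * T z)" for z
    by (rule wronskian_zero_imp_proportional[OF ha hT w' Tz0])
  define \<kappa> where "\<kappa> = (U z0 - \<alpha> * T z0) / T z0 + \<alpha>"
  have UT: "U z = \<kappa> * T z" for z
  proof -
    have "((U z - \<alpha> * T z) * T z0) * (\<beta> - \<alpha>) = ((U z0 - \<alpha> * T z0) * T z) * (\<beta> - \<alpha>)"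
      using pr[of z] by (simp only: mult_1 mult_ac)
    then have "(U z - \<alpha> * T z) * T z0 = (U z0 - \<alpha> * T z0) * T z" using ab(3) by simp
    then have "U z * T z0 = U z0 * T z" by (simp add: algebra_simps)
    then show ?thesis using Tz0 by (simp add: \<kappa>_def field_simps)
  qed
  have "y z ^ (k * m) = Ph \<kappa> 1 * c z ^ (k * m)" for z
  proof -
    have "Ph (\<kappa> * T z) (1 * T z) = T z ^ m * Ph \<kappa> 1"
      unfolding Ph_def distrib_left sum_distrib_left
    proof (intro arg_cong2[where f = "(+)"] sum.cong refl)
      show "(\<kappa> * T z) ^ m = T z ^ m * \<kappa> ^ m" by (simp add: power_mult_distrib mult.commute)
      fix i assume "i \<in> {..n}"
      then have "(i + 2) + (m - i - 2) = m" using m by auto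
      then have "T z ^ m = T z ^ (i + 2) * T z ^ (m - i - 2)" by (metis power_add)
      then show "\<sigma> i * (1 * T z) ^ (i + 2) * (\<kappa> * T z) ^ (m - i - 2) = T z ^ m * (\<sigma> i * 1 ^ (i + 2) * \<kappa> ^ (m - i - 2))"
        by (simp add: power_mult_distrib)
    qed
    then show ?thesis unfolding yPh UT by (simp add: T_def power_mult mult.commute)
  qed
  then show ?thesis by blast
qed

text \<open>The deformation \<open>t \<rightarrow> 0\<close> of \<open>X = {F = t u}\<close> to the cone over \<open>{F = 0}\<close>, with \<open>t = 1 / (j + 1)\<close>.\<close>

definition deformed_form :: "nat \<Rightarrow> nat \<Rightarrow> nat \<Rightarrow> cpoly \<Rightarrow> nat \<Rightarrow> cpoly" where
  "deformed_form n k m F j = (const_poly (of_nat (Suc j)) * F) ^ m +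
     (\<Sum>i\<le>n. var_poly i ^ (k * (i + 2)) * (const_poly (of_nat (Suc j)) * F) ^ (m - i - 2))"

lemma eval_deformed_form:
  "eval_poly (deformed_form n k m F j) v = (of_nat (Suc j) * eval_poly F v) ^ m +
     (\<Sum>i\<le>n. v i ^ (k * (i + 2)) * (of_nat (Suc j) * eval_poly F v) ^ (m - i - 2))"
  by (simp add: deformed_form_def del: of_nat_Suc)

text \<open>With subtraction of natural numbers the degrees add up to k m because i + 2 \<le> m for
  every i \<le> n.\<close>

lemma deformed_form_forms:
  assumes F: "F \<in> forms n k" and m: "m \<ge> n + 2"
  shows "deformed_form n k m F j \<in> forms n (k * m)"
  unfolding deformed_form_def
proof (intro forms_add forms_sum forms_power forms_cmult F)
  fix i assume i: "i \<in> {..n}"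
  have "k * (i + 2) + k * (m - i - 2) = k * (i + 2 + (m - i - 2))" by (rule distrib_left[symmetric])
  also have "i + 2 + (m - i - 2) = m" using i m by simp
  finally have deg: "1 * (k * (i + 2)) + k * (m - i - 2) = k * m" by simp
  show "var_poly i ^ (k * (i + 2)) * (const_poly (of_nat (Suc j)) * F) ^ (m - i - 2) \<in> forms n (k * m)"
    unfolding deg[symmetric] by (intro forms_mult forms_power forms_var forms_cmult F) (use i in simp)
qed

text \<open>Cauchy's bound for the roots of a monic polynomial, with u measured in units of
  \<rho>^k. If t = u / \<rho>^k exceeded 2 n + 3 = (n + 2) + (n + 1), the terms on the right, each
  at most t^(m - 1) in these units, could not add up to t^m.\<close>

lemma weighted_root_bound:
  fixes u :: real
  assumes \<rho>: "\<rho> > 0" and m: "m \<ge> n + 2" and u0: "u \<ge> 0"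
    and le: "u ^ m \<le> (real n + 2) * \<rho> ^ (k * m) + (\<Sum>i\<le>n. \<rho> ^ (k * (i + 2)) * u ^ (m - i - 2))"
  shows "u \<le> (2 * real n + 3) * \<rho> ^ k"
proof (rule ccontr)
  assume big: "\<not> ?thesis"
  define t where "t = u / \<rho> ^ k"
  have u: "u = t * \<rho> ^ k" using \<rho> by (simp add: t_def)
  have t: "t > 2 * n + 3" using big \<rho> by (simp add: t_def pos_less_divide_eq)
  then have t1: "t \<ge> 1" by simp
  have "t ^ m * \<rho> ^ (k * m) = u ^ m" by (simp add: u power_mult_distrib power_mult)
  also note le
  finally have tm: "t ^ m * \<rho> ^ (k * m) \<le> (real n + 2) * \<rho> ^ (k * m) + (\<Sum>i\<le>n. \<rho> ^ (k * (i + 2)) * u ^ (m - i - 2))" .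
  have sm: "(\<Sum>i\<le>n. \<rho> ^ (k * (i + 2)) * u ^ (m - i - 2)) \<le> (\<Sum>i\<le>n. t ^ (m - 1) * \<rho> ^ (k * m))"
  proof (rule sum_mono)
    fix i assume i: "i \<in> {..n}"
    have "k * (i + 2) + k * (m - i - 2) = k * (i + 2 + (m - i - 2))" by (rule distrib_left[symmetric])
    also have "i + 2 + (m - i - 2) = m" using i m by simp
    finally have "\<rho> ^ (k * (i + 2)) * \<rho> ^ (k * (m - i - 2)) = \<rho> ^ (k * m)" by (simp flip: power_add)
    then have "\<rho> ^ (k * (i + 2)) * u ^ (m - i - 2) = t ^ (m - i - 2) * \<rho> ^ (k * m)"
      by (simp add: u power_mult_distrib power_mult mult_ac)
    also have "\<dots> \<le> t ^ (m - 1) * \<rho> ^ (k * m)"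
      using t1 \<rho> by (intro mult_right_mono power_increasing) auto
    finally show "\<rho> ^ (k * (i + 2)) * u ^ (m - i - 2) \<le> t ^ (m - 1) * \<rho> ^ (k * m)" .
  qed
  have "(real n + 2) * \<rho> ^ (k * m) \<le> (real n + 2) * (t ^ (m - 1) * \<rho> ^ (k * m))"
    using t1 \<rho> one_le_power[OF t1, of "m - 1"] by (intro mult_left_mono) auto
  with tm sm have "t ^ m * \<rho> ^ (k * m) \<le> (real n + 2) * (t ^ (m - 1) * \<rho> ^ (k * m)) + (\<Sum>i\<le>n. t ^ (m - 1) * \<rho> ^ (k * m))"
    by linarith
  also have "\<dots> = ((2 * real n + 3) * t ^ (m - 1)) * \<rho> ^ (k * m)" by (simp add: algebra_simps)
  finally have "t ^ m \<le> (2 * real n + 3) * t ^ (m - 1)" using \<rho> by simp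
  moreover have "t ^ m = t * t ^ (m - 1)" using m by (cases m) auto
  ultimately have "t \<le> 2 * n + 3" using t1 by simp
  with t show False by simp
qed

lemma hyperbolic_cyclic_cover_exists:
  assumes n: "n \<ge> 2" and k: "k \<ge> 3" and m: "m \<ge> n + 2" and F: "F \<in> forms n k"
    and hyp: "brody_hyperbolic n (zero_locus n (proj_form F))"
  shows "\<exists>W \<in> hypersurfaces (n + 1) (k * m).
           smooth_hypersurface (n + 1) W \<and>
           brody_hyperbolic (n + 1) (zero_locus (n + 1) W) \<and>
           (\<exists>A. linear_projection n A \<and> cyclic_cover n (k * m) A (zero_locus (n + 1) W))"
proof (rule ccontr)
  assume none: "\<not> ?thesis"
  define d where "d = k * m"
  have d2: "d \<ge> 2" "d > 0"
  proof -
    have "3 * 1 \<le> k * m" by (rule mult_le_mono) (use k m in auto)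
    then have "3 \<le> d" by (simp only: d_def mult_1_right)
    then show "d \<ge> 2" "d > 0" by simp_all
  qed
  define G where "G j = deformed_form n k m F j" for j
  have Gf: "G j \<in> forms n d" for j unfolding G_def d_def by (rule deformed_form_forms[OF F m])
  \<comment> \<open>The singular parameters are finite in number, so a smooth choice exists in every
    interval (0, 1 / (j + 1)), which also makes the parameters tend to 0.\<close>
  have "\<exists>\<epsilon>::real. 0 < \<epsilon> \<and> \<epsilon> < 1 / real (Suc j) \<and>
      (\<forall>v\<in>nonzero_vecs n. \<exists>i\<le>n. poly_partial i (G j) v + of_real \<epsilon> * of_nat d * v i ^ (d - 1) \<noteq> 0)" for j
  proof -
    let ?E = "{\<epsilon>. \<exists>v\<in>nonzero_vecs n. \<forall>i\<le>n. poly_partial i (G j) v + \<epsilon> * of_nat d * v i ^ (d - 1) = 0}"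
    have "finite ?E" by (rule finite_singular_parameters[OF Gf d2(2)])
    then have "finite (complex_of_real -` ?E)" by (rule finite_vimageI) (simp add: inj_def)
    moreover have "infinite {0<..<1 / real (Suc j)}" by (rule infinite_Ioo) simp
    ultimately have "{0<..<1 / real (Suc j)} - complex_of_real -` ?E \<noteq> {}"
      by (intro infinite_imp_nonempty Diff_infinite_finite)
    then obtain \<epsilon> where \<epsilon>: "\<epsilon> \<in> {0<..<1 / real (Suc j)} - complex_of_real -` ?E"
      unfolding ex_in_conv[symmetric] by (rule exE)
    then have "\<not> (\<exists>v\<in>nonzero_vecs n. \<forall>i\<le>n. poly_partial i (G j) v + of_real \<epsilon> * of_nat d * v i ^ (d - 1) = 0)"
      by (simp only: Diff_iff vimage_eq mem_Collect_eq) simp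
    then show ?thesis using \<epsilon> by (intro exI[of _ \<epsilon>]) simp
  qed
  then have "\<forall>j. \<exists>\<epsilon>::real. 0 < \<epsilon> \<and> \<epsilon> < 1 / real (Suc j) \<and>
      (\<forall>v\<in>nonzero_vecs n. \<exists>i\<le>n. poly_partial i (G j) v + of_real \<epsilon> * of_nat d * v i ^ (d - 1) \<noteq> 0)" by (rule allI)
  from choice[OF this] obtain \<epsilon> :: "nat \<Rightarrow> real" where "\<forall>j. 0 < \<epsilon> j \<and> \<epsilon> j < 1 / real (Suc j) \<and>
      (\<forall>v\<in>nonzero_vecs n. \<exists>i\<le>n. poly_partial i (G j) v + of_real (\<epsilon> j) * of_nat d * v i ^ (d - 1) \<noteq> 0)"
    by (rule exE)
  then have \<epsilon>: "0 < \<epsilon> j" "\<epsilon> j < 1 / real (Suc j)"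
    "v \<in> nonzero_vecs n \<Longrightarrow> \<exists>i\<le>n. poly_partial i (G j) v + of_real (\<epsilon> j) * of_nat d * v i ^ (d - 1) \<noteq> 0" for j v
    by simp_all
  define s where "s j = G j + const_poly (of_real (\<epsilon> j)) * fermat_poly n d" for j
  have sf: "s j \<in> forms n d" for j unfolding s_def by (intro forms_add forms_cmult Gf fermat_poly_forms)
  have smooth: "\<exists>i\<le>n. poly_partial i (s j) v \<noteq> 0" if v: "v \<in> nonzero_vecs n" for j v
  proof -
    obtain i where i: "i \<le> n" "poly_partial i (G j) v + of_real (\<epsilon> j) * of_nat d * v i ^ (d - 1) \<noteq> 0" using \<epsilon>(3)[OF v] by blast
    then show ?thesis unfolding s_def poly_partial_add poly_partial_const_mult
      by (intro exI[of _ i]) (simp add: poly_partial_fermat mult.assoc)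
  qed
  let ?X = "\<lambda>j. zero_locus (n + 1) (proj_form (cover_poly n d (s j)))"
  have nh: "\<not> brody_hyperbolic (n + 1) (?X j)" for j
    using cyclic_hypersurface[OF sf d2(1) smooth] none unfolding d_def by blast
  have "\<exists>v. entire_curve (n + 1) v \<and> (\<forall>z. proj_point (v z) \<in> ?X j) \<and> (\<exists>z. curve_speed (n + 1) v z \<noteq> 0)" for j
  proof (rule not_brody_hyperbolic_curve[OF nh[of j]])
    fix v assume "entire_curve (n + 1) v" "\<And>z. proj_point (v z) \<in> ?X j" "\<exists>z. curve_speed (n + 1) v z \<noteq> 0"
    then show ?thesis by (intro exI[of _ v] conjI allI)
  qed
  then have "\<forall>j. \<exists>v. entire_curve (n + 1) v \<and> (\<forall>z. proj_point (v z) \<in> ?X j) \<and> (\<exists>z. curve_speed (n + 1) v z \<noteq> 0)"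
    by (rule allI)
  from choice[OF this] obtain v where v: "\<forall>j. entire_curve (n + 1) (v j) \<and> (\<forall>z. proj_point (v j z) \<in> ?X j) \<and> (\<exists>z. curve_speed (n + 1) (v j) z \<noteq> 0)"
    by (rule exE)
  have vc: "entire_curve (n + 1) (v j)" and vX: "proj_point (v j z) \<in> ?X j" and vs: "\<exists>z. curve_speed (n + 1) (v j) z \<noteq> 0" for j z
    using v by simp_all
  define u where "u j z = of_nat (Suc j) * eval_poly F (v j z)" for j z
  have veq: "v j z (n + 1) ^ d = u j z ^ m + (\<Sum>i\<le>n. v j z i ^ (k * (i + 2)) * u j z ^ (m - i - 2)) + of_real (\<epsilon> j) * (\<Sum>i\<le>n. v j z i ^ d)" for j z
    using vX[of j z] unfolding mem_zero_locus_iff[OF cover_poly_forms[OF sf] entire_curve.nz[OF vc]]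
    by (simp add: eval_cover_poly s_def G_def eval_deformed_form u_def del: of_nat_Suc)
  have uhol: "u j holomorphic_on UNIV" for j
    unfolding u_def by (intro holomorphic_intros eval_poly_holomorphic entire_curve.hol[OF vc])
  \<comment> \<open>With all coordinates bounded by \<rho>, the equation becomes a monic polynomial
    inequality for |u|. The constant n + 2 counts the term y^d and the n + 1 summands of the Fermat
    form, whose factor \<epsilon> is below 1.\<close>
  have ub: "\<exists>B. \<forall>j z i. i \<le> n + 1 \<longrightarrow> v j z i \<noteq> 0 \<longrightarrow> (\<forall>a\<le>n + 1. cmod (v j z a) \<le> M * cmod (v j z i)) \<longrightarrow>
        cmod (u j z) \<le> B * cmod (v j z i) ^ k" for M
  proof (intro exI[of _ "(2 * real n + 3) * M ^ k"] allI impI)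
    fix j z i assume i: "i \<le> n + 1" "v j z i \<noteq> 0" and M: "\<forall>a\<le>n + 1. cmod (v j z a) \<le> M * cmod (v j z i)"
    define \<rho> where "\<rho> = M * cmod (v j z i)"
    have \<rho>: "\<rho> > 0"
    proof -
      have "0 < cmod (v j z i)" using i by simp
      also have "\<dots> \<le> \<rho>" using M i(1) by (simp add: \<rho>_def)
      finally show ?thesis .
    qed
    have va: "cmod (v j z a) ^ l \<le> \<rho> ^ l" if "a \<le> n + 1" for a l using M that by (intro power_mono) (auto simp: \<rho>_def)
    have "cmod (u j z) ^ m = cmod (v j z (n + 1) ^ d - (\<Sum>i\<le>n. v j z i ^ (k * (i + 2)) * u j z ^ (m - i - 2)) - of_real (\<epsilon> j) * (\<Sum>i\<le>n. v j z i ^ d))"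
      unfolding veq norm_power[symmetric] by (simp add: algebra_simps)
    also have "\<dots> \<le> cmod (v j z (n + 1) ^ d) + cmod (\<Sum>i\<le>n. v j z i ^ (k * (i + 2)) * u j z ^ (m - i - 2)) + cmod (of_real (\<epsilon> j) * (\<Sum>i\<le>n. v j z i ^ d))"
      by (intro order_trans[OF norm_triangle_ineq4] add_right_mono norm_triangle_ineq4)
    also have "\<dots> \<le> \<rho> ^ d + (\<Sum>i\<le>n. \<rho> ^ (k * (i + 2)) * cmod (u j z) ^ (m - i - 2)) + (\<Sum>i\<le>n. \<rho> ^ d)"
    proof (intro add_mono)
      show "cmod (v j z (n + 1) ^ d) \<le> \<rho> ^ d" unfolding norm_power by (rule va) simp
      show "cmod (\<Sum>i\<le>n. v j z i ^ (k * (i + 2)) * u j z ^ (m - i - 2)) \<le> (\<Sum>i\<le>n. \<rho> ^ (k * (i + 2)) * cmod (u j z) ^ (m - i - 2))"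
        by (rule order_trans[OF norm_sum], rule sum_mono, unfold norm_mult norm_power, rule mult_right_mono, rule va) auto
      have "cmod (of_real (\<epsilon> j) * (\<Sum>i\<le>n. v j z i ^ d)) \<le> 1 * (\<Sum>i\<le>n. \<rho> ^ d)"
        unfolding norm_mult
      proof (rule mult_mono)
        have "\<epsilon> j < 1" using \<epsilon>(2)[of j] by (rule less_le_trans) simp
        then show "cmod (of_real (\<epsilon> j)) \<le> 1" using \<epsilon>(1)[of j] by simp
        show "cmod (\<Sum>i\<le>n. v j z i ^ d) \<le> (\<Sum>i\<le>n. \<rho> ^ d)"
          by (rule order_trans[OF norm_sum], rule sum_mono, unfold norm_power, rule va) auto
      qed auto
      then show "cmod (of_real (\<epsilon> j) * (\<Sum>i\<le>n. v j z i ^ d)) \<le> (\<Sum>i\<le>n. \<rho> ^ d)" by simp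
    qed
    finally have "cmod (u j z) ^ m \<le> (real n + 2) * \<rho> ^ (k * m) + (\<Sum>i\<le>n. \<rho> ^ (k * (i + 2)) * cmod (u j z) ^ (m - i - 2))"
      by (simp add: d_def algebra_simps)
    from weighted_root_bound[OF \<rho> m norm_ge_zero this]
    show "cmod (u j z) \<le> (2 * real n + 3) * M ^ k * cmod (v j z i) ^ k" by (simp add: \<rho>_def power_mult_distrib mult.assoc)
  qed
  show False
  proof (rule brody_limit[of "n + 1" v u k, OF vc vs uhol ub])
    fix w Ul assume wc: "entire_curve (n + 1) w" and Uhol: "Ul holomorphic_on UNIV"
      and nonconst: "\<exists>z. proj_point (w z) \<noteq> proj_point (w 0)"
      and lim: "\<And>z. \<exists>i\<le>n + 1. \<exists>r x. strict_mono (r :: nat \<Rightarrow> nat) \<and> w z i \<noteq> 0 \<and> (\<forall>\<^sub>F j in sequentially. v (r j) (x j) i \<noteq> 0) \<and>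
       (\<forall>a\<le>n + 1. (\<lambda>j. v (r j) (x j) a / v (r j) (x j) i) \<longlonglongrightarrow> w z a / w z i) \<and>
       (\<lambda>j. u (r j) (x j) / v (r j) (x j) i ^ k) \<longlonglongrightarrow> Ul z / w z i ^ k"
    interpret w: entire_curve "n + 1" w by (rule wc)
    define \<Psi> where "\<Psi> x b = b ^ m + (\<Sum>i\<le>n. x i ^ (k * (i + 2)) * b ^ (m - i - 2))" for x :: cvec and b :: complex
    \<comment> \<open>Coordinates have weight 1 and u has weight k, so the limit equation is
      compatible with the normalisation in \<open>brody_limit\<close>.\<close>
    have \<Psi>h: "\<Psi> (\<lambda>i. t * x i) (t ^ k * b) = t ^ d * \<Psi> x b" for t x b
      unfolding \<Psi>_def distrib_left[of "t ^ d"] sum_distrib_left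
    proof (intro arg_cong2[where f = "(+)"] sum.cong refl)
      show "(t ^ k * b) ^ m = t ^ d * b ^ m" by (simp add: d_def power_mult_distrib power_mult)
      fix i assume i: "i \<in> {..n}"
      have "k * (i + 2) + k * (m - i - 2) = k * (i + 2 + (m - i - 2))" by (rule distrib_left[symmetric])
      also have "i + 2 + (m - i - 2) = m" using i m by simp
      finally have "t ^ (k * (i + 2)) * t ^ (k * (m - i - 2)) = t ^ d" by (simp add: d_def flip: power_add)
      then show "(t * x i) ^ (k * (i + 2)) * (t ^ k * b) ^ (m - i - 2) = t ^ d * (x i ^ (k * (i + 2)) * b ^ (m - i - 2))"
        by (simp add: power_mult_distrib power_mult[symmetric] mult_ac del: power_Suc)
    qed
    have limeq: "eval_poly F (w z) = 0 \<and> w z (n + 1) ^ d = \<Psi> (w z) (Ul z)" for z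
    proof -
      obtain i0 r x where i0: "i0 \<le> n + 1" and r: "strict_mono (r :: nat \<Rightarrow> nat)" and wi0: "w z i0 \<noteq> 0"
        and vnz: "\<forall>\<^sub>F j in sequentially. v (r j) (x j) i0 \<noteq> 0"
        and la: "\<forall>a\<le>n + 1. (\<lambda>j. v (r j) (x j) a / v (r j) (x j) i0) \<longlonglongrightarrow> w z a / w z i0"
        and lu: "(\<lambda>j. u (r j) (x j) / v (r j) (x j) i0 ^ k) \<longlonglongrightarrow> Ul z / w z i0 ^ k"
        using lim[of z] by (elim exE conjE)
      define t where "t j = 1 / v (r j) (x j) i0" for j
      define t0 where "t0 = 1 / w z i0"
      define P where "P j = (\<lambda>a. t j * v (r j) (x j) a)" for j
      define P0 where "P0 = (\<lambda>a. t0 * w z a)"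
      define b where "b j = t j ^ k * u (r j) (x j)" for j
      define b0 where "b0 = t0 ^ k * Ul z"
      have limP: "(\<lambda>j. P j a) \<longlonglongrightarrow> P0 a" for a
      proof (cases "a \<le> n + 1")
        case True
        then show ?thesis using la by (simp add: P_def P0_def t_def t0_def)
      next
        case False
        then show ?thesis using entire_curve.supp[OF vc] w.supp by (simp add: P_def P0_def)
      qed
      have limb: "b \<longlonglongrightarrow> b0" using lu by (simp add: b_def[abs_def] b0_def t_def t0_def power_divide)
      have inv0: "(\<lambda>j. 1 / complex_of_real (real (Suc (r j)))) \<longlonglongrightarrow> 0"
      proof -
        have "(\<lambda>j. inverse (real (Suc j))) \<longlonglongrightarrow> 0" by (rule LIMSEQ_inverse_real_of_nat)
        from tendsto_of_real[OF LIMSEQ_subseq_LIMSEQ[OF this r], where ?'a = complex] show ?thesis by (simp add: o_def divide_inverse)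
      qed
      \<comment> \<open>F at the normalised points is the convergent sequence \<open>b\<close>
        divided by r j + 1, so F vanishes on the limit curve.\<close>
      have "(\<lambda>j. eval_poly F (P j)) \<longlonglongrightarrow> b0 * 0"
      proof -
        have "(\<lambda>j. b j * (1 / complex_of_real (real (Suc (r j))))) \<longlonglongrightarrow> b0 * 0" by (intro tendsto_mult limb inv0)
        moreover have "b j * (1 / complex_of_real (real (Suc (r j)))) = eval_poly F (P j)" for j
          unfolding P_def eval_poly_scale[OF F] b_def u_def by (simp del: of_nat_Suc)
        ultimately show ?thesis by simp
      qed
      moreover have "(\<lambda>j. eval_poly F (P j)) \<longlonglongrightarrow> eval_poly F P0" by (intro eval_poly_tendsto limP)
      ultimately have "eval_poly F P0 = b0 * 0" by (rule LIMSEQ_unique[rotated])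
      then have "t0 ^ k * eval_poly F (w z) = 0" unfolding P0_def eval_poly_scale[OF F] by simp
      then have F0: "eval_poly F (w z) = 0" using wi0 by (simp add: t0_def)
      have Peq: "P j (n + 1) ^ d = \<Psi> (P j) (b j) + of_real (\<epsilon> (r j)) * (\<Sum>i\<le>n. P j i ^ d)" for j
      proof -
        have "P j (n + 1) ^ d = t j ^ d * v (r j) (x j) (n + 1) ^ d" by (simp add: P_def power_mult_distrib)
        also have "\<dots> = t j ^ d * \<Psi> (v (r j) (x j)) (u (r j) (x j)) + of_real (\<epsilon> (r j)) * (\<Sum>i\<le>n. t j ^ d * v (r j) (x j) i ^ d)"
          unfolding veq \<Psi>_def[symmetric] by (simp add: distrib_left sum_distrib_left mult_ac)
        finally show ?thesis unfolding \<Psi>h[symmetric] by (simp add: P_def b_def power_mult_distrib)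
      qed
      have \<epsilon>0: "(\<lambda>j. complex_of_real (\<epsilon> (r j))) \<longlonglongrightarrow> 0"
      proof -
        have "\<epsilon> \<longlonglongrightarrow> 0"
        proof (rule tendsto_sandwich[of "\<lambda>_. 0" _ _ "\<lambda>j. inverse (real (Suc j))"])
          show "\<forall>\<^sub>F j in sequentially. 0 \<le> \<epsilon> j" using \<epsilon>(1) by (intro always_eventually allI less_imp_le)
          show "\<forall>\<^sub>F j in sequentially. \<epsilon> j \<le> inverse (real (Suc j))"
            using \<epsilon>(2) by (intro always_eventually allI less_imp_le) (simp add: inverse_eq_divide)
        qed (rule tendsto_const LIMSEQ_inverse_real_of_nat)+
        from tendsto_of_real[OF LIMSEQ_subseq_LIMSEQ[OF this r], where ?'a = complex] show ?thesis by (simp add: o_def)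
      qed
      have "(\<lambda>j. \<Psi> (P j) (b j) + of_real (\<epsilon> (r j)) * (\<Sum>i\<le>n. P j i ^ d)) \<longlonglongrightarrow> \<Psi> P0 b0 + 0 * (\<Sum>i\<le>n. P0 i ^ d)"
        unfolding \<Psi>_def by (intro tendsto_intros limP limb \<epsilon>0)
      then have "(\<lambda>j. P j (n + 1) ^ d) \<longlonglongrightarrow> \<Psi> P0 b0" by (simp only: Peq[symmetric] mult_zero_left add_0_right)
      moreover have "(\<lambda>j. P j (n + 1) ^ d) \<longlonglongrightarrow> P0 (n + 1) ^ d" by (intro tendsto_power limP)
      ultimately have "P0 (n + 1) ^ d = \<Psi> P0 b0" by (rule LIMSEQ_unique[rotated])
      then have "t0 ^ d * w z (n + 1) ^ d = t0 ^ d * \<Psi> (w z) (Ul z)"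
        unfolding P0_def b0_def \<Psi>h by (simp add: power_mult_distrib)
      then show ?thesis using F0 wi0 by (simp add: t0_def)
    qed
    \<comment> \<open>The limit curve projected from (0 : ... : 0 : 1). Its coordinates may vanish
      simultaneously at some points, which is why hyperbolicity is used in the form of
      \<open>brody_hyperbolic_cone_map\<close>.\<close>
    define x where "x z = (\<lambda>a. if a \<le> n then w z a else 0)" for z
    have "\<exists>z a. x z a \<noteq> 0"
    proof (rule ccontr)
      \<comment> \<open>Otherwise the limit curve would stay at the centre of projection.\<close>
      assume x0: "\<not> ?thesis"
      have w0: "w z a = 0" if "a \<noteq> n + 1" for z a
      proof (cases "a \<le> n")
        case True
        have "x z a = 0" using x0 by blast
        with True show ?thesis by (simp add: x_def)
      next
        case False
        then show ?thesis using that w.supp[of a z] by simp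
      qed
      have wn: "w z (n + 1) \<noteq> 0" for z
      proof
        assume "w z (n + 1) = 0"
        then have "w z a = 0" for a using w0[of a z] by (cases "a = n + 1") auto
        then show False using w.nz[of z] by (auto simp: nonzero_vecs_def)
      qed
      have "proj_point (w z) = proj_point (w 0)" for z
        unfolding proj_point_eq_iff
      proof (intro exI conjI ext)
        show "w z (n + 1) / w 0 (n + 1) \<noteq> 0" using wn by simp
        show "w z a = w z (n + 1) / w 0 (n + 1) * w 0 a" for a using w0[of a] wn[of 0] by (cases "a = n + 1") auto
      qed
      then show False using nonconst by blast
    qed
    then obtain z0 a0 where za: "x z0 a0 \<noteq> 0" by blast
    have evx: "eval_poly F (x z) = 0" for z
    proof -
      have "eval_poly F (x z) = eval_poly F (w z)" by (rule eval_poly_cong[OF F]) (simp add: x_def)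
      then show ?thesis using limeq by simp
    qed
    show False
    proof (rule brody_hyperbolic_cone_map[OF hyp, of x z0 a0])
      show "(\<lambda>z. x z i) holomorphic_on UNIV" for i unfolding x_def by (cases "i \<le> n") (auto intro: w.hol)
      show "x z i = 0" if "i > n" for z i using that by (simp add: x_def)
      show "x z0 a0 \<noteq> 0" by (rule za)
      show "proj_point (x z) \<in> zero_locus n (proj_form F)" if "x z \<in> nonzero_vecs n" for z
        unfolding mem_zero_locus_iff[OF F that] by (rule evx)
    next
      fix y z assume ya: "\<And>i. (\<lambda>w. y w i) analytic_on {z::complex}" and yz: "y z \<in> nonzero_vecs n"
        and ev: "\<forall>\<^sub>F w in at z. proj_point (y w) \<in> zero_locus n (proj_form F)"
      have lim: "((\<lambda>w. y w i) \<longlongrightarrow> y z i) (at z)" for i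
        using analytic_at_imp_isCont[OF ya] by (rule isContD)
      have "\<exists>i\<le>n. y z i \<noteq> 0" using yz by (simp add: nonzero_vecs_def)
      have ev0: "\<forall>\<^sub>F w in at z. eval_poly F (y w) = 0"
        using ev
      proof (rule eventually_mono)
        fix w assume "proj_point (y w) \<in> zero_locus n (proj_form F)"
        then have "\<exists>u. proj_point (y w) = proj_point u \<and> u \<in> nonzero_vecs n \<and> (\<forall>G\<in>proj_form F. eval_poly G u = 0)"
          unfolding zero_locus_def by (rule CollectD)
        then obtain u where u: "proj_point (y w) = proj_point u" "u \<in> nonzero_vecs n" "\<forall>G\<in>proj_form F. eval_poly G u = 0"
          by (elim exE conjE)
        have "eval_poly (Poly_Mapping.map ((*) 1) F) u = 0" using u(3) map_one_mem_proj_form by (rule bspec)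
        moreover obtain \<mu> where "\<mu> \<noteq> 0 \<and> y w = (\<lambda>i. \<mu> * u i)" using u(1) unfolding proj_point_eq_iff by (rule exE)
        ultimately show "eval_poly F (y w) = 0" by (simp add: eval_poly_scale[OF F])
      qed
      have "((\<lambda>w. eval_poly F (y w)) \<longlongrightarrow> eval_poly F (y z)) (at z)" by (intro eval_poly_tendsto lim)
      moreover have "((\<lambda>w. eval_poly F (y w)) \<longlongrightarrow> 0) (at z)" by (rule tendsto_eventually[OF ev0])
      ultimately have "eval_poly F (y z) = 0" by (rule LIM_unique)
      then show "proj_point (y z) \<in> zero_locus n (proj_form F)" using mem_zero_locus_iff[OF F yz] by simp
    next
      fix c \<xi> assume c: "c holomorphic_on UNIV" and \<xi>: "\<xi> \<in> nonzero_vecs n" and xc: "\<And>z i. x z i = c z * \<xi> i"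
      have wc': "w z i = c z * \<xi> i" if "i \<le> n" for z i using xc[of z i] that by (simp add: x_def)
      obtain i0 where i0: "i0 \<le> n" "\<xi> i0 \<noteq> 0" using \<xi> by (auto simp: nonzero_vecs_def)
      have nocom: "c z \<noteq> 0 \<or> w z (n + 1) \<noteq> 0" for z
      proof (rule ccontr)
        assume n0: "\<not> ?thesis"
        have "w z a = 0" if "a \<le> n + 1" for a
        proof (cases "a \<le> n")
          case True
          then show ?thesis using wc'[of a z] n0 by simp
        next
          case False
          with that have "a = n + 1" by simp
          then show ?thesis using n0 by simp
        qed
        then show False using w.nz[of z] by (auto simp: nonzero_vecs_def)
      qed
      \<comment> \<open>Over the fixed point \<xi> the coefficients become the constants \<xi>_i^(k
        (i + 2)), and a nonzero entry of \<xi> provides a nonzero one.\<close>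
      have "\<exists>\<kappa>. \<forall>z. w z (n + 1) ^ (k * m) = \<kappa> * c z ^ (k * m)"
      proof (rule fibre_curve_constant[OF c w.hol Uhol _ nocom _ i0(1) _ k m, of "\<lambda>i. \<xi> i ^ (k * (i + 2))" z0])
        fix z
        have "w z (n + 1) ^ (k * m) = Ul z ^ m + (\<Sum>i\<le>n. w z i ^ (k * (i + 2)) * Ul z ^ (m - i - 2))"
          using limeq[of z] by (simp add: d_def \<Psi>_def)
        also have "(\<Sum>i\<le>n. w z i ^ (k * (i + 2)) * Ul z ^ (m - i - 2)) = (\<Sum>i\<le>n. \<xi> i ^ (k * (i + 2)) * (c z ^ k) ^ (i + 2) * Ul z ^ (m - i - 2))"
        proof (intro sum.cong refl arg_cong2[where f = "(*)"])
          fix i assume "i \<in> {..n}"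
          then have "w z i = \<xi> i * c z" using wc' by simp
          then show "w z i ^ (k * (i + 2)) = \<xi> i ^ (k * (i + 2)) * (c z ^ k) ^ (i + 2)"
            by (simp only: power_mult_distrib power_mult[of "c z"])
        qed
        finally show "w z (n + 1) ^ (k * m) = Ul z ^ m + (\<Sum>i\<le>n. \<xi> i ^ (k * (i + 2)) * (c z ^ k) ^ (i + 2) * Ul z ^ (m - i - 2))" .
      next
        show "c z0 \<noteq> 0" using za xc by auto
        show "\<xi> i0 ^ (k * (i0 + 2)) \<noteq> 0" using i0 by simp
      qed
      then obtain \<kappa> where \<kappa>: "\<And>z. w z (n + 1) ^ d = \<kappa> * c z ^ d" unfolding d_def by blast
      have cnz: "c z \<noteq> 0" for z
      proof
        assume c0: "c z = 0"
        then have "w z (n + 1) ^ d = 0" using \<kappa>[of z] d2 by simp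
        then show False using nocom[of z] c0 by auto
      qed
      have "proj_point (w z) = proj_point (w 0)" for z
      proof (rule w.constant_of_powers_proportional[of i0 d])
        show "w z i0 \<noteq> 0" for z using wc'[OF i0(1)] cnz i0(2) by simp
        show "d > 0" by (rule d2(2))
        fix j assume j: "j \<le> n + 1"
        show "\<exists>\<mu>. \<forall>z. w z j ^ d = \<mu> * w z i0 ^ d"
        proof (cases "j \<le> n")
          case True
          then show ?thesis using i0 by (intro exI[of _ "\<xi> j ^ d / \<xi> i0 ^ d"]) (simp add: wc' power_mult_distrib)
        next
          case False
          with j have "j = n + 1" by simp
          then show ?thesis using i0 \<kappa> by (intro exI[of _ "\<kappa> / \<xi> i0 ^ d"]) (simp add: wc' power_mult_distrib)
        qed
      qed
      then show False using nonconst by blast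
    qed
  qed
qed

theorem theorem22:
  fixes n k \<delta> :: nat
  assumes "0 < n" and "0 < k" and "0 < \<delta>" and "k dvd \<delta>"
    and "(H n k \<noteq> {} \<and> \<delta> \<ge> (n + 3) * k) \<or> (HE n k \<inter> H n k \<noteq> {} \<and> \<delta> \<ge> (n + 2) * k)"
  shows "\<exists>W \<in> hypersurfaces (n + 1) \<delta>.
           smooth_hypersurface (n + 1) W \<and>
           brody_hyperbolic (n + 1) (zero_locus (n + 1) W) \<and>
           (\<exists>A. linear_projection n A \<and> cyclic_cover n \<delta> A (zero_locus (n + 1) W))"
proof -
  obtain m where m: "\<delta> = k * m" using assms(4) by (rule dvdE)
  have Hne: "H n k \<noteq> {}" using assms(5) by blast
  have mge: "m \<ge> n + 2"
  proof -
    have "(n + 2) * k \<le> (n + 3) * k" by (rule mult_le_mono1) simp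
    then have "(n + 2) * k \<le> \<delta>" using assms(5) by (elim disjE conjE) (rule order_trans, assumption+)
    then show ?thesis using assms(2) by (simp only: m mult.commute[of k] mult_le_cancel2)
  qed
  show ?thesis
  proof (cases "n = 1")
    case False
    then have n: "n \<ge> 2" using assms(1) by simp
    obtain X where X: "X \<in> hypersurfaces n k" "brody_hyperbolic n (zero_locus n X)" using Hne by (auto simp: H_def)
    obtain F where F: "F \<in> forms n k" "X = proj_form F" using X(1) by (rule hypersurfacesE)
    have hyp: "brody_hyperbolic n (zero_locus n (proj_form F))" using X(2) F(2) by simp
    have "k \<ge> 3" by (rule hyperbolic_hypersurface_degree[OF F(1) assms(2) n hyp])
    from hyperbolic_cyclic_cover_exists[OF n this mge F(1) hyp] show ?thesis unfolding m .
  next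
    case True
    \<comment> \<open>For k = 1 the second alternative is void, and the first one gives \<delta>
      \<ge> 4. For k \<ge> 2, m \<ge> 3 gives \<delta> \<ge> 6.\<close>
    have d4: "\<delta> \<ge> 4"
    proof (cases "k = 1")
      case k1: True
      then have "HE n k = {}" using HE_1_1_empty True by simp
      then show ?thesis using assms(5) True k1 by simp
    next
      case False
      then have "2 * 3 \<le> k * m" using mge True assms(2) by (intro mult_le_mono) auto
      then show ?thesis unfolding m by simp
    qed
    have hyp: "brody_hyperbolic (1 + 1) (zero_locus (1 + 1) (proj_form (cover_poly 1 \<delta> (fermat_poly 1 \<delta>))))"
      using fermat_curve_hyperbolic[OF d4] by (simp add: numeral_2_eq_2)
    show ?thesis unfolding True
    proof (rule cyclic_hypersurface[OF fermat_poly_forms _ _ hyp])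
      show "\<delta> \<ge> 2" using d4 by simp
      fix v assume "v \<in> nonzero_vecs 1"
      then obtain i where "i \<le> 1" "v i \<noteq> 0" by (auto simp: nonzero_vecs_def)
      then show "\<exists>i\<le>1. poly_partial i (fermat_poly 1 \<delta>) v \<noteq> 0"
        using d4 by (intro exI[of _ i]) (simp add: poly_partial_fermat)
    qed
  qed
qed

end
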